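(* Let $G$ be a topological group and let $d$ be a metrically proper compatible left-invariant metric on $G$. Suppose that, for all $\alpha>0$, there is a continuous weakly almost periodic function $\phi\in\ell^\infty(G)$ with $d$-bounded support so that $\phi\equiv 1$ on the ball $D_\alpha=\{g\in G : d(g,1)\leqslant\alpha\}$. Then $G$ admits a metrically proper continuous affine isometric action on a reflexive Banach space.
   Context: A metric on a topological group $G$ is compatible if it induces the topology of $G$, and left-invariant if $d(hg,hf)=d(g,f)$ for all $g,f,h\in G$. A sequence $(g_n)$ in $G$ tends to infinity, written $g_n\to\infty$, if there is a compatible left-invariant metric $\partial$ on $G$ with $\partial(g_n,1)\to\infty$. A compatible left-invariant metric $d$ is metrically proper if $d(g_n,1)\to\infty$ whenever $g_n\to\infty$. A bounded function $\phi\colon G\to\mathbb{R}$ is weakly almost periodic if $\{\phi(g^{-1}\,\cdot\,) : g\in G\}$ is a relatively weakly compact subset of $\ell^\infty(G)$ (the bounded real-valued functions on $G$ with the supremum norm). An affine isometric action of $G$ on a Banach space $X$ is an action $\alpha$ of the form $\alpha(g)\xi=\pi(g)\xi+b(g)$, where $\pi$ is a representation of $G$ by invertible linear isometries of $X$ and $b\colon G\to X$ satisfies $b(gf)=\pi(g)b(f)+b(g)$. The action is metrically proper if for all $\xi\in X$ one has $\|\alpha(g_n)\xi-\xi\|\to\infty$ whenever $g_n\to\infty$ in $G$. *)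

theory Defs
  imports "HOL-Analysis.Analysis" "HOL-Library.Function_Algebras"
begin

instantiation "fun" :: (type, real_vector) real_vector
begin

definition scaleR_fun :: "real \<Rightarrow> ('a \<Rightarrow> 'b) \<Rightarrow> 'a \<Rightarrow> 'b"
  where "scaleR_fun c f = (\<lambda>x. c *\<^sub>R f x)"

instance
  by standard (simp_all add: scaleR_fun_def fun_eq_iff plus_fun_def algebra_simps)

end

text \<open>
  A topological group is a type of class \<open>topological_group_add\<close>: this class does not assume
  commutativity, but it is written additively, so the unit is \<open>0\<close>, the product \<open>gf\<close> is
  \<open>g + f\<close> and the inverse of \<open>g\<close> is \<open>- g\<close>.
\<close>

definition compatible_metric :: "('a::topological_space \<Rightarrow> 'a \<Rightarrow> real) \<Rightarrow> bool"
  where "compatible_metric d \<longleftrightarrow>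
    Metric_space UNIV d \<and> Metric_space.mtopology UNIV d = (euclidean :: 'a topology)"

definition left_invariant :: "('a::group_add \<Rightarrow> 'a \<Rightarrow> real) \<Rightarrow> bool"
  where "left_invariant d \<longleftrightarrow> (\<forall>g f h. d (h + g) (h + f) = d g f)"

definition tends_to_infinity :: "(nat \<Rightarrow> 'a::topological_group_add) \<Rightarrow> bool"
  where "tends_to_infinity g \<longleftrightarrow>
    (\<exists>\<delta>. compatible_metric \<delta> \<and> left_invariant \<delta> \<and>
      filterlim (\<lambda>n. \<delta> (g n) 0) at_top sequentially)"

definition metrically_proper_metric :: "('a::topological_group_add \<Rightarrow> 'a \<Rightarrow> real) \<Rightarrow> bool"
  where "metrically_proper_metric d \<longleftrightarrow>
    compatible_metric d \<and> left_invariant d \<and>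
    (\<forall>g. tends_to_infinity g \<longrightarrow> filterlim (\<lambda>n. d (g n) 0) at_top sequentially)"

text \<open>
  A real normed space is a pair of a linear subspace \<open>V\<close> of some real vector space and a norm
  \<open>N\<close> on \<open>V\<close>; the values of \<open>N\<close> outside \<open>V\<close> are irrelevant. The ambient space carries no
  topology, so this loses no generality, and it allows quantification over normed spaces and
  the formation of dual spaces within the logic.
\<close>

definition normed_space_on :: "'b::real_vector set \<Rightarrow> ('b \<Rightarrow> real) \<Rightarrow> bool"
  where "normed_space_on V N \<longleftrightarrow>
    subspace V \<and>
    (\<forall>x\<in>V. 0 \<le> N x \<and> (N x = 0 \<longleftrightarrow> x = 0)) \<and>
    (\<forall>c. \<forall>x\<in>V. N (c *\<^sub>R x) = \<bar>c\<bar> * N x) \<and>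
    (\<forall>x\<in>V. \<forall>y\<in>V. N (x + y) \<le> N x + N y)"

text \<open>
  The locale \<open>Metric_space\<close> requires nonnegativity and symmetry also outside the carrier, hence
  the value \<open>0\<close> there.
\<close>

definition norm_dist :: "'b::real_vector set \<Rightarrow> ('b \<Rightarrow> real) \<Rightarrow> 'b \<Rightarrow> 'b \<Rightarrow> real"
  where "norm_dist V N x y = (if x \<in> V \<and> y \<in> V then N (x - y) else 0)"

lemma Metric_space_norm_dist:
  assumes "normed_space_on V N"
  shows "Metric_space V (norm_dist V N)"
proof
  have s: "subspace V" using assms by (simp add: normed_space_on_def)
  have d: "x - y \<in> V" if "x \<in> V" "y \<in> V" for x y using s that by (simp add: subspace_diff)
  have nonneg: "0 \<le> N x" and zero: "N x = 0 \<longleftrightarrow> x = 0" if "x \<in> V" for x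
    using assms that unfolding normed_space_on_def by blast+
  have scale: "N (c *\<^sub>R x) = \<bar>c\<bar> * N x" if "x \<in> V" for c x
    using assms that unfolding normed_space_on_def by blast
  have triangle: "N (x + y) \<le> N x + N y" if "x \<in> V" "y \<in> V" for x y
    using assms that unfolding normed_space_on_def by blast
  fix x y z
  show "0 \<le> norm_dist V N x y"
    by (simp add: norm_dist_def nonneg d)
  have "N (x - y) = N (y - x)" if "x \<in> V" "y \<in> V"
  proof -
    have "N ((- 1) *\<^sub>R (y - x)) = N (y - x)"
      using scale[OF d[OF that(2,1)], of "- 1"] by simp
    then show ?thesis by simp
  qed
  then show "norm_dist V N x y = norm_dist V N y x"
    by (simp add: norm_dist_def)
  show "(norm_dist V N x y = 0) = (x = y)" if "x \<in> V" "y \<in> V"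
    using that by (simp add: norm_dist_def zero d)
  show "norm_dist V N x z \<le> norm_dist V N x y + norm_dist V N y z"
    if "x \<in> V" "y \<in> V" "z \<in> V"
  proof -
    have "N ((x - y) + (y - z)) \<le> N (x - y) + N (y - z)"
      by (rule triangle[OF d[OF that(1,2)] d[OF that(2,3)]])
    then show ?thesis using that by (simp add: norm_dist_def)
  qed
qed

abbreviation norm_topology :: "'b::real_vector set \<Rightarrow> ('b \<Rightarrow> real) \<Rightarrow> 'b topology"
  where "norm_topology V N \<equiv> Metric_space.mtopology V (norm_dist V N)"

definition banach_space_on :: "'b::real_vector set \<Rightarrow> ('b \<Rightarrow> real) \<Rightarrow> bool"
  where "banach_space_on V N \<longleftrightarrow>
    normed_space_on V N \<and> Metric_space.mcomplete V (norm_dist V N)"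

definition linear_map_on ::
    "'b::real_vector set \<Rightarrow> 'c::real_vector set \<Rightarrow> ('b \<Rightarrow> 'c) \<Rightarrow> bool"
  where "linear_map_on V W f \<longleftrightarrow>
    f ` V \<subseteq> W \<and>
    (\<forall>x\<in>V. \<forall>y\<in>V. f (x + y) = f x + f y) \<and>
    (\<forall>c. \<forall>x\<in>V. f (c *\<^sub>R x) = c *\<^sub>R f x)"

text \<open>
  Functionals on \<open>V\<close> are extended by \<open>0\<close> outside \<open>V\<close>, so that each of them is represented by
  exactly one function and the dual is again a linear subspace.
\<close>

definition dual_space :: "'b::real_vector set \<Rightarrow> ('b \<Rightarrow> real) \<Rightarrow> ('b \<Rightarrow> real) set"
  where "dual_space V N =
    {f. linear_map_on V UNIV f \<and> (\<exists>K. \<forall>x\<in>V. \<bar>f x\<bar> \<le> K * N x) \<and> (\<forall>x. x \<notin> V \<longrightarrow> f x = 0)}"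

definition dual_norm :: "'b::real_vector set \<Rightarrow> ('b \<Rightarrow> real) \<Rightarrow> ('b \<Rightarrow> real) \<Rightarrow> real"
  where "dual_norm V N f = (SUP x\<in>{x\<in>V. N x \<le> 1}. \<bar>f x\<bar>)"

text \<open>Reflexivity: the canonical embedding into the bidual is surjective.\<close>

definition reflexive_on :: "'b::real_vector set \<Rightarrow> ('b \<Rightarrow> real) \<Rightarrow> bool"
  where "reflexive_on V N \<longleftrightarrow>
    (\<forall>\<Phi>\<in>dual_space (dual_space V N) (dual_norm V N). \<exists>x\<in>V. \<forall>f\<in>dual_space V N. \<Phi> f = f x)"

definition weak_topology :: "'b::real_vector set \<Rightarrow> ('b \<Rightarrow> real) \<Rightarrow> 'b topology"
  where "weak_topology V N =
    topology_generated_by {{x\<in>V. f x \<in> U} | f U. f \<in> dual_space V N \<and> open U}"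

definition relatively_weakly_compact ::
    "'b::real_vector set \<Rightarrow> ('b \<Rightarrow> real) \<Rightarrow> 'b set \<Rightarrow> bool"
  where "relatively_weakly_compact V N S \<longleftrightarrow>
    S \<subseteq> V \<and> compactin (weak_topology V N) (weak_topology V N closure_of S)"

definition linf :: "('a \<Rightarrow> real) set"
  where "linf = {\<phi>. bounded (range \<phi>)}"

definition linf_norm :: "('a \<Rightarrow> real) \<Rightarrow> real"
  where "linf_norm \<phi> = (SUP x. \<bar>\<phi> x\<bar>)"

definition weakly_almost_periodic :: "('a::group_add \<Rightarrow> real) \<Rightarrow> bool"
  where "weakly_almost_periodic \<phi> \<longleftrightarrow>
    \<phi> \<in> linf \<and> relatively_weakly_compact linf linf_norm (range (\<lambda>g x. \<phi> (- g + x)))"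

definition isometric_representation ::
    "'b::real_vector set \<Rightarrow> ('b \<Rightarrow> real) \<Rightarrow> ('a::group_add \<Rightarrow> 'b \<Rightarrow> 'b) \<Rightarrow> bool"
  where "isometric_representation V N \<pi> \<longleftrightarrow>
    (\<forall>g. linear_map_on V V (\<pi> g) \<and> bij_betw (\<pi> g) V V \<and> (\<forall>\<xi>\<in>V. N (\<pi> g \<xi>) = N \<xi>)) \<and>
    (\<forall>\<xi>\<in>V. \<pi> 0 \<xi> = \<xi>) \<and>
    (\<forall>g f. \<forall>\<xi>\<in>V. \<pi> (g + f) \<xi> = \<pi> g (\<pi> f \<xi>))"

definition affine_isometric_action ::
    "'b::real_vector set \<Rightarrow> ('b \<Rightarrow> real) \<Rightarrow> ('a::group_add \<Rightarrow> 'b \<Rightarrow> 'b) \<Rightarrow> bool"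
  where "affine_isometric_action V N \<alpha> \<longleftrightarrow>
    (\<forall>g. \<forall>\<xi>\<in>V. \<alpha> g \<xi> \<in> V) \<and>
    (\<forall>\<xi>\<in>V. \<alpha> 0 \<xi> = \<xi>) \<and>
    (\<forall>g f. \<forall>\<xi>\<in>V. \<alpha> (g + f) \<xi> = \<alpha> g (\<alpha> f \<xi>)) \<and>
    (\<exists>\<pi> b. isometric_representation V N \<pi> \<and>
      (\<forall>g. b g \<in> V) \<and>
      (\<forall>g f. b (g + f) = \<pi> g (b f) + b g) \<and>
      (\<forall>g. \<forall>\<xi>\<in>V. \<alpha> g \<xi> = \<pi> g \<xi> + b g))"

definition continuous_action ::
    "'b::real_vector set \<Rightarrow> ('b \<Rightarrow> real) \<Rightarrow> ('a::topological_space \<Rightarrow> 'b \<Rightarrow> 'b) \<Rightarrow> bool"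
  where "continuous_action V N \<alpha> \<longleftrightarrow>
    continuous_map (prod_topology euclidean (norm_topology V N)) (norm_topology V N)
      (\<lambda>(g, \<xi>). \<alpha> g \<xi>)"

definition metrically_proper_action ::
    "'b::real_vector set \<Rightarrow> ('b \<Rightarrow> real) \<Rightarrow> ('a::topological_group_add \<Rightarrow> 'b \<Rightarrow> 'b) \<Rightarrow> bool"
  where "metrically_proper_action V N \<alpha> \<longleftrightarrow>
    (\<forall>\<xi>\<in>V. \<forall>g. tends_to_infinity g \<longrightarrow>
      filterlim (\<lambda>n. N (\<alpha> (g n) \<xi> - \<xi>)) at_top sequentially)"

text \<open>
  The logic cannot quantify existentially over types. A Banach space with an affine isometric
  action of a group of type \<open>'a\<close> is therefore sought inside the fixed vector
  space of functions \<open>nat \<Rightarrow> 'a \<Rightarrow> real\<close>. This is no restriction up to isometric isomorphism: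
  an action on a Banach space restricts to an action, with the same properties, on
  the closed linear span of the orbit of \<open>0\<close>, which has at most
  \<open>max(2^aleph_0, |G|^aleph_0)\<close> elements, while the ambient space has dimension at least
  that (for \<open>G\<close> finite no sequence tends to infinity, and the zero space will do).
\<close>

end

theory Submission
  imports Defs
begin

text \<open>
  Averaging \<open>k\<close> truncated cut-off functions on nested shells gives weakly almost periodic
  functions \<open>\<psi> n\<close> with \<open>d\<close>-bounded support and value one at the unit which move by at most
  \<open>1 / 16 ^ n\<close> in the uniform norm under translation by elements of length at most \<open>n\<close>. Let \<open>X n\<close> be
  the Davis-Figiel-Johnson-Pelczynski interpolation space between the hull of the orbit of \<open>\<psi> n\<close> and
  the uniform norm. Since \<open>translate g (\<psi> n) - \<psi> n\<close> lies in that hull and is uniformly small, it is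
  small in \<open>X n\<close>; hence \<open>g \<mapsto> (translate g (\<psi> n) - \<psi> n)\<^sub>n\<close> is a cocycle with values in the
  \<open>l\<^sup>2\<close>-sum of the \<open>X n\<close>, and it is proper because each of its coordinates has norm at least \<open>1/2\<close>
  once \<open>g\<close> has left the support of \<open>\<psi> n\<close>.

  Reflexivity is obtained without dual spaces: all that is used of a weakly compact convex set is
  that a downward directed family of convex subsets has members meeting arbitrarily small balls in
  common (\<open>convexly_compact\<close>). This passes to sums and uniform approximations, and to \<open>l\<^sup>2\<close>-sums by a
  minimal norm argument; together with Goldstine's theorem it implies reflexivity. For the hull of
  an orbit it follows from the double limit condition by Ptak's combinatorial lemma, which replaces
  Krein's theorem.
\<close>

section \<open>Convex bases and the double limit condition\<close>

text \<open>A single cut-off function \<open>\<phi>\<close> yields only the bounded cocycle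
  \<open>translate g \<phi> - \<phi>\<close>. Properness requires infinitely many cut-offs side by
  side, and then the difficulty is convergence of the sum at every \<open>g\<close>. Neither
  available estimate suffices alone: membership in the hull gives the decay \<open>1 / 2 ^ m\<close>
  in the scale \<open>m\<close> of the interpolation norm but nothing in \<open>n\<close>, while the
  uniform bound is small in \<open>n\<close> but enters the seminorm of scale \<open>m\<close> with
  the factor \<open>2 ^ m\<close>. The rate \<open>1 / 16 ^ n\<close> lets the uniform bound win for
  \<open>m < 2 * n\<close> and the hull bound otherwise.

  A second obstacle is continuity of the action: a bounded continuous function need not have a norm
  continuous orbit map. For weakly almost periodic functions this is true, and it is derived from
  the same double limit condition as reflexivity. That condition is also what is kept of weak almost
  periodicity after truncation to the unit interval, which ensures that a sum of nested cut-offs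
  moves by at most one at each point.\<close>

lemma scaleR_fun_apply: "(c *\<^sub>R f) x = c *\<^sub>R f x"
  by (simp add: scaleR_fun_def)

lemma nhds_pointwise:
  fixes f :: "'s \<Rightarrow> real"
  shows "((\<lambda>h. h s) \<longlongrightarrow> f s) (nhds f)"
proof (rule topological_tendstoI)
  fix T assume "open T" "f s \<in> T"
  moreover have "open ((\<lambda>h :: 's \<Rightarrow> real. h s) -` T)"
    using \<open>open T\<close> by (intro open_vimage continuous_on_product_coordinates)
  ultimately show "eventually (\<lambda>h. h s \<in> T) (nhds f)"
    unfolding eventually_nhds by (intro exI[of _ "(\<lambda>h. h s) -` T"]) auto
qed

lemma abs_convex_bound_le:
  fixes x y :: real
  assumes "\<bar>x\<bar> \<le> c" "\<bar>y\<bar> \<le> c" "0 \<le> a" "0 \<le> b" "a + b = 1"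
  shows "\<bar>a * x + b * y\<bar> \<le> c"
proof -
  have "\<bar>a * x + b * y\<bar> \<le> a * \<bar>x\<bar> + b * \<bar>y\<bar>"
    using assms by (intro order_trans[OF abs_triangle_ineq]) (simp add: abs_mult)
  also have "\<dots> \<le> c" using assms by (intro convex_bound_le)
  finally show ?thesis .
qed

lemma compact_pointwise_bounded:
  fixes M :: "'s \<Rightarrow> real"
  shows "compact {h :: 's \<Rightarrow> real. \<forall>s. \<bar>h s\<bar> \<le> M s}"
proof -
  have "{h :: 's \<Rightarrow> real. \<forall>s. \<bar>h s\<bar> \<le> M s} = PiE UNIV (\<lambda>s. {- M s..M s})"
    by (auto simp: PiE_iff abs_le_iff minus_le_iff)
  moreover have "compactin (product_topology (\<lambda>_. euclidean) UNIV) (PiE UNIV (\<lambda>s. {- M s..M s}))"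
    by (simp add: compactin_PiE)
  ultimately show ?thesis
    by (simp add: euclidean_product_topology flip: compactin_euclidean_iff)
qed

text \<open>By Tychonoff the family has a cluster point in a product of compact intervals; adding
  the pulled back neighbourhoods of that point to \<open>F\<close> makes it the limit. Filters take
  the place of subsequences because \<open>S\<close> may be uncountable.\<close>

lemma pointwise_convergent_refinement:
  fixes B :: "'p \<Rightarrow> 's \<Rightarrow> real"
  assumes "F \<noteq> bot" and "eventually (\<lambda>p. \<forall>s\<in>S. \<bar>B p s\<bar> \<le> M s) F"
  obtains F' f where "F' \<le> F" "F' \<noteq> bot" "\<And>s. s \<in> S \<Longrightarrow> ((\<lambda>p. B p s) \<longlongrightarrow> f s) F'"
proof -
  \<comment> \<open>The bound holds only on \<open>S\<close>, so the functions are put to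
    \<open>0\<close> elsewhere, and \<open>K\<close> uses \<open>\<bar>M s\<bar>\<close> because
    \<open>M\<close> may be negative there.\<close>
  define R where "R p s = (if s \<in> S then B p s else 0)" for p s
  define K where "K = {h :: 's \<Rightarrow> real. \<forall>s. \<bar>h s\<bar> \<le> \<bar>M s\<bar>}"
  have "filtermap R F \<noteq> bot" using assms(1) by (simp add: filtermap_bot_iff)
  moreover have "eventually (\<lambda>h. h \<in> K) (filtermap R F)"
    unfolding eventually_filtermap
    by (rule eventually_mono[OF assms(2)]) (force simp: K_def R_def)
  ultimately obtain f where f: "inf (nhds f) (filtermap R F) \<noteq> bot"
    using compact_pointwise_bounded[of "\<lambda>s. \<bar>M s\<bar>"] unfolding compact_filter K_def by blast
  define F' where "F' = inf F (filtercomap R (nhds f))"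
  have "F' \<noteq> bot"
  proof
    assume "F' = bot"
    then have "eventually (\<lambda>_. False) F'" by simp
    then obtain P Q where P: "eventually P F" and Q: "eventually Q (filtercomap R (nhds f))"
      and PQ: "\<And>p. P p \<Longrightarrow> Q p \<Longrightarrow> False"
      unfolding F'_def eventually_inf by blast
    obtain Q' where Q': "eventually Q' (nhds f)" "\<And>p. Q' (R p) \<Longrightarrow> Q p"
      using Q unfolding eventually_filtercomap by blast
    have "eventually (\<lambda>h. h \<in> R ` Collect P) (filtermap R F)"
      unfolding eventually_filtermap by (rule eventually_mono[OF P]) auto
    then have "eventually (\<lambda>_. False) (inf (nhds f) (filtermap R F))"
      unfolding eventually_inf using Q' PQ by blast
    then show False using f by (simp add: eventually_False)
  qed
  moreover have "((\<lambda>p. B p s) \<longlongrightarrow> f s) F'" if "s \<in> S" for s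
  proof -
    have "filterlim R (nhds f) F'"
      unfolding filterlim_iff_le_filtercomap F'_def by simp
    then have "((\<lambda>p. R p s) \<longlongrightarrow> f s) F'"
      by (rule filterlim_compose[OF nhds_pointwise])
    then show ?thesis using that by (simp add: R_def)
  qed
  ultimately show ?thesis using that[of F' f] by (simp add: F'_def)
qed

text \<open>A filter base of convex sets. Keeping the members convex means that means of points of a
  member stay in that member, so uniform approximation by means becomes approximation by points of
  every member.\<close>

definition convex_base :: "'b::real_vector set set \<Rightarrow> bool"
  where "convex_base \<C> \<longleftrightarrow> \<C> \<noteq> {} \<and> (\<forall>C\<in>\<C>. convex C \<and> C \<noteq> {}) \<and>
    (\<forall>C\<in>\<C>. \<forall>D\<in>\<C>. \<exists>E\<in>\<C>. E \<subseteq> C \<inter> D)"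

lemma convex_baseD:
  assumes "convex_base \<C>"
  shows "\<C> \<noteq> {}" "C \<in> \<C> \<Longrightarrow> convex C" "C \<in> \<C> \<Longrightarrow> C \<noteq> {}"
    "C \<in> \<C> \<Longrightarrow> D \<in> \<C> \<Longrightarrow> \<exists>E\<in>\<C>. E \<subseteq> C \<and> E \<subseteq> D"
  using assms by (simp_all add: convex_base_def)

text \<open>\<open>\<Psi>\<close> acts on sets rather than points, which covers traces on a fixed
  set, coordinates of sums and the relation of being close to some point of
  \<open>C\<close>.\<close>

lemma convex_base_image:
  assumes "convex_base \<C>" and "\<And>C D. C \<subseteq> D \<Longrightarrow> \<Psi> C \<subseteq> \<Psi> D"
    and "\<And>C. C \<in> \<C> \<Longrightarrow> convex (\<Psi> C)" and "\<And>C. C \<in> \<C> \<Longrightarrow> \<Psi> C \<noteq> {}"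
  shows "convex_base (\<Psi> ` \<C>)"
  unfolding convex_base_def
proof (intro conjI ballI)
  show "\<Psi> ` \<C> \<noteq> {}" using assms(1) by (auto simp: convex_base_def)
  fix C' D' assume "C' \<in> \<Psi> ` \<C>" "D' \<in> \<Psi> ` \<C>"
  then obtain C D where CD: "C \<in> \<C>" "D \<in> \<C>" "C' = \<Psi> C" "D' = \<Psi> D" by blast
  then obtain E where "E \<in> \<C>" "E \<subseteq> C" "E \<subseteq> D" using convex_baseD(4)[OF assms(1)] by meson
  then show "\<exists>E'\<in>\<Psi> ` \<C>. E' \<subseteq> C' \<inter> D'"
    using CD assms(2)[of E C] assms(2)[of E D] by (intro bexI[of _ "\<Psi> E"]) simp_all
qed (use assms(3,4) in auto)

lemma convex_base_Int:
  assumes "convex_base \<C>" and "convex B" and "\<And>C. C \<in> \<C> \<Longrightarrow> C \<inter> B \<noteq> {}"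
  shows "convex_base ((\<lambda>C. C \<inter> B) ` \<C>)"
proof (rule convex_base_image[OF assms(1)])
  show "convex (C \<inter> B)" if "C \<in> \<C>" for C
    using convex_baseD(2)[OF assms(1) that] assms(2) by (rule convex_Int)
qed (use assms(3) in auto)

lemma convex_base_below:
  assumes "convex_base \<C>" "C \<in> \<C>"
  shows "convex_base {D\<in>\<C>. D \<subseteq> C}"
  unfolding convex_base_def
proof (intro conjI ballI)
  fix D E assume "D \<in> {D\<in>\<C>. D \<subseteq> C}" "E \<in> {D\<in>\<C>. D \<subseteq> C}"
  then obtain E' where "E' \<in> \<C>" "E' \<subseteq> D" "E' \<subseteq> E" "D \<subseteq> C"
    using convex_baseD(4)[OF assms(1), of D E] by auto
  then show "\<exists>E'\<in>{D\<in>\<C>. D \<subseteq> C}. E' \<subseteq> D \<inter> E" by (intro bexI[of _ E']) auto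
qed (use assms convex_baseD[OF assms(1)] in auto)

text \<open>
  Grothendieck's double limit condition as the absence of an infinite half graph; in this form it is
  trivially inherited under monotone functions such as truncation.
\<close>

definition no_order :: "('p \<Rightarrow> 's \<Rightarrow> real) \<Rightarrow> 'p set \<Rightarrow> 's set \<Rightarrow> bool"
  where "no_order B P S \<longleftrightarrow>
    (\<forall>p x r t. range p \<subseteq> P \<and> range x \<subseteq> S \<and> r < t \<longrightarrow>
      \<not> (\<forall>i j::nat. i < j \<longrightarrow> B (p i) (x j) \<le> r \<and> t \<le> B (p j) (x i)) \<and>
      \<not> (\<forall>i j::nat. i < j \<longrightarrow> t \<le> B (p i) (x j) \<and> B (p j) (x i) \<le> r))"

lemma no_orderD:
  assumes "no_order B P S" "\<And>i. p i \<in> P" "\<And>i. x i \<in> S" "r < t"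
  shows "\<not> (\<forall>i j::nat. i < j \<longrightarrow> B (p i) (x j) \<le> r \<and> t \<le> B (p j) (x i))"
    and "\<not> (\<forall>i j::nat. i < j \<longrightarrow> t \<le> B (p i) (x j) \<and> B (p j) (x i) \<le> r)"
  using assms(1)[unfolded no_order_def, rule_format, of p x r t] assms(2-) by (simp_all add: image_subset_iff)

lemma no_orderI:
  assumes "\<And>p x r t. \<lbrakk>\<And>i. p i \<in> P; \<And>i. x i \<in> S; r < t;
      \<And>i j::nat. i < j \<Longrightarrow> B (p i) (x j) \<le> r; \<And>i j. i < j \<Longrightarrow> t \<le> B (p j) (x i)\<rbrakk> \<Longrightarrow> False"
    and "\<And>p x r t. \<lbrakk>\<And>i. p i \<in> P; \<And>i. x i \<in> S; r < t;
      \<And>i j::nat. i < j \<Longrightarrow> t \<le> B (p i) (x j); \<And>i j. i < j \<Longrightarrow> B (p j) (x i) \<le> r\<rbrakk> \<Longrightarrow> False"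
  shows "no_order B P S"
  unfolding no_order_def
proof (intro allI impI conjI notI; elim conjE)
  fix p :: "nat \<Rightarrow> _" and x :: "nat \<Rightarrow> _" and r t :: real
  assume px: "range p \<subseteq> P" "range x \<subseteq> S" "r < t"
  have p: "p i \<in> P" and x: "x i \<in> S" for i using px by auto
  show False if "\<forall>i j. i < j \<longrightarrow> B (p i) (x j) \<le> r \<and> t \<le> B (p j) (x i)"
    using that by (intro assms(1)[of p x r t] p x px(3)) simp_all
  show False if "\<forall>i j. i < j \<longrightarrow> t \<le> B (p i) (x j) \<and> B (p j) (x i) \<le> r"
    using that by (intro assms(2)[of p x r t] p x px(3)) simp_all
qed

text \<open>Transposition exchanges the two forbidden half graphs; this symmetry is the reason for
  forbidding both.\<close>

lemma no_order_transpose: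
  assumes "no_order B P S" shows "no_order (\<lambda>s p. B p s) S P"
proof (rule no_orderI)
  fix p x :: "nat \<Rightarrow> _" and r t :: real
  assume "\<And>i. p i \<in> S" "\<And>i. x i \<in> P" "r < t"
  note nd = no_orderD[OF assms this(2,1,3)]
  show False if "\<And>i j::nat. i < j \<Longrightarrow> B (x j) (p i) \<le> r" "\<And>i j. i < j \<Longrightarrow> t \<le> B (x i) (p j)"
    using nd(2) that by blast
  show False if "\<And>i j::nat. i < j \<Longrightarrow> t \<le> B (x j) (p i)" "\<And>i j. i < j \<Longrightarrow> B (x i) (p j) \<le> r"
    using nd(1) that by blast
qed

lemma no_order_subset:
  assumes "no_order B P S" "P' \<subseteq> P"
  shows "no_order B P' S"
proof (rule no_orderI)
  fix p :: "nat \<Rightarrow> _" and x :: "nat \<Rightarrow> _" and r t :: real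
  assume p: "\<And>i. p i \<in> P'" and x: "\<And>i. x i \<in> S" and rt: "r < t"
  have "p i \<in> P" for i using p assms(2) by blast
  note nd = no_orderD[OF assms(1) this x rt]
  show False if "\<And>i j::nat. i < j \<Longrightarrow> B (p i) (x j) \<le> r" "\<And>i j. i < j \<Longrightarrow> t \<le> B (p j) (x i)"
    using nd(1) that by blast
  show False if "\<And>i j::nat. i < j \<Longrightarrow> t \<le> B (p i) (x j)" "\<And>i j. i < j \<Longrightarrow> B (p j) (x i) \<le> r"
    using nd(2) that by blast
qed

section \<open>Ptak's lemma and Mazur's theorem for the double limit condition\<close>

text \<open>The members consist eventually of means of the \<open>e p\<close> with \<open>p\<close>
  far out in \<open>F\<close>. Allowing any finer base leaves room to impose smallness conditions
  one after the other.\<close>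

definition fine_base :: "('p \<Rightarrow> 's \<Rightarrow> real) \<Rightarrow> 'p filter \<Rightarrow> ('s \<Rightarrow> real) set set \<Rightarrow> bool"
  where "fine_base e F \<C> \<longleftrightarrow> convex_base \<C> \<and>
    (\<forall>X. eventually (\<lambda>p. p \<in> X) F \<longrightarrow> (\<exists>C\<in>\<C>. C \<subseteq> convex hull (e ` X)))"

text \<open>
  For indicators \<open>e p\<close> of sets, robustness of \<open>T\<close> means that convex combinations of the \<open>e p\<close>
  far out in \<open>F\<close>, even if restricted to a finer base, do not become uniformly small on \<open>T\<close>.
\<close>

definition robust :: "('p \<Rightarrow> 's \<Rightarrow> real) \<Rightarrow> 'p filter \<Rightarrow> 's set \<Rightarrow> bool"
  where "robust e F T \<longleftrightarrow>
    (\<exists>\<C> \<epsilon>. fine_base e F \<C> \<and> \<epsilon> > 0 \<and> (\<forall>u\<in>\<Union>\<C>. \<exists>s\<in>T. u s > \<epsilon>))"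

lemma convex_pointwise_le: "convex {u :: 's \<Rightarrow> real. \<forall>s\<in>T. u s \<le> \<delta>}"
  unfolding convex_def scaleR_fun_def plus_fun_def by (simp add: convex_bound_le)

lemma not_robustD:
  assumes "\<not> robust e F T" "fine_base e F \<C>" "\<delta> > 0"
  obtains u where "u \<in> \<Union>\<C>" "\<And>s. s \<in> T \<Longrightarrow> u s \<le> \<delta>"
proof -
  have "\<not> (\<forall>u\<in>\<Union>\<C>. \<exists>s\<in>T. u s > \<delta>)"
    using assms unfolding robust_def by meson
  then show ?thesis using that by (meson not_le)
qed

text \<open>Applying non-robustness to the part of \<open>\<C>\<close> below a given member shows
  that every member, and not just one, contains a mean that is small on \<open>T\<close>.\<close>

lemma fine_base_refine:
  assumes \<C>: "fine_base e F \<C>" and T: "\<not> robust e F T" and "\<delta> > 0"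
  shows "fine_base e F ((\<lambda>C. C \<inter> {u. \<forall>s\<in>T. u s \<le> \<delta>}) ` \<C>)"
  unfolding fine_base_def
proof (intro conjI allI impI)
  have base: "convex_base \<C>" using \<C> by (simp add: fine_base_def)
  show "convex_base ((\<lambda>C. C \<inter> {u. \<forall>s\<in>T. u s \<le> \<delta>}) ` \<C>)"
  proof (rule convex_base_Int[OF base convex_pointwise_le])
    fix C assume C: "C \<in> \<C>"
    have "fine_base e F {D\<in>\<C>. D \<subseteq> C}"
      unfolding fine_base_def
    proof (intro conjI allI impI)
      fix X assume "eventually (\<lambda>p. p \<in> X) F"
      then obtain D where "D \<in> \<C>" "D \<subseteq> convex hull (e ` X)"
        using \<C> unfolding fine_base_def by blast
      moreover obtain E where "E \<in> \<C>" "E \<subseteq> C" "E \<subseteq> D"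
        using convex_baseD(4)[OF base C \<open>D \<in> \<C>\<close>] by blast
      ultimately show "\<exists>D\<in>{D\<in>\<C>. D \<subseteq> C}. D \<subseteq> convex hull (e ` X)" by blast
    qed (rule convex_base_below[OF base C])
    from not_robustD[OF T this \<open>\<delta> > 0\<close>]
    obtain u where "u \<in> \<Union>{D\<in>\<C>. D \<subseteq> C}" "\<And>s. s \<in> T \<Longrightarrow> u s \<le> \<delta>" by metis
    then have "u \<in> C \<inter> {u. \<forall>s\<in>T. u s \<le> \<delta>}" by blast
    then show "C \<inter> {u. \<forall>s\<in>T. u s \<le> \<delta>} \<noteq> {}"
      unfolding ex_in_conv[symmetric] by (rule exI[of _ u])
  qed
next
  fix X assume "eventually (\<lambda>p. p \<in> X) F"
  then obtain C where "C \<in> \<C>" "C \<subseteq> convex hull (e ` X)"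
    using \<C> unfolding fine_base_def by blast
  then show "\<exists>C\<in>(\<lambda>C. C \<inter> {u. \<forall>s\<in>T. u s \<le> \<delta>}) ` \<C>. C \<subseteq> convex hull (e ` X)"
    by (intro bexI[of _ "C \<inter> {u. \<forall>s\<in>T. u s \<le> \<delta>}"] imageI) (simp_all add: le_infI1)
qed

lemma fine_base_refine_finite:
  assumes "finite \<R>" "fine_base e F \<C>" "\<And>T. T \<in> \<R> \<Longrightarrow> \<not> robust e F T" "\<delta> > 0"
  shows "fine_base e F ((\<lambda>C. C \<inter> {u. \<forall>s\<in>\<Union>\<R>. u s \<le> \<delta>}) ` \<C>)"
  using assms
proof (induction \<R> rule: finite_induct)
  case (insert T \<R>)
  have "fine_base e F ((\<lambda>C. C \<inter> {u. \<forall>s\<in>T. u s \<le> \<delta>}) ` (\<lambda>C. C \<inter> {u. \<forall>s\<in>\<Union>\<R>. u s \<le> \<delta>}) ` \<C>)"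
    using insert.prems by (intro fine_base_refine[OF insert.IH]) simp_all
  moreover have "(\<lambda>C. C \<inter> {u. \<forall>s\<in>T. u s \<le> \<delta>}) ` (\<lambda>C. C \<inter> {u. \<forall>s\<in>\<Union>\<R>. u s \<le> \<delta>}) ` \<C> =
      (\<lambda>C. C \<inter> {u. \<forall>s\<in>\<Union>(insert T \<R>). u s \<le> \<delta>}) ` \<C>"
    unfolding image_image by (rule image_cong) auto
  ultimately show ?case by simp
qed auto

text \<open>
  The inductive step of Ptak's combinatorial lemma. If it fails, one can pick convex combinations of
  indicators one after the other, each of them small on the supports of its predecessors; their
  averages are then uniformly small on \<open>T\<close>.
\<close>

lemma robust_Int:
  fixes E :: "'p \<Rightarrow> 's set"
  defines "e \<equiv> \<lambda>p s. indicator (E p) s :: real"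
  assumes T: "robust e F T" and X: "eventually (\<lambda>p. p \<in> X) F"
    and E: "\<And>p. p \<in> X \<Longrightarrow> E p = \<Union>(\<P> p)" "\<And>p. p \<in> X \<Longrightarrow> finite (\<P> p)"
  shows "\<exists>p\<in>X. \<exists>A\<in>\<P> p. robust e F (T \<inter> A)"
proof (rule ccontr)
  assume "\<not> ?thesis"
  then have thin: "\<not> robust e F (T \<inter> A)" if "p \<in> X" "A \<in> \<P> p" for p A using that by blast
  obtain \<C> \<epsilon> where \<C>: "fine_base e F \<C>" and \<epsilon>: "\<epsilon> > 0" "\<And>u. u \<in> \<Union>\<C> \<Longrightarrow> \<exists>s\<in>T. u s > \<epsilon>"
    using T unfolding robust_def by blast
  obtain C where C: "C \<in> \<C>" "C \<subseteq> convex hull (e ` X)"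
    using \<C> X unfolding fine_base_def by blast
  have "convex C" using \<C> C(1) by (simp add: fine_base_def convex_base_def)
  \<comment> \<open>Within \<open>T\<close> the support of \<open>u\<close> is covered by finitely
    many non-robust sets, so the base can be refined to be small on all of it.\<close>
  define supp where "supp u \<R> \<longleftrightarrow> finite \<R> \<and> (\<forall>A\<in>\<R>. \<not> robust e F A) \<and> (\<forall>s\<in>T. u s \<noteq> 0 \<longrightarrow> s \<in> \<Union>\<R>)"
    for u :: "'s \<Rightarrow> real" and \<R>
  have supp_add: "\<exists>\<R>. supp (a *\<^sub>R u + b *\<^sub>R v) \<R>" if "supp u \<R>1" "supp v \<R>2" for u v a b \<R>1 \<R>2
    by (rule exI[of _ "\<R>1 \<union> \<R>2"])
      (use that in \<open>auto simp: supp_def scaleR_fun_def plus_fun_def\<close>)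
  have hull: "\<exists>\<R>. supp u \<R>" "\<forall>s. u s \<le> 1" if "u \<in> convex hull (e ` X)" for u
  proof -
    have "convex hull (e ` X) \<subseteq> {u. \<exists>\<R>. supp u \<R>}"
    proof (rule hull_minimal)
      show "convex {u. \<exists>\<R>. supp u \<R>}"
        unfolding convex_def using supp_add by blast
      have "supp (e p) ((\<inter>) T ` \<P> p)" if "p \<in> X" for p
        using thin[OF that] E[OF that] by (auto simp: supp_def e_def indicator_def)
      then show "e ` X \<subseteq> {u. \<exists>\<R>. supp u \<R>}" by (intro image_subsetI CollectI exI)
    qed
    then show "\<exists>\<R>. supp u \<R>" using that by blast
    have "convex hull (e ` X) \<subseteq> {u. \<forall>s\<in>UNIV. u s \<le> 1}"
      by (rule hull_minimal[where S = convex, OF _ convex_pointwise_le]) (auto simp: e_def indicator_def)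
    then show "\<forall>s. u s \<le> 1" using that by blast
  qed
  define \<delta> where "\<delta> = \<epsilon> / 2"
  have "\<delta> > 0" using \<epsilon> by (simp add: \<delta>_def)
  \<comment> \<open>\<open>Suc k * w\<close> is a sum of \<open>k + 1\<close> means. Each new mean
    is at most \<open>\<delta>\<close> on the supports found so far, and at most \<open>1\<close> at
    points where the old average vanishes; hence a point of \<open>T\<close> receives the full value
    \<open>1\<close> at most once.\<close>
  have avg: "\<exists>w. w \<in> C \<and> (\<exists>\<R>. supp w \<R>) \<and> (\<forall>s\<in>T. real (Suc k) * w s \<le> 1 + real k * \<delta>)" for k
  proof (induction k)
    case 0
    obtain u where "u \<in> C" using convex_baseD(3)[OF _ C(1)] \<C> unfolding fine_base_def by blast
    then have "u \<in> convex hull (e ` X)" using C(2) by blast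
    from hull[OF this] \<open>u \<in> C\<close> show ?case by (intro exI[of _ u]) simp
  next
    case (Suc k)
    then obtain w \<R> where w: "w \<in> C" "supp w \<R>" and
      wb: "\<And>s. s \<in> T \<Longrightarrow> real (Suc k) * w s \<le> 1 + real k * \<delta>" by blast
    have "fine_base e F ((\<lambda>C. C \<inter> {u. \<forall>s\<in>\<Union>\<R>. u s \<le> \<delta>}) ` \<C>)"
      using w(2) \<C> \<open>\<delta> > 0\<close> by (intro fine_base_refine_finite) (auto simp: supp_def)
    then have "convex_base ((\<lambda>C. C \<inter> {u. \<forall>s\<in>\<Union>\<R>. u s \<le> \<delta>}) ` \<C>)" by (simp add: fine_base_def)
    from convex_baseD(3)[OF this imageI[OF C(1)]]
    have "C \<inter> {u. \<forall>s\<in>\<Union>\<R>. u s \<le> \<delta>} \<noteq> {}" .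
    then obtain u where "u \<in> C \<inter> {u. \<forall>s\<in>\<Union>\<R>. u s \<le> \<delta>}"
      unfolding ex_in_conv[symmetric] by (rule exE)
    then have u: "u \<in> C" "\<And>s. s \<in> \<Union>\<R> \<Longrightarrow> u s \<le> \<delta>" by auto
    obtain \<R>' where \<R>': "supp u \<R>'" using hull(1) u(1) C(2) by blast
    \<comment> \<open>This weight turns the average of \<open>k + 1\<close> means and one further
      mean into the average of \<open>k + 2\<close> means.\<close>
    define a where "a = real (Suc k) / real (Suc (Suc k))"
    define w' where "w' = a *\<^sub>R w + (1 - a) *\<^sub>R u"
    have a: "real (Suc (Suc k)) * a = real (Suc k)" "real (Suc (Suc k)) * (1 - a) = 1"
      by (auto simp: a_def field_simps)
    have "0 \<le> a" "a \<le> 1" by (auto simp: a_def)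
    then have "w' \<in> C" unfolding w'_def using \<open>convex C\<close> w(1) u(1)
      by (intro convexD) auto
    moreover have "\<exists>\<R>. supp w' \<R>" unfolding w'_def by (rule supp_add[OF w(2) \<R>'])
    moreover have "real (Suc (Suc k)) * w' s \<le> 1 + real (Suc k) * \<delta>" if s: "s \<in> T" for s
    proof -
      have "real (Suc (Suc k)) * w' s =
          (real (Suc (Suc k)) * a) * w s + (real (Suc (Suc k)) * (1 - a)) * u s"
        unfolding w'_def scaleR_fun_def plus_fun_def real_scaleR_def by (simp only: distrib_left mult.assoc)
      also have "\<dots> = real (Suc k) * w s + u s"
        unfolding a by simp
      also have "\<dots> \<le> 1 + real (Suc k) * \<delta>"
      proof (cases "s \<in> \<Union>\<R>")
        case True
        then show ?thesis using u(2)[OF True] wb[OF s] by (simp add: algebra_simps)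
      next
        case False
        then have "w s = 0" using w(2) s by (auto simp: supp_def)
        moreover have "u s \<le> 1" using hull(2) u(1) C(2) by blast
        moreover have "0 \<le> real (Suc k) * \<delta>" using \<open>\<delta> > 0\<close> by simp
        ultimately show ?thesis by simp
      qed
      finally show ?thesis .
    qed
    ultimately show ?case by blast
  qed
  \<comment> \<open>With \<open>1 < Suc k * \<delta>\<close> the average is less than
    \<open>2 * \<delta> = \<epsilon>\<close> on all of \<open>T\<close>, against the choice of
    \<open>\<epsilon>\<close>.\<close>
  obtain k where k: "real (Suc k) > 1 / \<delta>" using reals_Archimedean2
    by (metis lessI less_trans of_nat_less_iff)
  obtain w where w: "w \<in> C" "\<And>s. s \<in> T \<Longrightarrow> real (Suc k) * w s \<le> 1 + real k * \<delta>"
    using avg by blast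
  obtain s where s: "s \<in> T" "w s > \<epsilon>" using \<epsilon>(2) w(1) C(1) by blast
  have "real (Suc k) * \<epsilon> < 1 + real k * \<delta>"
    using w(2)[OF s(1)] s(2) by (smt (verit) mult_strict_left_mono of_nat_0_less_iff zero_less_Suc)
  moreover have "1 < real (Suc k) * \<delta>" using k \<open>\<delta> > 0\<close> by (simp add: field_simps)
  moreover have "\<epsilon> = 2 * \<delta>" by (simp add: \<delta>_def)
  ultimately show False using \<open>\<delta> > 0\<close> by (simp add: algebra_simps)
qed

text \<open>The two signs of the deviation are kept apart because a half graph needs all deviations
  on the same side; \<open>robust_Int\<close> can select one of finitely many parts.\<close>

definition exceed :: "('p \<Rightarrow> 's \<Rightarrow> real) \<Rightarrow> ('s \<Rightarrow> real) \<Rightarrow> 's set \<Rightarrow> real \<Rightarrow> bool \<Rightarrow> 'p \<Rightarrow> 's set"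
  where "exceed B f S \<eta> \<sigma> p = {s\<in>S. \<eta> \<le> (if \<sigma> then B p s - f s else f s - B p s)}"

text \<open>An alternating choice: \<open>p i\<close> is taken so far out in \<open>F\<close> that
  it is near \<open>f\<close> at all earlier points, while its \<open>exceed\<close> set still cuts
  the current robust set in a robust set; \<open>s i\<close> and all later points are then taken
  from that intersection.\<close>

lemma robust_fine_sequence:
  fixes B :: "'p \<Rightarrow> 's \<Rightarrow> real"
  assumes lim: "\<And>s. s \<in> S \<Longrightarrow> ((\<lambda>p. B p s) \<longlongrightarrow> f s) F"
    and U: "eventually (\<lambda>p. p \<in> U) F" and \<eta>: "\<eta> > 0"
    and rob: "robust (\<lambda>p s. indicator (exceed B f S \<eta> True p \<union> exceed B f S \<eta> False p) s) F S"
  obtains \<sigma> p s where "\<And>i::nat. p i \<in> U" "\<And>i. s i \<in> S"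
    "\<And>i j. i \<le> j \<Longrightarrow> s j \<in> exceed B f S \<eta> (\<sigma> i) (p i)"
    "\<And>i j. i < j \<Longrightarrow> \<bar>B (p j) (s i) - f (s i)\<bar> < \<eta> / 2"
proof -
  let ?E = "exceed B f S \<eta>"
  let ?e = "\<lambda>p s. indicator (?E True p \<union> ?E False p) s :: real"
  define X where "X Q = {p\<in>U. \<forall>s\<in>Q. \<bar>B p s - f s\<bar> < \<eta> / 2}" for Q
  have X: "eventually (\<lambda>p. p \<in> X Q) F" if "finite Q" "Q \<subseteq> S" for Q
  proof -
    have "\<forall>s\<in>Q. eventually (\<lambda>p. \<bar>B p s - f s\<bar> < \<eta> / 2) F"
    proof
      fix s assume "s \<in> Q"
      then have "((\<lambda>p. B p s) \<longlongrightarrow> f s) F" using lim that(2) by blast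
      from tendstoD[OF this, of "\<eta> / 2"] \<eta>
      show "eventually (\<lambda>p. \<bar>B p s - f s\<bar> < \<eta> / 2) F" by (simp add: dist_real_def)
    qed
    then have "eventually (\<lambda>p. \<forall>s\<in>Q. \<bar>B p s - f s\<bar> < \<eta> / 2) F"
      using that(1) by (simp add: eventually_ball_finite)
    then show ?thesis using U unfolding X_def by eventually_elim simp
  qed
  have step: "\<exists>p\<in>X Q. \<exists>\<sigma>. \<exists>s\<in>R \<inter> ?E \<sigma> p. robust ?e F (R \<inter> ?E \<sigma> p)"
    if R: "robust ?e F R" and Q: "finite Q" "Q \<subseteq> S" for R Q
  proof -
    obtain p A where p: "p \<in> X Q" and A: "A \<in> {?E True p, ?E False p}" "robust ?e F (R \<inter> A)"
      using robust_Int[OF R X[OF Q], of "\<lambda>p. {?E True p, ?E False p}"] by auto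
    from A(1) obtain \<sigma> where \<sigma>: "A = ?E \<sigma> p" by auto
    \<comment> \<open>Robustness of the intersection is used here only to see that it is nonempty,
      so that the next point \<open>s\<close> can be taken from it.\<close>
    obtain \<C> u where "fine_base ?e F \<C>" "u \<in> \<Union>\<C> \<Longrightarrow> \<exists>s\<in>R \<inter> A. True" "u \<in> \<Union>\<C>"
    proof -
      obtain \<C> \<epsilon> where "fine_base ?e F \<C>" "\<forall>u\<in>\<Union>\<C>. \<exists>s\<in>R \<inter> A. u s > \<epsilon>"
        using A(2) unfolding robust_def by blast
      moreover from this(1) obtain C where "C \<in> \<C>" "C \<noteq> {}"
        unfolding fine_base_def convex_base_def by fast
      ultimately show ?thesis using that by blast
    qed
    then show ?thesis using p A(2) unfolding \<sigma> by blast
  qed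
  \<comment> \<open>A state consists of the current robust set, the finite set of points chosen so
    far, and the latest sign, index and point.\<close>
  define good where "good = (\<lambda>(R, Q, \<sigma>, p, s). robust ?e F R \<and> finite Q \<and> Q \<subseteq> S \<and> s \<in> Q \<and> s \<in> R \<and> R \<subseteq> ?E \<sigma> p \<and> p \<in> U)"
  define succ where "succ = (\<lambda>(R, Q, _ :: bool \<times> 'p \<times> 's) (R' :: 's set, Q', \<sigma> :: bool, p, s :: 's). R' \<subseteq> R \<and> Q \<subseteq> Q' \<and> p \<in> X Q)"
  have next_state: "\<exists>R' Q' \<sigma> p s. good (R', Q', \<sigma>, p, s) \<and> R' \<subseteq> R \<and> Q \<subseteq> Q' \<and> p \<in> X Q"
    if R: "robust ?e F R" "finite Q" "Q \<subseteq> S" for R Q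
  proof -
    obtain p \<sigma> s where "p \<in> X Q" "s \<in> R \<inter> ?E \<sigma> p" "robust ?e F (R \<inter> ?E \<sigma> p)"
      using step[OF R] by blast
    moreover have "p \<in> U" using \<open>p \<in> X Q\<close> by (simp add: X_def)
    moreover have "s \<in> S" using \<open>s \<in> R \<inter> ?E \<sigma> p\<close> by (simp add: exceed_def)
    ultimately have "good (R \<inter> ?E \<sigma> p, insert s Q, \<sigma>, p, s) \<and> R \<inter> ?E \<sigma> p \<subseteq> R \<and> Q \<subseteq> insert s Q \<and> p \<in> X Q"
      using R by (auto simp: good_def)
    then show ?thesis by blast
  qed
  have "\<exists>x. \<forall>n. good (x n) \<and> succ (x n) (x (Suc n))"
  proof (rule dependent_nat_choice)
    show "\<exists>x. good x" using next_state[OF rob, of "{}"] by blast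
    fix x :: "'s set \<times> 's set \<times> bool \<times> 'p \<times> 's" and n :: nat
    assume g: "good x"
    obtain R Q \<sigma> p s where x: "x = (R, Q, \<sigma>, p, s)" by (metis prod_cases5)
    show "\<exists>y. good y \<and> succ x y"
    proof -
      have "robust ?e F R" "finite Q" "Q \<subseteq> S" using g unfolding x good_def by auto
      from next_state[OF this] obtain R' Q' \<sigma>' p' s'
        where "good (R', Q', \<sigma>', p', s')" "R' \<subseteq> R" "Q \<subseteq> Q'" "p' \<in> X Q" by blast
      then show ?thesis by (intro exI[of _ "(R', Q', \<sigma>', p', s')"]) (simp add: x succ_def)
    qed
  qed
  then obtain x where x: "\<And>n. good (x n)" "\<And>n. succ (x n) (x (Suc n))" by blast
  define R where "R n = fst (x n)" for n
  define Q where "Q n = fst (snd (x n))" for n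
  define \<sigma> where "\<sigma> n = fst (snd (snd (x n)))" for n
  define p where "p n = fst (snd (snd (snd (x n))))" for n
  define s where "s n = snd (snd (snd (snd (x n))))" for n
  have xe: "x n = (R n, Q n, \<sigma> n, p n, s n)" for n
    by (simp add: R_def Q_def \<sigma>_def p_def s_def)
  have g: "Q n \<subseteq> S" "s n \<in> Q n" "s n \<in> R n" "R n \<subseteq> ?E (\<sigma> n) (p n)" "p n \<in> U" for n
    using x(1)[of n] unfolding xe good_def by auto
  have sc: "R (Suc n) \<subseteq> R n" "Q n \<subseteq> Q (Suc n)" "p (Suc n) \<in> X (Q n)" for n
    using x(2)[of n] unfolding xe succ_def by auto
  have Rmono: "R j \<subseteq> R i" if "i \<le> j" for i j
    using lift_Suc_antimono_le[of R, OF sc(1) that] .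
  have Qmono: "Q i \<subseteq> Q j" if "i \<le> j" for i j
    using lift_Suc_mono_le[of Q, OF sc(2) that] .
  show ?thesis
  proof (rule that[of p s \<sigma>])
    show "p i \<in> U" for i by (rule g)
    show "s i \<in> S" for i using g by blast
    \<comment> \<open>Here \<open>i = j\<close> is allowed since \<open>s i\<close> is chosen after
      \<open>p i\<close>; in the next claim \<open>p j\<close> is near \<open>f\<close> only at the
      points chosen before it.\<close>
    show "s j \<in> ?E (\<sigma> i) (p i)" if "i \<le> j" for i j
      using Rmono[OF that] g(3)[of j] g(4)[of i] by blast
    show "\<bar>B (p j) (s i) - f (s i)\<bar> < \<eta> / 2" if "i < j" for i j
    proof -
      obtain k where k: "j = Suc k" "i \<le> k" using \<open>i < j\<close> by (cases j) auto
      have "s i \<in> Q k" using Qmono[OF k(2)] g(2)[of i] by blast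
      then show ?thesis using sc(3)[of k] k(1) unfolding X_def by simp
    qed
  qed
qed

text \<open>The sequences already form a half graph relative to the varying level
  \<open>f (s i)\<close>. A subsequence with constant sign and nearly constant level makes the
  thresholds constant.\<close>

lemma no_order_not_robust:
  assumes no: "no_order B P S" and f: "\<And>s. s \<in> S \<Longrightarrow> \<bar>f s\<bar> \<le> M"
    and lim: "\<And>s. s \<in> S \<Longrightarrow> ((\<lambda>p. B p s) \<longlongrightarrow> f s) F"
    and P: "eventually (\<lambda>p. p \<in> P) F" and \<eta>: "\<eta> > 0"
  shows "\<not> robust (\<lambda>p s. indicator (exceed B f S \<eta> True p \<union> exceed B f S \<eta> False p) s) F S"
proof
  assume rob: "robust (\<lambda>p s. indicator (exceed B f S \<eta> True p \<union> exceed B f S \<eta> False p) s) F S"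
  show False
  proof (rule robust_fine_sequence[OF lim P \<eta> rob])
    fix p s \<sigma>
    assume p: "\<And>i::nat. p i \<in> P" and s: "\<And>i. s i \<in> S"
      and far: "\<And>i j. i \<le> j \<Longrightarrow> s j \<in> exceed B f S \<eta> (\<sigma> i) (p i)"
      and near: "\<And>i j. i < j \<Longrightarrow> \<bar>B (p j) (s i) - f (s i)\<bar> < \<eta> / 2"
    \<comment> \<open>Pigeonhole on the sign and on cells of width \<open>\<eta> / 8\<close> for
      \<open>f (s i)\<close>: since \<open>f\<close> is bounded there are finitely many
      values.\<close>
    define h where "h i = (\<sigma> i, \<lfloor>f (s i) * (8 / \<eta>)\<rfloor>)" for i
    have "range h \<subseteq> UNIV \<times> {\<lfloor>- M * (8 / \<eta>)\<rfloor>..\<lfloor>M * (8 / \<eta>)\<rfloor>}"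
    proof (rule image_subsetI)
      fix i
      have "- M \<le> f (s i)" "f (s i) \<le> M" using f[OF s, of i] by auto
      then have "- M * (8 / \<eta>) \<le> f (s i) * (8 / \<eta>)" "f (s i) * (8 / \<eta>) \<le> M * (8 / \<eta>)"
        by (intro mult_right_mono; use \<eta> in simp)+
      then show "h i \<in> UNIV \<times> {\<lfloor>- M * (8 / \<eta>)\<rfloor>..\<lfloor>M * (8 / \<eta>)\<rfloor>}"
        unfolding h_def mem_Times_iff fst_conv snd_conv atLeastAtMost_iff by (intro conjI UNIV_I floor_mono)
    qed
    then have "finite (range h)" by (rule finite_subset) simp
    then obtain i0 where "infinite {i. h i = h i0}"
      using pigeonhole_infinite[of UNIV h] by auto
    then obtain r :: "nat \<Rightarrow> nat" where r: "strict_mono r" "\<And>n. h (r n) = h i0"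
      using infinite_enumerate by (metis (mono_tags, lifting) mem_Collect_eq)
    define c where "c = \<eta> / 8 * \<lfloor>f (s i0) * (8 / \<eta>)\<rfloor>"
    have cell: "c \<le> f (s (r n))" "f (s (r n)) \<le> c + \<eta> / 8" for n
    proof -
      have "\<lfloor>f (s i0) * (8 / \<eta>)\<rfloor> = \<lfloor>f (s (r n)) * (8 / \<eta>)\<rfloor>"
        using r(2)[of n] by (simp add: h_def)
      then have c: "c = \<eta> / 8 * \<lfloor>f (s (r n)) * (8 / \<eta>)\<rfloor>" by (simp add: c_def)
      have "f (s (r n)) = \<eta> / 8 * (f (s (r n)) * (8 / \<eta>))" using \<eta> by simp
      moreover have "\<eta> / 8 * \<lfloor>f (s (r n)) * (8 / \<eta>)\<rfloor> \<le> \<eta> / 8 * (f (s (r n)) * (8 / \<eta>))"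
        using \<eta> by (intro mult_left_mono) auto
      moreover have "\<eta> / 8 * (f (s (r n)) * (8 / \<eta>)) \<le> \<eta> / 8 * (\<lfloor>f (s (r n)) * (8 / \<eta>)\<rfloor> + 1)"
        using \<eta> by (intro mult_left_mono) linarith+
      ultimately show "c \<le> f (s (r n))" "f (s (r n)) \<le> c + \<eta> / 8"
        unfolding c by (simp_all add: distrib_left)
    qed
    have rl: "r i < r j" if "i < j" for i j using r(1) that by (simp add: strict_mono_def)
    have sg: "\<sigma> (r n) = \<sigma> i0" for n using r(2)[of n] by (simp add: h_def)
    have late: "\<bar>B (p (r j)) (s (r i)) - f (s (r i))\<bar> < \<eta> / 2" if "i < j" for i j
      using near rl[OF that] by blast
    have early: "\<eta> \<le> (if \<sigma> i0 then B (p (r i)) (s (r j)) - f (s (r j)) else f (s (r j)) - B (p (r i)) (s (r j)))"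
      if "i < j" for i j
      using far[OF less_imp_le[OF rl[OF that]]] sg[of i] unfolding exceed_def by simp
    show False
    proof (cases "\<sigma> i0")
      case True
      \<comment> \<open>Early indices exceed the level by \<open>\<eta>\<close>, late ones by less
        than \<open>\<eta> / 2\<close>, to which the width of the cell adds
        \<open>\<eta> / 8\<close>; so \<open>c + \<eta>\<close> and
        \<open>c + \<eta> * (3/4)\<close> separate them.\<close>
      have "\<forall>i j. i < j \<longrightarrow> c + \<eta> \<le> B (p (r i)) (s (r j)) \<and> B (p (r j)) (s (r i)) \<le> c + \<eta> * (3/4)"
      proof (intro allI impI)
        fix i j :: nat assume "i < j"
        show "c + \<eta> \<le> B (p (r i)) (s (r j)) \<and> B (p (r j)) (s (r i)) \<le> c + \<eta> * (3/4)"
          using early[OF \<open>i < j\<close>] late[OF \<open>i < j\<close>, unfolded abs_less_iff] cell[of i] cell[of j] \<eta> True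
          unfolding if_P[OF True] by (intro conjI) argo+
      qed
      then show False
        using no_orderD(2)[OF no, of "\<lambda>i. p (r i)" "\<lambda>i. s (r i)" "c + \<eta> * (3/4)" "c + \<eta>"] p s \<eta> by simp
    next
      case False
      \<comment> \<open>Now the width of the cell affects the early indices: they are at most
        \<open>c + \<eta> / 8 - \<eta>\<close>, while the late ones are above
        \<open>c - \<eta> / 2\<close>.\<close>
      have "\<forall>i j. i < j \<longrightarrow> B (p (r i)) (s (r j)) \<le> c - \<eta> * (3/4) \<and> c - \<eta> / 2 \<le> B (p (r j)) (s (r i))"
      proof (intro allI impI)
        fix i j :: nat assume "i < j"
        show "B (p (r i)) (s (r j)) \<le> c - \<eta> * (3/4) \<and> c - \<eta> / 2 \<le> B (p (r j)) (s (r i))"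
          using early[OF \<open>i < j\<close>] late[OF \<open>i < j\<close>, unfolded abs_less_iff] cell[of i] cell[of j] \<eta> False
          unfolding if_not_P[OF False] by (intro conjI) argo+
      qed
      then show False
        using no_orderD(1)[OF no, of "\<lambda>i. p (r i)" "\<lambda>i. s (r i)" "c - \<eta> * (3/4)" "c - \<eta> / 2"] p s \<eta> by simp
    qed
  qed
qed

lemma tendsto_bounded:
  fixes f :: "'p \<Rightarrow> real"
  assumes "(f \<longlongrightarrow> l) F" "F \<noteq> bot" "eventually (\<lambda>p. \<bar>f p\<bar> \<le> M) F"
  shows "\<bar>l\<bar> \<le> M"
  using tendsto_upperbound[OF tendsto_rabs[OF assms(1)] assms(3)] assms(2) by simp

text \<open>Outside its exceptional set \<open>B p\<close> is within \<open>\<delta> / 2\<close> of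
  \<open>f\<close>, and on it within \<open>2 * \<bar>M\<bar>\<close>. A mean of the indicators of
  the exceptional sets that is uniformly small therefore gives, with the same weights, a mean of the
  \<open>B p\<close> uniformly close to \<open>f\<close>.\<close>

lemma no_order_Mazur:
  fixes B :: "'p \<Rightarrow> 's \<Rightarrow> real"
  assumes no: "no_order B P S" and bd: "\<And>p s. p \<in> P \<Longrightarrow> s \<in> S \<Longrightarrow> \<bar>B p s\<bar> \<le> M"
    and F: "F \<noteq> bot" and lim: "\<And>s. s \<in> S \<Longrightarrow> ((\<lambda>p. B p s) \<longlongrightarrow> f s) F"
    and P: "eventually (\<lambda>p. p \<in> P) F" and U: "eventually (\<lambda>p. p \<in> U) F" and \<delta>: "\<delta> > 0"
  shows "\<exists>y\<in>convex hull (B ` U). \<forall>s\<in>S. \<bar>y s - f s\<bar> \<le> \<delta>"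
proof -
  let ?E = "exceed B f S (\<delta> / 2)"
  let ?e = "\<lambda>p s. indicator (?E True p \<union> ?E False p) s :: real"
  have f: "\<bar>f s\<bar> \<le> M" if "s \<in> S" for s
    by (rule tendsto_bounded[OF lim[OF that] F], rule eventually_mono[OF P]) (use bd that in auto)
  have not_robust: "\<not> robust ?e F S"
    using no_order_not_robust[OF no f lim P, of "\<delta> / 2"] \<delta> by simp
  define W where "W = P \<inter> U"
  have W: "eventually (\<lambda>p. p \<in> W) F" using P U unfolding W_def by eventually_elim simp
  have fine: "fine_base ?e F ((\<lambda>X. convex hull (?e ` X)) ` {X. X \<subseteq> W \<and> eventually (\<lambda>p. p \<in> X) F})"
    unfolding fine_base_def
  proof (intro conjI allI impI)
    show "convex_base ((\<lambda>X. convex hull (?e ` X)) ` {X. X \<subseteq> W \<and> eventually (\<lambda>p. p \<in> X) F})"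
      unfolding convex_base_def
    proof (intro conjI ballI)
      show "(\<lambda>X. convex hull (?e ` X)) ` {X. X \<subseteq> W \<and> eventually (\<lambda>p. p \<in> X) F} \<noteq> {}" using W by auto
      fix C assume "C \<in> (\<lambda>X. convex hull (?e ` X)) ` {X. X \<subseteq> W \<and> eventually (\<lambda>p. p \<in> X) F}"
      then obtain X where X: "C = convex hull (?e ` X)" "X \<subseteq> W" "eventually (\<lambda>p. p \<in> X) F" by blast
      show "convex C" unfolding X(1) by (rule convex_convex_hull)
      have "X \<noteq> {}" using X(3) F by (auto simp: eventually_False)
      then show "C \<noteq> {}" unfolding X(1) by simp
      fix D assume "D \<in> (\<lambda>X. convex hull (?e ` X)) ` {X. X \<subseteq> W \<and> eventually (\<lambda>p. p \<in> X) F}"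
      then obtain Y where Y: "D = convex hull (?e ` Y)" "Y \<subseteq> W" "eventually (\<lambda>p. p \<in> Y) F" by blast
      have "eventually (\<lambda>p. p \<in> X \<inter> Y) F" using X(3) Y(3) by eventually_elim simp
      moreover have "convex hull (?e ` (X \<inter> Y)) \<subseteq> C \<inter> D"
        unfolding X(1) Y(1) by (intro Int_greatest hull_mono image_mono) auto
      ultimately show "\<exists>G\<in>(\<lambda>X. convex hull (?e ` X)) ` {X. X \<subseteq> W \<and> eventually (\<lambda>p. p \<in> X) F}. G \<subseteq> C \<inter> D"
        using X(2) by (intro bexI[of _ "convex hull (?e ` (X \<inter> Y))"] imageI) auto
    qed
    fix X assume "eventually (\<lambda>p. p \<in> X) F"
    with W have "eventually (\<lambda>p. p \<in> X \<inter> W) F" by eventually_elim simp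
    moreover have "convex hull (?e ` (X \<inter> W)) \<subseteq> convex hull (?e ` X)"
      by (intro hull_mono image_mono) auto
    ultimately show "\<exists>C\<in>(\<lambda>X. convex hull (?e ` X)) ` {X. X \<subseteq> W \<and> eventually (\<lambda>p. p \<in> X) F}. C \<subseteq> convex hull (?e ` X)"
      by (intro bexI[of _ "convex hull (?e ` (X \<inter> W))"] imageI) auto
  qed
  \<comment> \<open>Chosen so that exceptional sets of mean weight \<open>\<kappa>\<close> cost at
    most \<open>\<delta> / 2\<close>; the summand \<open>1\<close> avoids division by zero.\<close>
  define \<kappa> where "\<kappa> = \<delta> / (4 * (\<bar>M\<bar> + 1))"
  have \<kappa>: "\<kappa> > 0" "2 * \<bar>M\<bar> * \<kappa> \<le> \<delta> / 2"
    using \<delta> by (auto simp: \<kappa>_def field_simps)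
  obtain u where u: "u \<in> \<Union>((\<lambda>X. convex hull (?e ` X)) ` {X. X \<subseteq> W \<and> eventually (\<lambda>p. p \<in> X) F})"
    and small: "\<And>s. s \<in> S \<Longrightarrow> u s \<le> \<kappa>"
    by (rule not_robustD[OF not_robust fine \<kappa>(1)], rule that)
  obtain X where X: "X \<subseteq> W" "u \<in> convex hull (?e ` X)" using u by auto
  have "convex hull (?e ` X) \<subseteq> convex hull (?e ` W)" by (intro hull_mono image_mono X(1))
  then have "u \<in> convex hull (?e ` W)" using X(2) by (rule subsetD)
  \<comment> \<open>The weights of \<open>u\<close> are never named: the right-hand side is a convex
    set of \<open>u\<close> that contains the generators, and so carries the weights over from
    indicators to the functions \<open>B p\<close>.\<close>
  moreover have "convex hull (?e ` W) \<subseteq>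
      {u. \<exists>y\<in>convex hull (B ` U). \<forall>s\<in>S. \<bar>y s - f s\<bar> \<le> \<delta> / 2 + 2 * \<bar>M\<bar> * u s}"
  proof (rule hull_minimal)
    show "?e ` W \<subseteq> {u. \<exists>y\<in>convex hull (B ` U). \<forall>s\<in>S. \<bar>y s - f s\<bar> \<le> \<delta> / 2 + 2 * \<bar>M\<bar> * u s}"
    proof (rule image_subsetI, rule CollectI)
      fix p assume p: "p \<in> W"
      have "\<bar>B p s - f s\<bar> \<le> \<delta> / 2 + 2 * \<bar>M\<bar> * ?e p s" if s: "s \<in> S" for s
        using f[OF s] bd[of p s] p s \<delta> unfolding W_def exceed_def indicator_def
          by (auto simp: abs_le_iff split: if_splits)
      then show "\<exists>y\<in>convex hull (B ` U). \<forall>s\<in>S. \<bar>y s - f s\<bar> \<le> \<delta> / 2 + 2 * \<bar>M\<bar> * ?e p s"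
        using p unfolding W_def by (intro bexI[of _ "B p"] hull_inc) auto
    qed
    show "convex {u. \<exists>y\<in>convex hull (B ` U). \<forall>s\<in>S. \<bar>y s - f s\<bar> \<le> \<delta> / 2 + 2 * \<bar>M\<bar> * u s}"
    proof (rule convexI, rule CollectI)
      fix u v and a b :: real
      assume u: "u \<in> {u. \<exists>y\<in>convex hull (B ` U). \<forall>s\<in>S. \<bar>y s - f s\<bar> \<le> \<delta> / 2 + 2 * \<bar>M\<bar> * u s}"
        and v: "v \<in> {u. \<exists>y\<in>convex hull (B ` U). \<forall>s\<in>S. \<bar>y s - f s\<bar> \<le> \<delta> / 2 + 2 * \<bar>M\<bar> * u s}"
        and ab: "0 \<le> a" "0 \<le> b" "a + b = 1"
      obtain y where y: "y \<in> convex hull (B ` U)" "\<And>s. s \<in> S \<Longrightarrow> \<bar>y s - f s\<bar> \<le> \<delta> / 2 + 2 * \<bar>M\<bar> * u s"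
        using u by auto
      obtain z where z: "z \<in> convex hull (B ` U)" "\<And>s. s \<in> S \<Longrightarrow> \<bar>z s - f s\<bar> \<le> \<delta> / 2 + 2 * \<bar>M\<bar> * v s"
        using v by auto
      have "\<bar>(a *\<^sub>R y + b *\<^sub>R z) s - f s\<bar> \<le> \<delta> / 2 + 2 * \<bar>M\<bar> * (a *\<^sub>R u + b *\<^sub>R v) s" if s: "s \<in> S" for s
      proof -
        have b: "b = 1 - a" using ab by simp
        have "(a *\<^sub>R y + b *\<^sub>R z) s - f s = a * (y s - f s) + b * (z s - f s)"
          unfolding b by (simp add: scaleR_fun_def plus_fun_def algebra_simps)
        also have "\<bar>\<dots>\<bar> \<le> a * \<bar>y s - f s\<bar> + b * \<bar>z s - f s\<bar>"
          using ab by (intro order_trans[OF abs_triangle_ineq]) (simp add: abs_mult)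
        also have "\<dots> \<le> a * (\<delta> / 2 + 2 * \<bar>M\<bar> * u s) + b * (\<delta> / 2 + 2 * \<bar>M\<bar> * v s)"
          using y(2)[OF s] z(2)[OF s] ab by (intro add_mono mult_left_mono) auto
        also have "\<dots> = \<delta> / 2 + 2 * \<bar>M\<bar> * (a *\<^sub>R u + b *\<^sub>R v) s"
          unfolding b by (simp add: scaleR_fun_def plus_fun_def field_simps)
        finally show ?thesis .
      qed
      moreover have "a *\<^sub>R y + b *\<^sub>R z \<in> convex hull (B ` U)"
        using y(1) z(1) ab by (intro convexD[OF convex_convex_hull]) auto
      ultimately show "\<exists>y\<in>convex hull (B ` U). \<forall>s\<in>S. \<bar>y s - f s\<bar> \<le> \<delta> / 2 + 2 * \<bar>M\<bar> * (a *\<^sub>R u + b *\<^sub>R v) s"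
        by blast
    qed
  qed
  ultimately obtain y where y: "y \<in> convex hull (B ` U)"
    "\<And>s. s \<in> S \<Longrightarrow> \<bar>y s - f s\<bar> \<le> \<delta> / 2 + 2 * \<bar>M\<bar> * u s" by auto
  have "\<bar>y s - f s\<bar> \<le> \<delta>" if s: "s \<in> S" for s
  proof -
    have "2 * \<bar>M\<bar> * u s \<le> 2 * \<bar>M\<bar> * \<kappa>" using small[OF s] by (intro mult_left_mono) auto
    then show ?thesis using y(2)[OF s] \<kappa>(2) by linarith
  qed
  then show ?thesis using y(1) by blast
qed

section \<open>Convexly compact sets of functions\<close>

lemma convex_uniform_ball: "convex {y :: 's \<Rightarrow> real. \<forall>s. \<bar>y s - f s\<bar> \<le> \<delta>}"
proof (rule convexI, rule CollectI, rule allI)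
  fix y z :: "'s \<Rightarrow> real" and u v :: real and s
  assume yz: "y \<in> {y. \<forall>s. \<bar>y s - f s\<bar> \<le> \<delta>}" "z \<in> {y. \<forall>s. \<bar>y s - f s\<bar> \<le> \<delta>}"
    and uv: "0 \<le> u" "0 \<le> v" "u + v = 1"
  have v: "v = 1 - u" using uv by simp
  have "(u *\<^sub>R y + v *\<^sub>R z) s - f s = u * (y s - f s) + v * (z s - f s)"
    unfolding v by (simp add: scaleR_fun_def plus_fun_def algebra_simps)
  also have "\<bar>\<dots>\<bar> \<le> \<delta>"
    using yz uv by (intro abs_convex_bound_le) auto
  finally show "\<bar>(u *\<^sub>R y + v *\<^sub>R z) s - f s\<bar> \<le> \<delta>" .
qed

lemma convex_hull_evaluation_linear:
  fixes u :: "('s \<Rightarrow> real) \<Rightarrow> real"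
  assumes "u \<in> convex hull ((\<lambda>s p. p s) ` X)"
  shows "u (a *\<^sub>R p + b *\<^sub>R q) = a * u p + b * u q"
proof -
  have "convex hull ((\<lambda>s p. p s) ` X) \<subseteq> {u :: ('s \<Rightarrow> real) \<Rightarrow> real. u (a *\<^sub>R p + b *\<^sub>R q) = a * u p + b * u q}"
    by (rule hull_minimal) (auto simp: convex_def scaleR_fun_def plus_fun_def algebra_simps)
  then show ?thesis using assms by blast
qed

lemma convex_hull_evaluation_bound:
  fixes u :: "('s \<Rightarrow> real) \<Rightarrow> real"
  assumes "u \<in> convex hull ((\<lambda>s p. p s) ` X)"
  shows "(\<And>s. s \<in> X \<Longrightarrow> p s \<le> t) \<Longrightarrow> u p \<le> t" and "(\<And>s. s \<in> X \<Longrightarrow> t \<le> p s) \<Longrightarrow> t \<le> u p"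
proof -
  have "convex hull ((\<lambda>s p. p s) ` X) \<subseteq> {u :: ('s \<Rightarrow> real) \<Rightarrow> real. u p \<le> t}" if "\<And>s. s \<in> X \<Longrightarrow> p s \<le> t"
    by (rule hull_minimal)
      (use that in \<open>auto simp: convex_def scaleR_fun_def plus_fun_def intro: convex_bound_le\<close>)
  then show "(\<And>s. s \<in> X \<Longrightarrow> p s \<le> t) \<Longrightarrow> u p \<le> t" using assms by blast
  have "convex hull ((\<lambda>s p. p s) ` X) \<subseteq> {u :: ('s \<Rightarrow> real) \<Rightarrow> real. - u p \<le> - t}" if "\<And>s. s \<in> X \<Longrightarrow> t \<le> p s"
  proof (rule hull_minimal)
    show "convex {u :: ('s \<Rightarrow> real) \<Rightarrow> real. - u p \<le> - t}"
    proof (rule convexI, rule CollectI)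
      fix u v :: "('s \<Rightarrow> real) \<Rightarrow> real" and a b :: real
      assume "u \<in> {u. - u p \<le> - t}" "v \<in> {u. - u p \<le> - t}" "0 \<le> a" "0 \<le> b" "a + b = 1"
      then have "a * (- u p) + b * (- v p) \<le> - t" by (intro convex_bound_le) auto
      then show "- (a *\<^sub>R u + b *\<^sub>R v) p \<le> - t" by (simp add: scaleR_fun_def plus_fun_def)
    qed
  qed (use that in auto)
  then show "(\<And>s. s \<in> X \<Longrightarrow> t \<le> p s) \<Longrightarrow> t \<le> u p" using assms by force
qed

lemma convex_hull_image_finite_part:
  assumes "u \<in> convex hull (h ` range x)"
  obtains n :: nat where "u \<in> convex hull (h ` x ` {..<n})"
proof -
  have "convex hull (h ` range x) \<subseteq> {u. \<exists>n. u \<in> convex hull (h ` x ` {..<n})}"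
  proof (rule hull_minimal)
    show "h ` range x \<subseteq> {u. \<exists>n. u \<in> convex hull (h ` x ` {..<n})}"
    proof clarify
      fix i show "\<exists>n. h (x i) \<in> convex hull (h ` x ` {..<n})"
        by (rule exI[of _ "Suc i"], rule hull_inc) auto
    qed
    show "convex {u. \<exists>n. u \<in> convex hull (h ` x ` {..<n})}"
    proof (rule convexI, rule CollectI)
      fix u v and a b :: real
      assume "u \<in> {u. \<exists>n. u \<in> convex hull (h ` x ` {..<n})}" "v \<in> {u. \<exists>n. u \<in> convex hull (h ` x ` {..<n})}"
        and ab: "0 \<le> a" "0 \<le> b" "a + b = 1"
      then obtain m n where mn: "u \<in> convex hull (h ` x ` {..<m})" "v \<in> convex hull (h ` x ` {..<n})" by blast
      have "convex hull (h ` x ` {..<m}) \<subseteq> convex hull (h ` x ` {..<max m n})"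
        "convex hull (h ` x ` {..<n}) \<subseteq> convex hull (h ` x ` {..<max m n})"
        by (intro hull_mono image_mono; auto)+
      with mn have "a *\<^sub>R u + b *\<^sub>R v \<in> convex hull (h ` x ` {..<max m n})"
        by (intro convexD[OF convex_convex_hull] ab) auto
      then show "\<exists>n. a *\<^sub>R u + b *\<^sub>R v \<in> convex hull (h ` x ` {..<n})" ..
    qed
  qed
  then show ?thesis using assms that by blast
qed

text \<open>The theorem of Mazur type with points and functions exchanged: means of early and of
  late evaluations approximate the same cluster point uniformly on \<open>A\<close>. Their
  difference is linear in \<open>p\<close>, so the estimate extends to the convex hull.\<close>

lemma no_order_close_combinations:
  fixes A :: "('s \<Rightarrow> real) set"
  assumes no: "no_order (\<lambda>p s. p s) A S" and bd: "\<And>p s. p \<in> A \<Longrightarrow> s \<in> S \<Longrightarrow> \<bar>p s\<bar> \<le> M"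
    and x: "\<And>i::nat. x i \<in> S" and \<delta>: "\<delta> > 0"
  shows "\<exists>n. \<exists>u\<in>convex hull ((\<lambda>s p. p s) ` x ` {..<n}). \<exists>v\<in>convex hull ((\<lambda>s p. p s) ` x ` {n<..}).
    \<forall>p\<in>convex hull A. \<bar>u p - v p\<bar> \<le> \<delta>"
proof -
  let ?ev = "\<lambda>s (p :: 's \<Rightarrow> real). p s"
  have F0: "filtermap x sequentially \<noteq> bot" by (simp add: filtermap_bot_iff)
  have "eventually (\<lambda>s. \<forall>p\<in>A. \<bar>?ev s p\<bar> \<le> M) (filtermap x sequentially)"
    using bd x by (simp add: eventually_filtermap)
  then obtain F f where F: "F \<le> filtermap x sequentially" "F \<noteq> bot"
    and lim: "\<And>p. p \<in> A \<Longrightarrow> ((\<lambda>s. ?ev s p) \<longlongrightarrow> f p) F"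
    by (rule pointwise_convergent_refinement[OF F0]) metis
  have ev: "eventually (\<lambda>s. s \<in> x ` {n..}) F" for n
  proof -
    have "eventually (\<lambda>i. x i \<in> x ` {n..}) sequentially"
      using eventually_ge_at_top[of n] by (rule eventually_mono) auto
    then have "eventually (\<lambda>s. s \<in> x ` {n..}) (filtermap x sequentially)"
      by (simp add: eventually_filtermap)
    then show ?thesis using F(1) by (simp add: filter_leD)
  qed
  have S: "eventually (\<lambda>s. s \<in> S) F"
    by (rule eventually_mono[OF ev[of 0]]) (use x in auto)
  have approx: "\<exists>y\<in>convex hull (?ev ` x ` {n..}). \<forall>p\<in>A. \<bar>y p - f p\<bar> \<le> \<delta> / 2" for n
    by (rule no_order_Mazur[OF no_order_transpose[OF no] _ F(2) lim S ev]) (use bd \<delta> in auto)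
  obtain u where u: "u \<in> convex hull (?ev ` range x)" "\<forall>p\<in>A. \<bar>u p - f p\<bar> \<le> \<delta> / 2"
    using approx[of 0] by (auto simp: atLeast_0)
  obtain n where n: "u \<in> convex hull (?ev ` x ` {..<n})"
    using convex_hull_image_finite_part[OF u(1)] .
  \<comment> \<open>Starting at \<open>Suc n\<close> leaves the index \<open>n\<close> free: the
    function \<open>p n\<close> will be compared with points of strictly smaller and strictly larger
    index.\<close>
  obtain v where v: "v \<in> convex hull (?ev ` x ` {n<..})" "\<forall>p\<in>A. \<bar>v p - f p\<bar> \<le> \<delta> / 2"
    using approx[of "Suc n"] by (auto simp: atLeast_Suc_greaterThan)
  note lin = convex_hull_evaluation_linear[OF n] convex_hull_evaluation_linear[OF v(1)]
  have "convex hull A \<subseteq> {p. \<bar>u p - v p\<bar> \<le> \<delta>}"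
  proof (rule hull_minimal)
    show "A \<subseteq> {p. \<bar>u p - v p\<bar> \<le> \<delta>}"
    proof
      fix p assume "p \<in> A"
      then have "\<bar>u p - f p\<bar> \<le> \<delta> / 2" "\<bar>v p - f p\<bar> \<le> \<delta> / 2" using u(2) v(2) by auto
      then show "p \<in> {p. \<bar>u p - v p\<bar> \<le> \<delta>}" unfolding mem_Collect_eq by linarith
    qed
    show "convex {p. \<bar>u p - v p\<bar> \<le> \<delta>}"
    proof (rule convexI, rule CollectI)
      fix p q and a b :: real
      assume pq: "p \<in> {p. \<bar>u p - v p\<bar> \<le> \<delta>}" "q \<in> {p. \<bar>u p - v p\<bar> \<le> \<delta>}" and ab: "0 \<le> a" "0 \<le> b" "a + b = 1"
      have "u (a *\<^sub>R p + b *\<^sub>R q) - v (a *\<^sub>R p + b *\<^sub>R q) = a * (u p - v p) + b * (u q - v q)"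
        unfolding lin by (simp add: algebra_simps)
      also have "\<bar>\<dots>\<bar> \<le> \<delta>"
        using pq ab by (intro abs_convex_bound_le) auto
      finally show "\<bar>u (a *\<^sub>R p + b *\<^sub>R q) - v (a *\<^sub>R p + b *\<^sub>R q)\<bar> \<le> \<delta>" .
    qed
  qed
  then show ?thesis using n v(1) by (intro exI bexI) auto
qed

text \<open>In a half graph the function \<open>p n\<close> is on one side of the gap at all earlier
  points and on the other side at all later ones. Means of evaluations keep these bounds, yet
  \<open>u\<close> and \<open>v\<close> differ by at most half of the gap.\<close>

lemma no_order_convex_hull:
  fixes A :: "('s \<Rightarrow> real) set"
  assumes no: "no_order (\<lambda>p s. p s) A S" and bd: "\<And>p s. p \<in> A \<Longrightarrow> s \<in> S \<Longrightarrow> \<bar>p s\<bar> \<le> M"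
  shows "no_order (\<lambda>p s. p s) (convex hull A) S"
proof (rule no_orderI)
  fix p :: "nat \<Rightarrow> 's \<Rightarrow> real" and x :: "nat \<Rightarrow> 's" and r t :: real
  assume p: "\<And>i. p i \<in> convex hull A" and x: "\<And>i. x i \<in> S" and rt: "r < t"
  have "(t - r) / 2 > 0" using rt by simp
  have "\<exists>n. \<exists>u\<in>convex hull ((\<lambda>s p. p s) ` x ` {..<n}). \<exists>v\<in>convex hull ((\<lambda>s p. p s) ` x ` {n<..}).
    \<forall>p\<in>convex hull A. \<bar>u p - v p\<bar> \<le> (t - r) / 2"
    by (rule no_order_close_combinations[of A S M x]; (fact | simp add: x bd))
  then
  obtain n u v where u: "u \<in> convex hull ((\<lambda>s p. p s) ` x ` {..<n})"
    and v: "v \<in> convex hull ((\<lambda>s p. p s) ` x ` {n<..})"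
    and uv: "\<forall>p\<in>convex hull A. \<bar>u p - v p\<bar> \<le> (t - r) / 2" by blast
  note close = bspec[OF uv p[of n]]
  {
    assume lo: "\<And>i j. i < j \<Longrightarrow> p i (x j) \<le> r" and hi: "\<And>i j. i < j \<Longrightarrow> t \<le> p j (x i)"
    have "t \<le> u (p n)" by (rule convex_hull_evaluation_bound(2)[OF u]) (use hi in auto)
    moreover have "v (p n) \<le> r" by (rule convex_hull_evaluation_bound(1)[OF v]) (use lo in auto)
    ultimately show False using close rt by (auto simp: abs_le_iff field_simps)
  next
    assume hi: "\<And>i j. i < j \<Longrightarrow> t \<le> p i (x j)" and lo: "\<And>i j. i < j \<Longrightarrow> p j (x i) \<le> r"
    have "u (p n) \<le> r" by (rule convex_hull_evaluation_bound(1)[OF u]) (use lo in auto)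
    moreover have "t \<le> v (p n)" by (rule convex_hull_evaluation_bound(2)[OF v]) (use hi in auto)
    ultimately show False using close rt by (auto simp: abs_le_iff field_simps)
  }
qed

text \<open>At each scale the members only have to come close to one point \<open>f\<close>. This
  approximate form is stable under uniform perturbation of \<open>A\<close>, which the interpolation
  argument relies on.\<close>

definition convexly_compact :: "('s \<Rightarrow> real) set \<Rightarrow> bool"
  where "convexly_compact A \<longleftrightarrow>
    (\<forall>\<C> \<delta>. convex_base \<C> \<and> (\<forall>C\<in>\<C>. C \<subseteq> A) \<and> \<delta> > 0 \<longrightarrow> (\<exists>f. \<forall>C\<in>\<C>. \<exists>y\<in>C. \<forall>s. \<bar>y s - f s\<bar> \<le> \<delta>))"

lemma convexly_compactD:
  assumes "convexly_compact A" "convex_base \<C>" "\<And>C. C \<in> \<C> \<Longrightarrow> C \<subseteq> A" "\<delta> > 0"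
  shows "\<exists>f. \<forall>C\<in>\<C>. \<exists>y\<in>C. \<forall>s. \<bar>y s - f s\<bar> \<le> \<delta>"
  using assms(1)[unfolded convexly_compact_def, rule_format, of \<C> \<delta>] assms(2-4) by simp

text \<open>The base generates a filter with a pointwise cluster point \<open>f\<close>. For each
  member \<open>C\<close> the filter lives on \<open>C\<close>, so \<open>no_order_Mazur\<close>
  gives a mean of points of \<open>C\<close> near \<open>f\<close>, and this mean is in
  \<open>C\<close> by convexity.\<close>

lemma no_order_imp_convexly_compact:
  fixes A :: "('s \<Rightarrow> real) set"
  assumes no: "no_order (\<lambda>p s. p s) A UNIV" and bd: "\<And>p s. p \<in> A \<Longrightarrow> \<bar>p s\<bar> \<le> M"
  shows "convexly_compact (convex hull A)"
  unfolding convexly_compact_def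
proof (intro allI impI, elim conjE)
  fix \<C> :: "('s \<Rightarrow> real) set set" and \<delta> :: real
  assume base: "convex_base \<C>" and sub: "\<forall>C\<in>\<C>. C \<subseteq> convex hull A" and \<delta>: "\<delta> > 0"
  have "convex hull A \<subseteq> {p. \<forall>s. \<bar>p s - 0\<bar> \<le> M}"
    by (rule hull_minimal[where S = convex, OF _ convex_uniform_ball]) (use bd in auto)
  then have bd': "\<bar>p s\<bar> \<le> M" if "p \<in> convex hull A" for p s using that by auto
  have no': "no_order (\<lambda>p s. p s) (convex hull A) UNIV" by (rule no_order_convex_hull[of A UNIV M]) (use no bd in auto)
  define F0 where "F0 = (INF C\<in>\<C>. principal C)"
  have ev: "eventually P F0 \<longleftrightarrow> (\<exists>C\<in>\<C>. \<forall>p\<in>C. P p)" for P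
    unfolding F0_def
  proof (subst eventually_INF_base)
    show "\<C> \<noteq> {}" by (rule convex_baseD(1)[OF base])
    show "\<exists>E\<in>\<C>. principal E \<le> inf (principal C) (principal D)" if "C \<in> \<C>" "D \<in> \<C>" for C D
      using convex_baseD(4)[OF base that] by auto
  qed (simp add: eventually_principal)
  have "F0 \<noteq> bot"
    unfolding eventually_False[symmetric] ev using convex_baseD(3)[OF base] by blast
  moreover have evA: "eventually (\<lambda>p. p \<in> convex hull A) F0"
    unfolding ev using sub convex_baseD(1)[OF base] by blast
  then have "eventually (\<lambda>p. \<forall>s\<in>UNIV. \<bar>p s\<bar> \<le> M) F0"
    by (rule eventually_mono) (use bd' in auto)
  ultimately obtain F f where F: "F \<le> F0" "F \<noteq> bot" and lim: "\<And>s. s \<in> UNIV \<Longrightarrow> ((\<lambda>p. p s) \<longlongrightarrow> f s) F"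
    by (rule pointwise_convergent_refinement) metis
  have "\<exists>y\<in>C. \<forall>s. \<bar>y s - f s\<bar> \<le> \<delta>" if C: "C \<in> \<C>" for C
  proof -
    have "eventually (\<lambda>p. p \<in> C) F0" unfolding ev using C by blast
    then have C': "eventually (\<lambda>p. p \<in> C) F" by (rule filter_leD[OF F(1)])
    have "\<exists>y\<in>convex hull ((\<lambda>p. p) ` C). \<forall>s\<in>UNIV. \<bar>y s - f s\<bar> \<le> \<delta>"
      by (rule no_order_Mazur[of _ "convex hull A" UNIV M F];
          (rule no' F(2) lim filter_leD[OF F(1) evA] C' \<delta> bd'; assumption?))
    then show ?thesis using convex_baseD(2)[OF base C] by (simp add: hull_same)
  qed
  then show "\<exists>f. \<forall>C\<in>\<C>. \<exists>y\<in>C. \<forall>s. \<bar>y s - f s\<bar> \<le> \<delta>" by blast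
qed

lemma convexly_compact_subset:
  assumes "convexly_compact B" "A \<subseteq> B"
  shows "convexly_compact A"
  unfolding convexly_compact_def
proof (intro allI impI, elim conjE)
  fix \<C> :: "('a \<Rightarrow> real) set set" and \<delta> :: real
  assume "convex_base \<C>" "\<forall>C\<in>\<C>. C \<subseteq> A" "\<delta> > 0"
  then show "\<exists>f. \<forall>C\<in>\<C>. \<exists>y\<in>C. \<forall>s. \<bar>y s - f s\<bar> \<le> \<delta>"
    using assms(2) by (intro convexly_compactD[OF assms(1)]) auto
qed

text \<open>The analogue of Grothendieck's criterion that a set which is within every
  \<open>\<delta>\<close> of some weakly compact set is relatively weakly compact. The base is
  transported to \<open>A'\<close> by passing to points at distance at most
  \<open>\<delta> / 2\<close>.\<close>

lemma convexly_compact_approx: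
  assumes "\<And>\<delta>. \<delta> > 0 \<Longrightarrow> \<exists>A'. convex A' \<and> convexly_compact A' \<and> (\<forall>a\<in>A. \<exists>a'\<in>A'. \<forall>s. \<bar>a s - a' s\<bar> \<le> \<delta>)"
  shows "convexly_compact A"
  unfolding convexly_compact_def
proof (intro allI impI, elim conjE)
  fix \<C> :: "('a \<Rightarrow> real) set set" and \<delta> :: real
  assume base: "convex_base \<C>" and sub: "\<forall>C\<in>\<C>. C \<subseteq> A" and \<delta>: "\<delta> > 0"
  obtain A' where A': "convex A'" "convexly_compact A'" "\<And>a. a \<in> A \<Longrightarrow> \<exists>a'\<in>A'. \<forall>s. \<bar>a s - a' s\<bar> \<le> \<delta> / 2"
    using assms[of "\<delta> / 2"] \<delta> by auto
  define \<Psi> where "\<Psi> C = {a'\<in>A'. \<exists>a\<in>C. \<forall>s. \<bar>a s - a' s\<bar> \<le> \<delta> / 2}" for C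
  have "convex_base (\<Psi> ` \<C>)"
  proof (rule convex_base_image[OF base])
    show "\<Psi> C \<subseteq> \<Psi> D" if "C \<subseteq> D" for C D using that by (auto simp: \<Psi>_def)
    fix C assume C: "C \<in> \<C>"
    obtain a where "a \<in> C" "a \<in> A" using convex_baseD(3)[OF base C] sub C by blast
    moreover obtain a' where "a' \<in> A'" "\<forall>s. \<bar>a s - a' s\<bar> \<le> \<delta> / 2" using A'(3)[OF \<open>a \<in> A\<close>] by blast
    ultimately have "a' \<in> \<Psi> C" by (auto simp: \<Psi>_def)
    then show "\<Psi> C \<noteq> {}" by blast
    show "convex (\<Psi> C)"
    proof (rule convexI)
      fix x y and u v :: real
      assume xy: "x \<in> \<Psi> C" "y \<in> \<Psi> C" and uv: "0 \<le> u" "0 \<le> v" "u + v = 1"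
      obtain a where a: "a \<in> C" "\<And>s. \<bar>a s - x s\<bar> \<le> \<delta> / 2" using xy(1) by (auto simp: \<Psi>_def)
      obtain b where b: "b \<in> C" "\<And>s. \<bar>b s - y s\<bar> \<le> \<delta> / 2" using xy(2) by (auto simp: \<Psi>_def)
      have "u *\<^sub>R a + v *\<^sub>R b \<in> C"
        by (rule convexD[OF convex_baseD(2)[OF base C] a(1) b(1) uv])
      moreover have "u *\<^sub>R x + v *\<^sub>R y \<in> A'"
        by (rule convexD[OF A'(1) _ _ uv]) (use xy in \<open>auto simp: \<Psi>_def\<close>)
      moreover have "\<bar>(u *\<^sub>R a + v *\<^sub>R b) s - (u *\<^sub>R x + v *\<^sub>R y) s\<bar> \<le> \<delta> / 2" for s
      proof -
        have "(u *\<^sub>R a + v *\<^sub>R b) s - (u *\<^sub>R x + v *\<^sub>R y) s = u * (a s - x s) + v * (b s - y s)"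
          by (simp add: scaleR_fun_def plus_fun_def algebra_simps)
        also have "\<bar>\<dots>\<bar> \<le> \<delta> / 2"
          using a(2) b(2) uv by (intro abs_convex_bound_le) auto
        finally show ?thesis .
      qed
      ultimately show "u *\<^sub>R x + v *\<^sub>R y \<in> \<Psi> C" unfolding \<Psi>_def by blast
    qed
  qed
  moreover have "C \<subseteq> A'" if "C \<in> \<Psi> ` \<C>" for C using that by (auto simp: \<Psi>_def)
  ultimately have "\<exists>f. \<forall>C\<in>\<Psi> ` \<C>. \<exists>y\<in>C. \<forall>s. \<bar>y s - f s\<bar> \<le> \<delta> / 2"
    using \<delta> by (intro convexly_compactD[OF A'(2)]; (assumption | simp))
  then obtain f where f: "\<forall>C\<in>\<Psi> ` \<C>. \<exists>y\<in>C. \<forall>s. \<bar>y s - f s\<bar> \<le> \<delta> / 2" by (rule exE)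
  have "\<exists>y\<in>C. \<forall>s. \<bar>y s - f s\<bar> \<le> \<delta>" if C: "C \<in> \<C>" for C
  proof -
    obtain y where "y \<in> \<Psi> C" and y: "\<And>s. \<bar>y s - f s\<bar> \<le> \<delta> / 2" using bspec[OF f imageI[OF C]] by blast
    then obtain a where a: "a \<in> C" "\<And>s. \<bar>a s - y s\<bar> \<le> \<delta> / 2" by (auto simp: \<Psi>_def)
    have "\<bar>a s - f s\<bar> \<le> \<delta>" for s using a(2)[of s] y[of s] by linarith
    then show ?thesis using a(1) by blast
  qed
  then show "\<exists>f. \<forall>C\<in>\<C>. \<exists>y\<in>C. \<forall>s. \<bar>y s - f s\<bar> \<le> \<delta>" by blast
qed

text \<open>The two summands are localised one after the other: independent choices would not
  guarantee that the two components belong to the same element of \<open>C\<close>.\<close>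

lemma convexly_compact_sum:
  fixes A B :: "('s \<Rightarrow> real) set"
  assumes A: "convexly_compact A" "convex A" and B: "convexly_compact B" "convex B"
  shows "convexly_compact {a + b |a b. a \<in> A \<and> b \<in> B}"
  unfolding convexly_compact_def
proof (intro allI impI, elim conjE)
  fix \<C> :: "('s \<Rightarrow> real) set set" and \<delta> :: real
  assume base: "convex_base \<C>" and sub: "\<forall>C\<in>\<C>. C \<subseteq> {a + b |a b. a \<in> A \<and> b \<in> B}" and \<delta>: "\<delta> > 0"
  have part: "convex {a\<in>X. \<exists>b\<in>Y. a + b \<in> C}" if "convex X" "convex Y" "convex C" for X Y C :: "('s \<Rightarrow> real) set"
  proof (rule convexI)
    fix x y and u v :: real
    assume xy: "x \<in> {a\<in>X. \<exists>b\<in>Y. a + b \<in> C}" "y \<in> {a\<in>X. \<exists>b\<in>Y. a + b \<in> C}" and uv: "0 \<le> u" "0 \<le> v" "u + v = 1"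
    obtain a where a: "a \<in> Y" "x + a \<in> C" using xy(1) by auto
    obtain b where b: "b \<in> Y" "y + b \<in> C" using xy(2) by auto
    have "u *\<^sub>R x + v *\<^sub>R y + (u *\<^sub>R a + v *\<^sub>R b) = u *\<^sub>R (x + a) + v *\<^sub>R (y + b)"
      by (simp add: algebra_simps)
    also have "\<dots> \<in> C" by (rule convexD[OF that(3) a(2) b(2) uv])
    finally have "u *\<^sub>R x + v *\<^sub>R y + (u *\<^sub>R a + v *\<^sub>R b) \<in> C" .
    moreover have "u *\<^sub>R a + v *\<^sub>R b \<in> Y" by (rule convexD[OF that(2) a(1) b(1) uv])
    moreover have "u *\<^sub>R x + v *\<^sub>R y \<in> X" by (rule convexD[OF that(1) _ _ uv]) (use xy in auto)
    ultimately show "u *\<^sub>R x + v *\<^sub>R y \<in> {a\<in>X. \<exists>b\<in>Y. a + b \<in> C}" by blast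
  qed
  define \<Psi> where "\<Psi> C = {a\<in>A. \<exists>b\<in>B. a + b \<in> C}" for C
  have "convex_base (\<Psi> ` \<C>)"
  proof (rule convex_base_image[OF base])
    show "\<Psi> C \<subseteq> \<Psi> D" if "C \<subseteq> D" for C D using that by (auto simp: \<Psi>_def)
    fix C assume C: "C \<in> \<C>"
    show "convex (\<Psi> C)" unfolding \<Psi>_def by (rule part[OF A(2) B(2) convex_baseD(2)[OF base C]])
    show "\<Psi> C \<noteq> {}" using convex_baseD(3)[OF base C] sub C unfolding \<Psi>_def by fast
  qed
  moreover have "C \<subseteq> A" if "C \<in> \<Psi> ` \<C>" for C using that by (auto simp: \<Psi>_def)
  ultimately have "\<exists>f. \<forall>C\<in>\<Psi> ` \<C>. \<exists>y\<in>C. \<forall>s. \<bar>y s - f s\<bar> \<le> \<delta> / 2"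
    using \<delta> by (intro convexly_compactD[OF A(1)]; (assumption | simp))
  then obtain f where f: "\<forall>C\<in>\<Psi> ` \<C>. \<exists>y\<in>C. \<forall>s. \<bar>y s - f s\<bar> \<le> \<delta> / 2" by (rule exE)
  \<comment> \<open>From here on only decompositions whose first component is near \<open>f\<close>
    are considered, and the second components are localised among those.\<close>
  define A' where "A' = A \<inter> {y. \<forall>s. \<bar>y s - f s\<bar> \<le> \<delta> / 2}"
  have A': "convex A'" unfolding A'_def by (intro convex_Int A(2) convex_uniform_ball)
  define \<Phi> where "\<Phi> C = {b\<in>B. \<exists>a\<in>A'. b + a \<in> C}" for C
  have "convex_base (\<Phi> ` \<C>)"
  proof (rule convex_base_image[OF base])
    show "\<Phi> C \<subseteq> \<Phi> D" if "C \<subseteq> D" for C D using that by (auto simp: \<Phi>_def)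
    fix C assume C: "C \<in> \<C>"
    show "convex (\<Phi> C)" unfolding \<Phi>_def by (rule part[OF B(2) A' convex_baseD(2)[OF base C]])
    obtain y where y: "y \<in> \<Psi> C" "\<forall>s. \<bar>y s - f s\<bar> \<le> \<delta> / 2" using bspec[OF f imageI[OF C]] by blast
    then obtain b where "b \<in> B" "y + b \<in> C" by (auto simp: \<Psi>_def)
    then have "b \<in> \<Phi> C" using y by (auto simp: \<Phi>_def A'_def \<Psi>_def add.commute)
    then show "\<Phi> C \<noteq> {}" by blast
  qed
  moreover have "C \<subseteq> B" if "C \<in> \<Phi> ` \<C>" for C using that by (auto simp: \<Phi>_def)
  ultimately have "\<exists>g. \<forall>C\<in>\<Phi> ` \<C>. \<exists>y\<in>C. \<forall>s. \<bar>y s - g s\<bar> \<le> \<delta> / 2"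
    using \<delta> by (intro convexly_compactD[OF B(1)]; (assumption | simp))
  then obtain g where g: "\<forall>C\<in>\<Phi> ` \<C>. \<exists>y\<in>C. \<forall>s. \<bar>y s - g s\<bar> \<le> \<delta> / 2" by (rule exE)
  have "\<exists>y\<in>C. \<forall>s. \<bar>y s - (f + g) s\<bar> \<le> \<delta>" if C: "C \<in> \<C>" for C
  proof -
    obtain b where "b \<in> \<Phi> C" and b: "\<And>s. \<bar>b s - g s\<bar> \<le> \<delta> / 2" using bspec[OF g imageI[OF C]] by blast
    then obtain a where a: "b + a \<in> C" "\<And>s. \<bar>a s - f s\<bar> \<le> \<delta> / 2" by (auto simp: \<Phi>_def A'_def)
    have "\<bar>(b + a) s - (f + g) s\<bar> \<le> \<delta>" for s
      using a(2)[of s] b[of s] unfolding plus_fun_def by linarith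
    then show ?thesis using a(1) by blast
  qed
  then show "\<exists>f. \<forall>C\<in>\<C>. \<exists>y\<in>C. \<forall>s. \<bar>y s - f s\<bar> \<le> \<delta>" by blast
qed

lemma convexly_compact_scale:
  fixes A :: "('s \<Rightarrow> real) set"
  assumes "convexly_compact A" "c \<noteq> 0"
  shows "convexly_compact ((*\<^sub>R) c ` A)"
  unfolding convexly_compact_def
proof (intro allI impI, elim conjE)
  fix \<C> :: "('s \<Rightarrow> real) set set" and \<delta> :: real
  assume base: "convex_base \<C>" and sub: "\<forall>C\<in>\<C>. C \<subseteq> (*\<^sub>R) c ` A" and \<delta>: "\<delta> > 0"
  let ?\<Psi> = "\<lambda>C :: ('s \<Rightarrow> real) set. (*\<^sub>R) (1 / c) ` C"
  have "convex_base (?\<Psi> ` \<C>)"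
    by (rule convex_base_image[OF base])
      (auto intro!: convex_scaling dest: convex_baseD(2,3)[OF base])
  moreover have "D \<subseteq> A" if "D \<in> ?\<Psi> ` \<C>" for D
    using that sub \<open>c \<noteq> 0\<close> by force
  ultimately have "\<exists>f. \<forall>D\<in>?\<Psi> ` \<C>. \<exists>y\<in>D. \<forall>s. \<bar>y s - f s\<bar> \<le> \<delta> / \<bar>c\<bar>"
    using \<delta> \<open>c \<noteq> 0\<close> by (intro convexly_compactD[OF assms(1)]; (assumption | simp))
  then obtain f where f: "\<forall>D\<in>?\<Psi> ` \<C>. \<exists>y\<in>D. \<forall>s. \<bar>y s - f s\<bar> \<le> \<delta> / \<bar>c\<bar>" by (rule exE)
  have "\<exists>y\<in>C. \<forall>s. \<bar>y s - (c *\<^sub>R f) s\<bar> \<le> \<delta>" if C: "C \<in> \<C>" for C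
  proof -
    obtain y where y: "y \<in> C" "\<And>s. \<bar>((1 / c) *\<^sub>R y) s - f s\<bar> \<le> \<delta> / \<bar>c\<bar>"
      using bspec[OF f imageI[OF C]] by blast
    have "\<bar>y s - (c *\<^sub>R f) s\<bar> \<le> \<delta>" for s
    proof -
      have "y s - (c *\<^sub>R f) s = c * (((1 / c) *\<^sub>R y) s - f s)"
        using \<open>c \<noteq> 0\<close> by (simp add: scaleR_fun_def algebra_simps)
      also have "\<bar>\<dots>\<bar> = \<bar>c\<bar> * \<bar>((1 / c) *\<^sub>R y) s - f s\<bar>" using \<open>c \<noteq> 0\<close> by (simp add: abs_mult)
      also have "\<dots> \<le> \<bar>c\<bar> * (\<delta> / \<bar>c\<bar>)" using y(2)[of s] \<open>c \<noteq> 0\<close> by (intro mult_left_mono) auto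
      finally show ?thesis using \<open>c \<noteq> 0\<close> by simp
    qed
    then show ?thesis using y(1) by blast
  qed
  then show "\<exists>f. \<forall>C\<in>\<C>. \<exists>y\<in>C. \<forall>s. \<bar>y s - f s\<bar> \<le> \<delta>" by blast
qed

section \<open>Weakly almost periodic functions\<close>

lemma zero_dual_space: "(\<lambda>_. 0) \<in> dual_space V N"
  unfolding dual_space_def linear_map_on_def by (auto intro!: exI[of _ 0])

lemma topspace_weak_topology [simp]: "topspace (weak_topology V N) = V"
proof -
  have "V \<in> {{x\<in>V. f x \<in> U} | f U. f \<in> dual_space V N \<and> open U}"
    by (rule CollectI, rule exI[of _ "\<lambda>_. 0"], rule exI[of _ UNIV]) (simp add: zero_dual_space)
  then show ?thesis
    unfolding weak_topology_def topology_generated_by_topspace by blast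
qed

lemma closedin_weak_topology:
  assumes "f \<in> dual_space V N" "closed T"
  shows "closedin (weak_topology V N) {x\<in>V. f x \<in> T}"
  unfolding closedin_def
proof
  have "openin (weak_topology V N) {x\<in>V. f x \<in> - T}"
    unfolding weak_topology_def
    by (rule topology_generated_by_Basis, rule CollectI, rule exI[of _ f], rule exI[of _ "- T"])
      (use assms in \<open>auto simp: open_Compl\<close>)
  moreover have "V - {x\<in>V. f x \<in> T} = {x\<in>V. f x \<in> - T}" by auto
  ultimately show "openin (weak_topology V N) (topspace (weak_topology V N) - {x\<in>V. f x \<in> T})" by simp
qed auto

lemma linf_bound: "u \<in> linf \<Longrightarrow> \<bar>u s\<bar> \<le> linf_norm u"
  unfolding linf_norm_def linf_def
  by (rule cSUP_upper) (auto simp: bounded_iff bdd_above_def)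

lemma linf_iff: "u \<in> linf \<longleftrightarrow> (\<exists>M. \<forall>s. \<bar>u s\<bar> \<le> M)"
  unfolding linf_def bounded_iff by auto

lemma linf_add: assumes "u \<in> linf" "v \<in> linf" shows "u + v \<in> linf"
proof -
  have "\<bar>(u + v) s\<bar> \<le> linf_norm u + linf_norm v" for s
    using linf_bound[OF assms(1), of s] linf_bound[OF assms(2), of s] unfolding plus_fun_def by linarith
  then show ?thesis unfolding linf_iff by blast
qed

lemma linf_scaleR: assumes "u \<in> linf" shows "c *\<^sub>R u \<in> linf"
proof -
  have "\<bar>(c *\<^sub>R u) s\<bar> \<le> \<bar>c\<bar> * linf_norm u" for s
    using linf_bound[OF assms, of s] by (simp add: scaleR_fun_def abs_mult mult_left_mono)
  then show ?thesis unfolding linf_iff by blast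
qed

text \<open>
  Apart from evaluations, this is the only functional at which weak compactness in \<open>linf\<close> has to be
  tested.
\<close>

lemma limit_functional:
  fixes x :: "nat \<Rightarrow> 's"
  obtains \<Phi> F where "\<Phi> \<in> dual_space linf linf_norm" "F \<le> sequentially" "F \<noteq> bot"
    "\<And>u. u \<in> linf \<Longrightarrow> ((\<lambda>j. u (x j)) \<longlongrightarrow> \<Phi> u) F"
proof -
  have "eventually (\<lambda>j. \<forall>u\<in>linf. \<bar>u (x j)\<bar> \<le> linf_norm u) sequentially"
    by (simp add: linf_bound)
  then obtain F L where F: "F \<le> sequentially" "F \<noteq> bot"
    and L: "\<And>u. u \<in> linf \<Longrightarrow> ((\<lambda>j. u (x j)) \<longlongrightarrow> L u) F"
    by (rule pointwise_convergent_refinement[OF sequentially_bot]) metis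
  define \<Phi> where "\<Phi> u = (if u \<in> linf then L u else 0)" for u
  have "\<Phi> \<in> dual_space linf linf_norm"
    unfolding dual_space_def linear_map_on_def
  proof (intro CollectI conjI ballI allI impI exI)
    fix u v :: "'s \<Rightarrow> real" assume uv: "u \<in> linf" "v \<in> linf"
    have "((\<lambda>j. (u + v) (x j)) \<longlongrightarrow> L u + L v) F"
      unfolding plus_fun_def by (intro tendsto_add L uv)
    with L[OF linf_add[OF uv]] have "L (u + v) = L u + L v" by (rule tendsto_unique[OF F(2)])
    then show "\<Phi> (u + v) = \<Phi> u + \<Phi> v" using uv linf_add[OF uv] by (simp add: \<Phi>_def)
  next
    fix c and u :: "'s \<Rightarrow> real" assume u: "u \<in> linf"
    have "((\<lambda>j. (c *\<^sub>R u) (x j)) \<longlongrightarrow> c *\<^sub>R L u) F"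
      unfolding scaleR_fun_def by (intro tendsto_scaleR tendsto_const L u)
    with L[OF linf_scaleR[OF u]] have "L (c *\<^sub>R u) = c *\<^sub>R L u" by (rule tendsto_unique[OF F(2)])
    then show "\<Phi> (c *\<^sub>R u) = c *\<^sub>R \<Phi> u" using u linf_scaleR[OF u] by (simp add: \<Phi>_def)
  next
    fix u :: "'s \<Rightarrow> real" assume u: "u \<in> linf"
    have "\<bar>L u\<bar> \<le> linf_norm u"
      by (rule tendsto_bounded[OF L[OF u] F(2)]) (simp add: linf_bound[OF u])
    then show "\<bar>\<Phi> u\<bar> \<le> 1 * linf_norm u" using u by (simp add: \<Phi>_def)
  qed (auto simp: \<Phi>_def)
  moreover have "((\<lambda>j. u (x j)) \<longlongrightarrow> \<Phi> u) F" if "u \<in> linf" for u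
    using L[OF that] that by (simp add: \<Phi>_def)
  ultimately show ?thesis using that F by blast
qed

text \<open>The weakly closed sets \<open>Z\<close> and \<open>Y i\<close> have the finite
  intersection property on the closure of \<open>A\<close>, as \<open>p n\<close> lies in
  \<open>Z\<close> and in \<open>Y i\<close> for \<open>i < n\<close>. A common point
  \<open>u\<close> has \<open>t \<le> c * u (x j)\<close> for all \<open>j\<close> but
  \<open>c * \<Phi> u \<le> r\<close>, although \<open>\<Phi> u\<close> is a limit of these values.
  The factor \<open>c\<close> will be \<open>1\<close> or \<open>- 1\<close>, one for each kind of
  half graph.\<close>

lemma relatively_weakly_compact_no_order_aux:
  fixes A :: "('s \<Rightarrow> real) set" and c :: real and x :: "nat \<Rightarrow> 's"
  assumes A: "relatively_weakly_compact linf linf_norm A"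
    and p: "\<And>i::nat. p i \<in> A" and rt: "r < t"
    and lo: "\<And>i j. i < j \<Longrightarrow> c * p i (x j) \<le> r" and hi: "\<And>i j. i < j \<Longrightarrow> t \<le> c * p j (x i)"
  shows False
proof (rule limit_functional[of x])
  let ?X = "weak_topology (linf :: ('s \<Rightarrow> real) set) linf_norm"
  fix \<Phi> :: "('s \<Rightarrow> real) \<Rightarrow> real" and F
  assume \<Phi>: "\<Phi> \<in> dual_space linf linf_norm" and F: "F \<le> sequentially" "F \<noteq> bot"
    and lim: "\<And>u. u \<in> linf \<Longrightarrow> ((\<lambda>j. u (x j)) \<longlongrightarrow> \<Phi> u) F"
  have AV: "A \<subseteq> linf" and comp: "compactin ?X (?X closure_of A)"
    using A by (auto simp: relatively_weakly_compact_def)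
  define ev where "ev i u = (if u \<in> linf then u (x i) else 0)" for i :: nat and u :: "'s \<Rightarrow> real"
  have ev: "ev i \<in> dual_space linf linf_norm" for i
    unfolding dual_space_def linear_map_on_def
  proof (intro CollectI conjI ballI allI impI exI)
    show "\<bar>ev i u\<bar> \<le> 1 * linf_norm u" if "u \<in> linf" for u using that linf_bound by (simp add: ev_def)
  qed (auto simp: ev_def linf_add[unfolded plus_fun_def] linf_scaleR[unfolded scaleR_fun_def real_scaleR_def] plus_fun_def scaleR_fun_def)
  define Z where "Z = {u\<in>linf. \<Phi> u \<in> {y. c * y \<le> r}}"
  define Y where "Y i = {u\<in>linf. ev i u \<in> {y. t \<le> c * y}}" for i
  have "(?X closure_of A) \<inter> \<Inter>(insert Z (range Y)) \<noteq> {}"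
  proof (rule compactin_fip[THEN iffD1, OF comp, THEN conjunct2, rule_format], intro conjI ballI allI impI)
    fix C assume "C \<in> insert Z (range Y)"
    moreover have "closedin ?X Z" unfolding Z_def
      by (rule closedin_weak_topology[OF \<Phi>]) (intro closed_Collect_le continuous_intros)
    moreover have "closedin ?X (Y i)" for i unfolding Y_def
      by (rule closedin_weak_topology[OF ev]) (intro closed_Collect_le continuous_intros)
    ultimately show "closedin ?X C" by auto
  next
    fix \<F> assume "finite \<F> \<and> \<F> \<subseteq> insert Z (range Y)"
    then have "finite (\<F> - {Z})" "\<F> - {Z} \<subseteq> range Y" by auto
    then obtain I where I: "finite I" "\<F> - {Z} = Y ` I" by (metis finite_subset_image)
    then obtain n where n: "\<And>i. i \<in> I \<Longrightarrow> i < n" by (metis finite_nat_set_iff_bounded)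
    have pl: "p n \<in> linf" using p AV by blast
    have "p n \<in> Y i" if "i \<in> I" for i using hi[OF n[OF that]] pl by (simp add: Y_def ev_def)
    moreover have "p n \<in> Z"
    proof -
      have "eventually (\<lambda>j. n < j) F" by (rule filter_leD[OF F(1) eventually_gt_at_top])
      then have "eventually (\<lambda>j. c * p n (x j) \<le> r) F" by (rule eventually_mono) (rule lo)
      moreover have "((\<lambda>j. c * p n (x j)) \<longlongrightarrow> c * \<Phi> (p n)) F"
        by (intro tendsto_mult tendsto_const lim pl)
      ultimately have "c * \<Phi> (p n) \<le> r" using tendsto_upperbound F(2) by blast
      then show ?thesis using pl by (simp add: Z_def)
    qed
    ultimately have "p n \<in> \<Inter>\<F>" using I(2) by blast
    moreover have "p n \<in> ?X closure_of A"
      using closure_of_subset[of A ?X] AV p by auto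
    ultimately show "(?X closure_of A) \<inter> \<Inter>\<F> \<noteq> {}" by blast
  qed
  then obtain u where "u \<in> \<Inter>(insert Z (range Y))" by fast
  then have u: "u \<in> Z" "u \<in> Y i" for i by simp_all
  then have ul: "u \<in> linf" by (simp add: Z_def)
  have "t \<le> c * u (x j)" for j using u(2)[of j] ul by (simp add: Y_def ev_def)
  moreover have "((\<lambda>j. c * u (x j)) \<longlongrightarrow> c * \<Phi> u) F"
    by (intro tendsto_mult tendsto_const lim ul)
  ultimately have "t \<le> c * \<Phi> u" using tendsto_lowerbound[of "\<lambda>j. c * u (x j)" "c * \<Phi> u" F t] F(2) by simp
  then show False using u(1) rt by (simp add: Z_def)
qed

lemma relatively_weakly_compact_no_order:
  fixes A :: "('s \<Rightarrow> real) set"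
  assumes A: "relatively_weakly_compact linf linf_norm A"
  shows "no_order (\<lambda>p s. p s) A UNIV"
proof (rule no_orderI)
  fix p :: "nat \<Rightarrow> 's \<Rightarrow> real" and x :: "nat \<Rightarrow> 's" and r t :: real
  assume p: "\<And>i. p i \<in> A" and rt: "r < t"
  show False if "\<And>i j. i < j \<Longrightarrow> p i (x j) \<le> r" "\<And>i j. i < j \<Longrightarrow> t \<le> p j (x i)"
    using relatively_weakly_compact_no_order_aux[where c = 1 and x = x and p = p, OF A p rt] that by simp
  have "- t < - r" using rt by simp
  then show False if "\<And>i j. i < j \<Longrightarrow> t \<le> p i (x j)" "\<And>i j. i < j \<Longrightarrow> p j (x i) \<le> r"
    using relatively_weakly_compact_no_order_aux[where c = "- 1" and x = x and p = p and r = "- t" and t = "- r", OF A p] that by simp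
qed

section \<open>Stability of the double limit condition under truncation and adjoining zero\<close>

definition clip :: "real \<Rightarrow> real"
  where "clip v = max 0 (min 1 v)"

text \<open>The hypotheses force \<open>0 \<le> r\<close> and \<open>t \<le> 1\<close>, and for
  thresholds in that range truncation changes neither comparison.\<close>

lemma clip_mono_bounds:
  assumes "clip v \<le> r" "t \<le> clip w" "r < t"
  shows "v \<le> r" "t \<le> w"
  using assms unfolding clip_def by linarith+

lemma no_order_clip:
  fixes A :: "('s \<Rightarrow> real) set"
  assumes A: "no_order (\<lambda>p s. p s) A UNIV"
  shows "no_order (\<lambda>p s. p s) ((\<lambda>p s. clip (p s)) ` A) UNIV"
proof (rule no_orderI)
  fix p :: "nat \<Rightarrow> 's \<Rightarrow> real" and x :: "nat \<Rightarrow> 's" and r t :: real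
  assume "\<And>i. p i \<in> (\<lambda>p s. clip (p s)) ` A" and rt: "r < t"
  then have "\<exists>q. q \<in> A \<and> p i = (\<lambda>s. clip (q s))" for i by blast
  then obtain q where q: "\<And>i. q i \<in> A" and pq: "\<And>i. p i = (\<lambda>s. clip (q i s))" by metis
  note nd = no_orderD[OF A, of q x, OF q UNIV_I rt]
  show False if "\<And>i j. i < j \<Longrightarrow> p i (x j) \<le> r" "\<And>i j. i < j \<Longrightarrow> t \<le> p j (x i)"
  proof -
    have "q i (x j) \<le> r \<and> t \<le> q j (x i)" if "i < j" for i j
      using clip_mono_bounds[of "q i (x j)" r t "q j (x i)"] \<open>i < j\<close> pq rt
        \<open>i < j \<Longrightarrow> p i (x j) \<le> r\<close> \<open>i < j \<Longrightarrow> t \<le> p j (x i)\<close> by simp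
    then show False using nd(1) by blast
  qed
  show False if "\<And>i j. i < j \<Longrightarrow> t \<le> p i (x j)" "\<And>i j. i < j \<Longrightarrow> p j (x i) \<le> r"
  proof -
    have "t \<le> q i (x j) \<and> q j (x i) \<le> r" if "i < j" for i j
      using clip_mono_bounds[of "q j (x i)" r t "q i (x j)"] \<open>i < j\<close> pq rt
        \<open>i < j \<Longrightarrow> t \<le> p i (x j)\<close> \<open>i < j \<Longrightarrow> p j (x i) \<le> r\<close> by simp
    then show False using nd(2) by blast
  qed
qed

text \<open>An index with both a predecessor and a successor takes values on both sides of the gap,
  so the zero function can occur only at index \<open>0\<close>, which is dropped.\<close>

lemma no_order_insert_zero:
  fixes A :: "('s \<Rightarrow> real) set"
  assumes A: "no_order (\<lambda>p s. p s) A UNIV"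
  shows "no_order (\<lambda>p s. p s) (insert 0 A) UNIV"
proof (rule no_orderI)
  fix p :: "nat \<Rightarrow> 's \<Rightarrow> real" and x :: "nat \<Rightarrow> 's" and r t :: real
  assume p: "\<And>i. p i \<in> insert 0 A" and rt: "r < t"
  show False if lo: "\<And>i j. i < j \<Longrightarrow> p i (x j) \<le> r" and hi: "\<And>i j. i < j \<Longrightarrow> t \<le> p j (x i)"
  proof -
    have "p (Suc i) \<noteq> 0" for i
      using lo[of "Suc i" "Suc (Suc i)"] hi[of 0 "Suc i"] rt by auto
    then have "p (Suc i) \<in> A" for i using p[of "Suc i"] by blast
    from no_orderD(1)[OF A, of "\<lambda>i. p (Suc i)" "\<lambda>i. x (Suc i)", OF this UNIV_I rt]
    show False using lo hi by blast
  qed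
  show False if hi: "\<And>i j. i < j \<Longrightarrow> t \<le> p i (x j)" and lo: "\<And>i j. i < j \<Longrightarrow> p j (x i) \<le> r"
  proof -
    have "p (Suc i) \<noteq> 0" for i
      using hi[of "Suc i" "Suc (Suc i)"] lo[of 0 "Suc i"] rt by auto
    then have "p (Suc i) \<in> A" for i using p[of "Suc i"] by blast
    from no_orderD(2)[OF A, of "\<lambda>i. p (Suc i)" "\<lambda>i. x (Suc i)", OF this UNIV_I rt]
    show False using lo hi by blast
  qed
qed

text \<open>The union over \<open>n\<close> is a countable substitute for the convex hull of a
  countable set. Iterating combinations of pairs makes countability immediate by induction.\<close>

primrec rational_hull :: "('s \<Rightarrow> real) set \<Rightarrow> nat \<Rightarrow> ('s \<Rightarrow> real) set" where
  "rational_hull A 0 = A"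
| "rational_hull A (Suc n) =
    (\<lambda>(u, v, q). q *\<^sub>R u + (1 - q) *\<^sub>R v) ` (rational_hull A n \<times> rational_hull A n \<times> (\<rat> \<inter> {0..1}))"

lemma countable_rational_hull: "countable A \<Longrightarrow> countable (rational_hull A n)"
  by (induction n) (auto intro!: countable_image countable_SIGMA countable_Int1 countable_rat)

lemma rational_hull_mono: "m \<le> n \<Longrightarrow> rational_hull A m \<subseteq> rational_hull A n"
proof (induction n rule: nat_induct)
  case (Suc n)
  have "u \<in> rational_hull A (Suc n)" if "u \<in> rational_hull A n" for u
    unfolding rational_hull.simps
    by (rule image_eqI[of _ _ "(u, u, 1)"]) (use that in auto)
  then show ?case using Suc le_Suc_eq by auto
qed simp

lemma rational_hull_dense:
  fixes A :: "('s \<Rightarrow> real) set"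
  assumes bd: "\<And>u s. u \<in> A \<Longrightarrow> \<bar>u s\<bar> \<le> M" and u: "u \<in> convex hull A" and \<delta>: "\<delta> > 0"
  shows "\<exists>w\<in>\<Union>(range (rational_hull A)). \<forall>s. \<bar>u s - w s\<bar> \<le> \<delta>"
proof -
  let ?D = "\<Union>(range (rational_hull A))"
  \<comment> \<open>The bound by \<open>M\<close> is carried along because replacing the weight
    \<open>a\<close> by a rational \<open>q\<close> costs
    \<open>\<bar>a - q\<bar> * \<bar>u s - v s\<bar>\<close>.\<close>
  define Q where "Q = {u. (\<forall>s. \<bar>u s\<bar> \<le> M) \<and> (\<forall>\<delta>>0. \<exists>w\<in>?D. \<forall>s. \<bar>u s - w s\<bar> \<le> \<delta>)}"
  have "convex hull A \<subseteq> Q"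
  proof (rule hull_minimal)
    show "A \<subseteq> Q"
    proof
      fix u assume "u \<in> A"
      moreover have "u \<in> ?D" using \<open>u \<in> A\<close> rational_hull.simps(1)[of A] by blast
      ultimately show "u \<in> Q" unfolding Q_def using bd by (auto intro!: bexI[of _ u])
    qed
    show "convex Q"
    proof (rule convexI)
      fix u v and a b :: real
      assume uv: "u \<in> Q" "v \<in> Q" and ab: "0 \<le> a" "0 \<le> b" "a + b = 1"
      have bu: "\<bar>u s\<bar> \<le> M" "\<bar>v s\<bar> \<le> M" for s using uv by (auto simp: Q_def)
      have b: "b = 1 - a" using ab by simp
      have bound: "\<bar>(a *\<^sub>R u + b *\<^sub>R v) s\<bar> \<le> M" for s
      proof -
        have "\<bar>a * u s + b * v s\<bar> \<le> M" using bu ab by (intro abs_convex_bound_le) auto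
        then show ?thesis by (simp add: scaleR_fun_def plus_fun_def)
      qed
      have "\<exists>w\<in>?D. \<forall>s. \<bar>(a *\<^sub>R u + b *\<^sub>R v) s - w s\<bar> \<le> \<delta>" if "\<delta> > 0" for \<delta>
      proof -
        have "M \<ge> 0" using bu(1)[of undefined] by linarith
        have "\<exists>w\<in>?D. \<forall>s. \<bar>u s - w s\<bar> \<le> \<delta> / 2"
          by (rule uv(1)[unfolded Q_def mem_Collect_eq, THEN conjunct2, rule_format, OF half_gt_zero[OF \<open>\<delta> > 0\<close>]])
        then obtain u' where u': "u' \<in> ?D" "\<And>s. \<bar>u s - u' s\<bar> \<le> \<delta> / 2" by blast
        have "\<exists>w\<in>?D. \<forall>s. \<bar>v s - w s\<bar> \<le> \<delta> / 2"
          by (rule uv(2)[unfolded Q_def mem_Collect_eq, THEN conjunct2, rule_format, OF half_gt_zero[OF \<open>\<delta> > 0\<close>]])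
        then obtain v' where v': "v' \<in> ?D" "\<And>s. \<bar>v s - v' s\<bar> \<le> \<delta> / 2" by blast
        \<comment> \<open>A rational just below \<open>a\<close> stays in the unit interval
          automatically; for \<open>a = 0\<close> there is no room below, and \<open>0\<close>
          itself is taken.\<close>
        obtain q where q: "q \<in> \<rat>" "0 \<le> q" "q \<le> 1" "\<bar>a - q\<bar> * (2 * M) \<le> \<delta> / 2"
        proof (cases "a = 0")
          case True
          then show ?thesis using that[of 0] \<open>\<delta> > 0\<close> by simp
        next
          case False
          define c where "c = max 0 (a - \<delta> / (4 * (M + 1)))"
          have "c < a" using False ab(1) \<open>\<delta> > 0\<close> \<open>M \<ge> 0\<close> by (auto simp: c_def)
          then obtain q where q: "q \<in> \<rat>" "c < q" "q < a" using Rats_dense_in_real by blast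
          have "\<bar>a - q\<bar> \<le> \<delta> / (4 * (M + 1))" using q unfolding c_def by linarith
          then have "\<bar>a - q\<bar> * (2 * M) \<le> \<delta> / (4 * (M + 1)) * (2 * M)"
            using \<open>M \<ge> 0\<close> by (intro mult_right_mono) auto
          also have "\<dots> \<le> \<delta> / 2" using \<open>M \<ge> 0\<close> \<open>\<delta> > 0\<close> by (simp add: field_simps)
          finally have "\<bar>a - q\<bar> * (2 * M) \<le> \<delta> / 2" .
          then show ?thesis using that[of q] q ab b by (auto simp: c_def)
        qed
        obtain m n where "u' \<in> rational_hull A m" "v' \<in> rational_hull A n" using u'(1) v'(1) by blast
        then have "u' \<in> rational_hull A (max m n)" "v' \<in> rational_hull A (max m n)"
          using rational_hull_mono[of m "max m n"] rational_hull_mono[of n "max m n"] by auto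
        then have "q *\<^sub>R u' + (1 - q) *\<^sub>R v' \<in> rational_hull A (Suc (max m n))"
          unfolding rational_hull.simps using q by (intro image_eqI[of _ _ "(u', v', q)"]) auto
        then have D: "q *\<^sub>R u' + (1 - q) *\<^sub>R v' \<in> ?D" by blast
        have "\<bar>(a *\<^sub>R u + b *\<^sub>R v) s - (q *\<^sub>R u' + (1 - q) *\<^sub>R v') s\<bar> \<le> \<delta>" for s
        proof -
          have "(a *\<^sub>R u + b *\<^sub>R v) s - (q *\<^sub>R u' + (1 - q) *\<^sub>R v') s =
              (a - q) * (u s - v s) + (q * (u s - u' s) + (1 - q) * (v s - v' s))"
            unfolding b by (simp add: scaleR_fun_def plus_fun_def algebra_simps)
          also have "\<bar>\<dots>\<bar> \<le> \<bar>a - q\<bar> * \<bar>u s - v s\<bar> + (q * \<bar>u s - u' s\<bar> + (1 - q) * \<bar>v s - v' s\<bar>)"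
            using q by (intro order_trans[OF abs_triangle_ineq] add_mono) (auto simp: abs_mult)
          also have "\<bar>a - q\<bar> * \<bar>u s - v s\<bar> \<le> \<bar>a - q\<bar> * (2 * M)"
            using bu[of s] by (intro mult_left_mono) auto
          also have "q * \<bar>u s - u' s\<bar> + (1 - q) * \<bar>v s - v' s\<bar> \<le> \<delta> / 2"
            using u'(2) v'(2) q by (intro convex_bound_le) auto
          finally show ?thesis using q(4) by linarith
        qed
        then show ?thesis using D by blast
      qed
      with bound show "a *\<^sub>R u + b *\<^sub>R v \<in> Q" unfolding Q_def by blast
    qed
  qed
  then show ?thesis using u \<delta> unfolding Q_def by blast
qed

text \<open>The closure is the pointwise one. By the theorem of Mazur type its elements are uniform
  limits of means of \<open>A\<close>, so for countable \<open>A\<close> it is norm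
  separable.\<close>

lemma no_order_closure_near_rational_hull:
  fixes A :: "('s \<Rightarrow> real) set"
  assumes no: "no_order (\<lambda>p s. p s) A UNIV" and bd: "\<And>u s. u \<in> A \<Longrightarrow> \<bar>u s\<bar> \<le> M"
    and f: "f \<in> closure A" and \<delta>: "\<delta> > 0"
  shows "\<exists>w\<in>\<Union>(range (rational_hull A)). \<forall>s. \<bar>f s - w s\<bar> \<le> \<delta>"
proof -
  define F where "F = inf (nhds f) (principal A)"
  have "F \<noteq> bot"
  proof
    assume "F = bot"
    then have "eventually (\<lambda>h. h \<notin> A) (nhds f)"
      unfolding F_def by (simp add: eventually_False[symmetric] eventually_inf_principal)
    then obtain U where "open U" "f \<in> U" "\<And>h. h \<in> U \<Longrightarrow> h \<notin> A" unfolding eventually_nhds by blast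
    then have "U \<inter> closure A = {}" using open_Int_closure_eq_empty[of U A] by blast
    then show False using \<open>f \<in> U\<close> f by blast
  qed
  moreover have "((\<lambda>h. h s) \<longlongrightarrow> f s) F" for s
    unfolding F_def by (rule tendsto_mono[OF inf_le1 nhds_pointwise])
  moreover have evA: "eventually (\<lambda>h. h \<in> A) F"
    unfolding F_def by (simp add: eventually_inf_principal)
  ultimately have "\<exists>y\<in>convex hull ((\<lambda>p. p) ` A). \<forall>s\<in>UNIV. \<bar>y s - f s\<bar> \<le> \<delta> / 2"
    using \<delta> bd by (intro no_order_Mazur[of _ A UNIV M F]) (auto intro: no)
  then obtain y where y: "y \<in> convex hull A" "\<And>s. \<bar>y s - f s\<bar> \<le> \<delta> / 2" by auto
  have "\<exists>w\<in>\<Union>(range (rational_hull A)). \<forall>s. \<bar>y s - w s\<bar> \<le> \<delta> / 2"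
    by (rule rational_hull_dense[where M = M]) (use bd y(1) \<delta> in auto)
  then obtain w where w: "w \<in> \<Union>(range (rational_hull A))" "\<forall>s. \<bar>y s - w s\<bar> \<le> \<delta> / 2" by blast
  have "\<bar>f s - w s\<bar> \<le> \<delta>" for s using y(2)[of s] spec[OF w(2), of s] by linarith
  then show ?thesis using w(1) by blast
qed

section \<open>Translations and norm continuity of orbit maps\<close>

definition translate :: "'a::group_add \<Rightarrow> ('a \<Rightarrow> real) \<Rightarrow> 'a \<Rightarrow> real"
  where "translate g \<phi> = (\<lambda>x. \<phi> (- g + x))"

lemma translate_add: "translate (g + h) \<phi> = translate g (translate h \<phi>)"
  by (simp only: translate_def minus_add add.assoc)

lemma translate_0 [simp]: "translate 0 \<phi> = \<phi>"
  by (simp add: translate_def)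

lemma translate_shift [simp]: "translate h \<phi> (h + x) = \<phi> x"
  by (simp add: translate_def)

lemma continuous_on_translate:
  fixes \<phi> :: "'a::topological_group_add \<Rightarrow> real"
  assumes "continuous_on UNIV \<phi>"
  shows "continuous_on UNIV (\<lambda>k. translate k \<phi>)"
proof (rule continuous_on_coordinatewise_then_product)
  fix x
  have "continuous_on UNIV (\<lambda>k. \<phi> (- k + x))"
    by (rule continuous_on_compose2[OF assms]) (auto intro!: continuous_intros)
  then show "continuous_on UNIV (\<lambda>k. translate k \<phi> x)" by (simp add: translate_def)
qed

text \<open>
  Baire's theorem on the pointwise closure of the orbit of \<open>\<phi>\<close> under the countable
  subsemigroup generated by the \<open>g n\<close>: this closure is norm separable, hence some
  nonempty pointwise open piece of it has small diameter, and by invariance the piece may be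
  assumed to contain \<open>\<phi>\<close>.
\<close>

lemma no_order_orbit_norm_continuous:
  fixes \<phi> :: "'a::topological_group_add \<Rightarrow> real"
  assumes cont: "continuous_on UNIV \<phi>" and bd: "\<And>x. \<bar>\<phi> x\<bar> \<le> M"
    and no: "no_order (\<lambda>p s. p s) (range (\<lambda>g. translate g \<phi>)) UNIV"
    and g: "g \<longlonglongrightarrow> 0" and \<epsilon>: "\<epsilon> > 0"
  shows "\<exists>n. \<forall>x. \<bar>translate (g n) \<phi> x - \<phi> x\<bar> \<le> \<epsilon>"
proof -
  \<comment> \<open>Words in the \<open>g n\<close>: there are countably many of them, and a letter
    can be appended on the right, which will produce \<open>H l + g n\<close>.\<close>
  define H where "H l = sum_list (map g l)" for l
  define A where "A = range (\<lambda>l. translate (H l) \<phi>)"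
  have "countable A" unfolding A_def by simp
  have Abd: "\<bar>u s\<bar> \<le> M" if "u \<in> A" for u s using that bd by (auto simp: A_def translate_def)
  have Ano: "no_order (\<lambda>p s. p s) A UNIV"
    by (rule no_order_subset[OF no]) (auto simp: A_def)
  let ?K = "closure A" and ?D = "\<Union>(range (rational_hull A))"
  have "compact {h :: 'a \<Rightarrow> real. \<forall>s. \<bar>h s\<bar> \<le> M}" by (rule compact_pointwise_bounded)
  have closedM: "closed {h :: 'a \<Rightarrow> real. \<forall>s. \<bar>h s - q s\<bar> \<le> c}" for q c
    by (intro closed_Collect_all closed_Collect_le continuous_intros continuous_on_product_coordinates)
  have "?K \<subseteq> {h. \<forall>s. \<bar>h s - 0\<bar> \<le> M}"
    by (rule closure_minimal[OF _ closedM]) (use Abd in auto)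
  then have "compact (?K \<inter> {h. \<forall>s. \<bar>h s\<bar> \<le> M})" "?K \<inter> {h. \<forall>s. \<bar>h s\<bar> \<le> M} = ?K"
    using compact_Int_closed[OF compact_pointwise_bounded[of "\<lambda>_. M"] closed_closure[of A]] by (auto simp: Int_commute)
  then have Kc: "compact ?K" by simp
  let ?X = "top_of_set ?K"
  have "compact_space ?X" using Kc by (simp add: compact_space_subtopology)
  moreover have "Hausdorff_space (euclidean :: ('a \<Rightarrow> real) topology)"
    unfolding euclidean_product_topology[symmetric] by (simp add: Hausdorff_space_product_topology)
  then have "Hausdorff_space ?X" by (rule Hausdorff_space_subtopology)
  ultimately have X: "locally_compact_space ?X \<and> regular_space ?X"
    by (simp add: compact_imp_locally_compact_space compact_Hausdorff_imp_regular_space)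
  \<comment> \<open>Closed pieces of diameter at most \<open>\<epsilon>\<close>; countably many of
    them cover the closure, so by Baire one has nonempty relative interior.\<close>
  define S where "S q = ?K \<inter> {f. \<forall>s. \<bar>f s - q s\<bar> \<le> \<epsilon> / 2}" for q
  have cover: "\<Union>(S ` ?D) = ?K"
  proof
    show "?K \<subseteq> \<Union>(S ` ?D)"
    proof
      fix f assume f: "f \<in> ?K"
      have "\<exists>w\<in>?D. \<forall>s. \<bar>f s - w s\<bar> \<le> \<epsilon> / 2"
        by (rule no_order_closure_near_rational_hull[where M = M]) (use Ano Abd f \<epsilon> in auto)
      then obtain w where w: "w \<in> ?D" "\<forall>s. \<bar>f s - w s\<bar> \<le> \<epsilon> / 2" by blast
      then have "f \<in> S w" using f unfolding S_def by blast
      then show "f \<in> \<Union>(S ` ?D)" using w(1) by blast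
    qed
  qed (auto simp: S_def)
  have "A \<noteq> {}" by (simp add: A_def)
  then have "?K \<noteq> {}" using closure_subset[of A] by auto
  have "\<exists>q\<in>?D. ?X interior_of S q \<noteq> {}"
  proof (rule ccontr)
    assume "\<not> ?thesis"
    then have empty: "?X interior_of T = {}" if "T \<in> S ` ?D" for T using that by auto
    have "closedin ?X T" if T: "T \<in> S ` ?D" for T
    proof -
      obtain q where "T = S q" using T by blast
      then show ?thesis
        using closedin_closed_Int[OF closedM[of q "\<epsilon> / 2"], of ?K] unfolding S_def by simp
    qed
    moreover have "countable (S ` ?D)"
      using countable_rational_hull[OF \<open>countable A\<close>] by (intro countable_image countable_UN) auto
    ultimately have "?X interior_of \<Union>(S ` ?D) = {}"
      using Baire_category_alt[of ?X "S ` ?D"] X empty by blast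
    then have "?X interior_of ?K = {}" unfolding cover .
    then show False using interior_of_topspace[of ?X] \<open>?K \<noteq> {}\<close> by simp
  qed
  then obtain q where "?X interior_of S q \<noteq> {}" by blast
  moreover have "openin ?X (?X interior_of S q)" by simp
  ultimately obtain U where U: "open U" "?X interior_of S q = ?K \<inter> U" "?K \<inter> U \<noteq> {}"
    unfolding openin_open by auto
  have small: "\<bar>f s - q s\<bar> \<le> \<epsilon> / 2" if "f \<in> A" "f \<in> U" for f s
  proof -
    have "f \<in> ?X interior_of S q" using that closure_subset[of A] unfolding U(2) by blast
    then have "f \<in> S q" using interior_of_subset[of ?X "S q"] by blast
    then show ?thesis by (simp add: S_def)
  qed
  \<comment> \<open>A nonempty open part of the closure contains a point of the orbit itself, where
    continuity of \<open>\<phi>\<close> can be used.\<close>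
  have "U \<inter> A \<noteq> {}" using open_Int_closure_eq_empty[OF U(1), of A] U(3) by (simp add: Int_commute)
  then obtain l where l: "translate (H l) \<phi> \<in> U" unfolding A_def by blast
  have "open ((\<lambda>k. translate k \<phi>) -` U)"
    by (rule open_vimage[OF U(1) continuous_on_translate[OF cont]])
  moreover have "(\<lambda>n. H l + g n) \<longlonglongrightarrow> H l + 0" by (intro tendsto_add tendsto_const g)
  ultimately have "eventually (\<lambda>n. H l + g n \<in> (\<lambda>k. translate k \<phi>) -` U) sequentially"
    using l by (intro topological_tendstoD) auto
  then obtain n where n: "translate (H l + g n) \<phi> \<in> U"
    unfolding eventually_sequentially by auto
  have "H (l @ [n]) = H l + g n" by (simp add: H_def)
  then have "translate (H l + g n) \<phi> \<in> A" unfolding A_def by (metis rangeI)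
  have "\<bar>translate (g n) \<phi> x - \<phi> x\<bar> \<le> \<epsilon>" for x
  proof -
    \<comment> \<open>Evaluating at \<open>H l + x\<close> cancels the common translation by
      \<open>H l\<close>, so closeness of the two orbit points in \<open>U\<close> becomes closeness
      of \<open>translate (g n) \<phi>\<close> to \<open>\<phi>\<close>.\<close>
    have "translate (H l + g n) \<phi> (H l + x) = translate (g n) \<phi> x" "translate (H l) \<phi> (H l + x) = \<phi> x"
      by (simp_all add: translate_add)
    moreover have "translate (H l) \<phi> \<in> A" by (simp add: A_def)
    ultimately have "\<bar>translate (g n) \<phi> x - q (H l + x)\<bar> \<le> \<epsilon> / 2" "\<bar>\<phi> x - q (H l + x)\<bar> \<le> \<epsilon> / 2"
      using small[OF \<open>translate (H l + g n) \<phi> \<in> A\<close> n, of "H l + x"] small[OF _ l, of "H l + x"] by auto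
    then show ?thesis by linarith
  qed
  then show ?thesis by blast
qed

section \<open>Hulls of orbits and tame functions\<close>

definition orbit_hull :: "('a::group_add \<Rightarrow> real) \<Rightarrow> ('a \<Rightarrow> real) set"
  where "orbit_hull \<psi> = convex hull (insert 0 (range (\<lambda>g. translate g \<psi>)))"

definition norm_continuous :: "('a::topological_group_add \<Rightarrow> real) \<Rightarrow> bool"
  where "norm_continuous \<psi> \<longleftrightarrow>
    (\<forall>\<epsilon>>0. eventually (\<lambda>g. \<forall>x. \<bar>translate g \<psi> x - \<psi> x\<bar> \<le> \<epsilon>) (nhds 0))"

text \<open>This is what the interpolation construction needs from \<open>\<psi>\<close>. The class
  is stable under sums and nonzero multiples, so averages of cut-offs can be formed without
  returning to weak topologies.\<close>

definition tame :: "('a::topological_group_add \<Rightarrow> real) \<Rightarrow> bool"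
  where "tame \<psi> \<longleftrightarrow> \<psi> \<in> linf \<and> norm_continuous \<psi> \<and> convexly_compact (orbit_hull \<psi>)"

lemma translate_plus: "translate g (\<phi> + \<psi>) = translate g \<phi> + translate g \<psi>"
  by (simp add: translate_def plus_fun_def)

lemma translate_minus: "translate g (\<phi> - \<psi>) = translate g \<phi> - translate g \<psi>"
  by (simp add: translate_def fun_diff_def)

lemma translate_scaleR: "translate g (c *\<^sub>R \<phi>) = c *\<^sub>R translate g \<phi>"
  by (simp add: translate_def scaleR_fun_def)

lemma translate_zero [simp]: "translate g 0 = 0"
  by (simp add: translate_def zero_fun_def)

lemma norm_continuous_add:
  assumes "norm_continuous \<phi>" "norm_continuous \<psi>"
  shows "norm_continuous (\<phi> + \<psi>)"
  unfolding norm_continuous_def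
proof (intro allI impI)
  fix \<epsilon> :: real assume "\<epsilon> > 0"
  then have "eventually (\<lambda>g. \<forall>x. \<bar>translate g \<phi> x - \<phi> x\<bar> \<le> \<epsilon> / 2) (nhds 0)"
    "eventually (\<lambda>g. \<forall>x. \<bar>translate g \<psi> x - \<psi> x\<bar> \<le> \<epsilon> / 2) (nhds 0)"
    using assms unfolding norm_continuous_def by (meson half_gt_zero)+
  then show "eventually (\<lambda>g. \<forall>x. \<bar>translate g (\<phi> + \<psi>) x - (\<phi> + \<psi>) x\<bar> \<le> \<epsilon>) (nhds 0)"
  proof eventually_elim
    case (elim g)
    show ?case
    proof
      fix x
      show "\<bar>translate g (\<phi> + \<psi>) x - (\<phi> + \<psi>) x\<bar> \<le> \<epsilon>"
        using spec[OF elim(1), of x] spec[OF elim(2), of x]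
        unfolding translate_plus plus_fun_apply by linarith
    qed
  qed
qed

lemma norm_continuous_scaleR:
  assumes "norm_continuous \<phi>"
  shows "norm_continuous (c *\<^sub>R \<phi>)"
  unfolding norm_continuous_def
proof (intro allI impI)
  fix \<epsilon> :: real assume "\<epsilon> > 0"
  then have "\<epsilon> / (\<bar>c\<bar> + 1) > 0" by (simp add: divide_pos_pos)
  then have "eventually (\<lambda>g. \<forall>x. \<bar>translate g \<phi> x - \<phi> x\<bar> \<le> \<epsilon> / (\<bar>c\<bar> + 1)) (nhds 0)"
    using assms unfolding norm_continuous_def by blast
  then show "eventually (\<lambda>g. \<forall>x. \<bar>translate g (c *\<^sub>R \<phi>) x - (c *\<^sub>R \<phi>) x\<bar> \<le> \<epsilon>) (nhds 0)"
  proof eventually_elim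
    case (elim g)
    show ?case
    proof
      fix x
      have "\<bar>translate g (c *\<^sub>R \<phi>) x - (c *\<^sub>R \<phi>) x\<bar> = \<bar>c\<bar> * \<bar>translate g \<phi> x - \<phi> x\<bar>"
        unfolding translate_scaleR scaleR_fun_apply real_scaleR_def by (simp add: abs_mult flip: right_diff_distrib)
      also have "\<dots> \<le> (\<bar>c\<bar> + 1) * (\<epsilon> / (\<bar>c\<bar> + 1))"
        using elim by (intro mult_mono) auto
      also have "\<dots> = \<epsilon>" by simp
      finally show "\<bar>translate g (c *\<^sub>R \<phi>) x - (c *\<^sub>R \<phi>) x\<bar> \<le> \<epsilon>" .
    qed
  qed
qed

text \<open>The orbit of a sum lies in the sum of the two hulls; this decouples the simultaneous
  translation of both functions.\<close>

lemma tame_add: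
  assumes "tame \<phi>" "tame \<psi>"
  shows "tame (\<phi> + \<psi>)"
proof -
  let ?S = "{a + b |a b. a \<in> orbit_hull \<phi> \<and> b \<in> orbit_hull \<psi>}"
  have in_hull: "translate g \<phi> \<in> orbit_hull \<phi>" "0 \<in> orbit_hull \<phi>" for g and \<phi> :: "'a \<Rightarrow> real"
    unfolding orbit_hull_def by (rule hull_inc; simp)+
  have "orbit_hull (\<phi> + \<psi>) \<subseteq> ?S"
    unfolding orbit_hull_def[of "\<phi> + \<psi>"]
  proof (rule hull_minimal)
    have "convex (\<Union>x\<in>orbit_hull \<phi>. \<Union>y\<in>orbit_hull \<psi>. {x + y})"
      by (intro convex_sums) (simp_all add: orbit_hull_def)
    moreover have "(\<Union>x\<in>orbit_hull \<phi>. \<Union>y\<in>orbit_hull \<psi>. {x + y}) = ?S" by blast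
    ultimately show "convex ?S" by simp
    have "0 + 0 \<in> ?S" using in_hull by blast
    then show "insert 0 (range (\<lambda>g. translate g (\<phi> + \<psi>))) \<subseteq> ?S"
      using in_hull by (auto simp: translate_plus)
  qed
  moreover have "convexly_compact ?S"
    by (rule convexly_compact_sum) (use assms in \<open>auto simp: tame_def orbit_hull_def\<close>)
  ultimately have "convexly_compact (orbit_hull (\<phi> + \<psi>))" by (rule convexly_compact_subset[rotated])
  then show ?thesis using assms by (simp add: tame_def linf_add norm_continuous_add)
qed

lemma tame_scaleR:
  assumes "tame \<phi>" "c \<noteq> 0"
  shows "tame (c *\<^sub>R \<phi>)"
proof -
  have "orbit_hull (c *\<^sub>R \<phi>) \<subseteq> (*\<^sub>R) c ` orbit_hull \<phi>"
    unfolding orbit_hull_def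
  proof (rule hull_minimal)
    show "convex ((*\<^sub>R) c ` (convex hull insert 0 (range (\<lambda>g. translate g \<phi>))))"
      by (intro convex_scaling convex_convex_hull)
    have "insert 0 (range (\<lambda>g. translate g (c *\<^sub>R \<phi>))) = (*\<^sub>R) c ` insert 0 (range (\<lambda>g. translate g \<phi>))"
      by (auto simp: translate_scaleR)
    also have "\<dots> \<subseteq> (*\<^sub>R) c ` (convex hull insert 0 (range (\<lambda>g. translate g \<phi>)))"
      by (intro image_mono hull_subset)
    finally show "insert 0 (range (\<lambda>g. translate g (c *\<^sub>R \<phi>))) \<subseteq>
        (*\<^sub>R) c ` (convex hull insert 0 (range (\<lambda>g. translate g \<phi>)))" .
  qed
  moreover have "convexly_compact ((*\<^sub>R) c ` orbit_hull \<phi>)"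
    using assms by (intro convexly_compact_scale) (auto simp: tame_def)
  ultimately have "convexly_compact (orbit_hull (c *\<^sub>R \<phi>))" by (rule convexly_compact_subset[rotated])
  then show ?thesis using assms by (simp add: tame_def linf_scaleR norm_continuous_scaleR)
qed

lemma tame_zero: "tame (0 :: 'a::topological_group_add \<Rightarrow> real)"
proof -
  have "orbit_hull (0 :: 'a \<Rightarrow> real) = {0}" by (simp add: orbit_hull_def)
  moreover have "convexly_compact {0 :: 'a \<Rightarrow> real}"
    unfolding convexly_compact_def
  proof (intro allI impI, elim conjE)
    fix \<C> :: "('a \<Rightarrow> real) set set" and \<delta> :: real
    assume base: "convex_base \<C>" and sub: "\<forall>C\<in>\<C>. C \<subseteq> {0}" and "\<delta> > 0"
    have "\<exists>y\<in>C. \<forall>s. \<bar>y s - 0\<bar> \<le> \<delta>" if "C \<in> \<C>" for C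
      using convex_baseD(3)[OF base that] sub that \<open>\<delta> > 0\<close> by (intro bexI[of _ 0]) auto
    then show "\<exists>f. \<forall>C\<in>\<C>. \<exists>y\<in>C. \<forall>s. \<bar>y s - f s\<bar> \<le> \<delta>" by (intro exI[of _ "\<lambda>_. 0"] ballI)
  qed
  ultimately show ?thesis
    unfolding tame_def linf_iff norm_continuous_def by auto
qed

section \<open>Slowly varying cut-off functions on a metrised group\<close>

locale compatible_group_metric =
  fixes d :: "'a::topological_group_add \<Rightarrow> 'a \<Rightarrow> real"
  assumes compatible: "compatible_metric d" and invariant: "left_invariant d"
begin

lemma metric: "Metric_space UNIV d"
  using compatible by (simp add: compatible_metric_def)

lemma triangle: "d x z \<le> d x y + d y z" and commute: "d x y = d y x" and d_self [simp]: "d x x = 0"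
  using Metric_space.triangle[OF metric] Metric_space.commute[OF metric]
    Metric_space.zero[OF metric] by auto

lemma d_left: "d (h + g) (h + f) = d g f"
  using invariant by (simp add: left_invariant_def)

lemma d_minus: "d (- g) 0 = d g 0"
  using d_left[of g "- g" 0] commute[of 0 g] by simp

text \<open>Left invariance rewrites \<open>d (- g + x) 0\<close> as \<open>d x g\<close>, after
  which this is the triangle inequality.\<close>

lemma d_shift: "\<bar>d (- g + x) 0 - d x 0\<bar> \<le> d g 0"
proof -
  have "d (- g + x) 0 = d x g" using d_left[of g "- g + x" 0] by (simp add: add.assoc[symmetric])
  then show ?thesis using triangle[of x g 0] triangle[of x 0 g] commute[of 0 g] by linarith
qed

lemma eventually_nhds_d: "eventually P (nhds x) \<longleftrightarrow> (\<exists>r>0. \<forall>y. d x y < r \<longrightarrow> P y)"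
proof -
  have op: "open S \<longleftrightarrow> (\<forall>x\<in>S. \<exists>r>0. Metric_space.mball UNIV d x r \<subseteq> S)" for S
    using Metric_space.openin_mtopology[OF metric, of S] compatible
    by (auto simp: compatible_metric_def)
  have ball: "Metric_space.mball UNIV d x r = {y. d x y < r}" for x r
    using Metric_space.in_mball[OF metric] by auto
  show ?thesis
  proof
    assume "eventually P (nhds x)"
    then obtain S where S: "open S" "x \<in> S" "\<forall>y\<in>S. P y" unfolding eventually_nhds by blast
    then obtain r where "r > 0" "{y. d x y < r} \<subseteq> S" using op ball by metis
    then show "\<exists>r>0. \<forall>y. d x y < r \<longrightarrow> P y" using S(3) by blast
  next
    assume "\<exists>r>0. \<forall>y. d x y < r \<longrightarrow> P y"
    then obtain r where r: "r > 0" "\<forall>y. d x y < r \<longrightarrow> P y" by blast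
    have "open {y. d x y < r}"
      using Metric_space.openin_mball[OF metric, of x r] compatible
      by (simp add: compatible_metric_def ball)
    then show "eventually P (nhds x)"
      unfolding eventually_nhds using r by (intro exI[of _ "{y. d x y < r}"]) auto
  qed
qed

text \<open>Metrisability reduces norm continuity to sequences: if it failed, some sequence
  converging to \<open>0\<close> would violate it at every index, whereas
  \<open>no_order_orbit_norm_continuous\<close> finds one good index in any such sequence.\<close>

lemma tame_clip:
  fixes \<phi> :: "'a \<Rightarrow> real"
  assumes cont: "continuous_on UNIV \<phi>" and wap: "weakly_almost_periodic \<phi>"
  shows "tame (\<lambda>x. clip (\<phi> x))"
proof -
  let ?c = "\<lambda>x. clip (\<phi> x)"
  have bd: "\<bar>?c x\<bar> \<le> 1" for x by (simp add: clip_def)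
  have "no_order (\<lambda>p s. p s) (range (\<lambda>g. translate g \<phi>)) UNIV"
    using wap relatively_weakly_compact_no_order
    unfolding weakly_almost_periodic_def translate_def by blast
  from no_order_clip[OF this]
  have no: "no_order (\<lambda>p s. p s) (range (\<lambda>g. translate g ?c)) UNIV"
    by (simp add: image_image translate_def)
  have "continuous_on UNIV clip" unfolding clip_def by (intro continuous_intros)
  then have contc: "continuous_on UNIV ?c"
    using cont by (rule continuous_on_compose2) auto
  have "convexly_compact (orbit_hull ?c)"
    unfolding orbit_hull_def
    by (rule no_order_imp_convexly_compact[OF no_order_insert_zero[OF no], of 1])
      (use bd in \<open>auto simp: translate_def\<close>)
  moreover have "norm_continuous ?c"
    unfolding norm_continuous_def
  proof (intro allI impI, rule ccontr)
    fix \<epsilon> :: real assume "\<epsilon> > 0"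
    let ?P = "\<lambda>g :: 'a. \<forall>x. \<bar>translate g ?c x - ?c x\<bar> \<le> \<epsilon>"
    assume "\<not> eventually ?P (nhds 0)"
    then have "\<exists>g. d 0 g < 1 / real (Suc n) \<and> \<not> ?P g" for n
      unfolding eventually_nhds_d by (meson of_nat_0_less_iff zero_less_Suc zero_less_divide_1_iff)
    then obtain g where g: "\<And>n. d 0 (g n) < 1 / real (Suc n)" "\<And>n. \<not> ?P (g n)" by metis
    have "g \<longlonglongrightarrow> 0"
    proof (rule topological_tendstoI)
      fix S :: "'a set" assume "open S" "0 \<in> S"
      then have "eventually (\<lambda>y. y \<in> S) (nhds 0)" by (rule eventually_nhds_in_open)
      then obtain r where r: "r > 0" "\<And>y. d 0 y < r \<Longrightarrow> y \<in> S" unfolding eventually_nhds_d by blast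
      obtain N where "1 / real (Suc N) < r" using r(1) nat_approx_posE by metis
      then have "d 0 (g n) < r" if "n \<ge> N" for n
        using g(1)[of n] that by (smt (verit) frac_le of_nat_0_less_iff of_nat_mono Suc_le_mono zero_less_Suc)
      then show "eventually (\<lambda>n. g n \<in> S) sequentially"
        unfolding eventually_sequentially using r(2) by blast
    qed
    then show False
      using no_order_orbit_norm_continuous[OF contc bd no _ \<open>\<epsilon> > 0\<close>] g(2) by blast
  qed
  moreover have "?c \<in> linf" unfolding linf_iff using bd by blast
  ultimately show ?thesis by (simp add: tame_def)
qed

text \<open>
  Each cut-off function equals one near the supports of its predecessors, so that at every point at
  most one summand moves under translation by elements of the ball of radius \<open>R\<close>.
\<close>

lemma slowly_varying_sum:
  assumes cutoff: "\<And>\<alpha>. \<alpha> > 0 \<Longrightarrow>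
      \<exists>\<phi> :: 'a \<Rightarrow> real. continuous_on UNIV \<phi> \<and> weakly_almost_periodic \<phi> \<and>
        Metric_space.mbounded UNIV d {g. \<phi> g \<noteq> 0} \<and> (\<forall>g. d g 0 \<le> \<alpha> \<longrightarrow> \<phi> g = 1)"
    and R: "R \<ge> 0"
  shows "\<exists>\<sigma> S. tame \<sigma> \<and> (\<forall>x. \<bar>\<sigma> x\<bar> \<le> real k) \<and> \<sigma> 0 = real k \<and> (\<forall>x. \<sigma> x \<noteq> 0 \<longrightarrow> d x 0 \<le> S) \<and>
    (\<forall>g x. d g 0 \<le> R \<longrightarrow> \<bar>translate g \<sigma> x - \<sigma> x\<bar> \<le> 1)"
proof (induction k)
  case 0
  show ?case
    by (rule exI[of _ "\<lambda>_. 0"], rule exI[of _ 0])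
      (simp add: tame_zero[unfolded zero_fun_def] translate_def)
next
  case (Suc k)
  then obtain \<sigma> S where \<sigma>: "tame \<sigma>" "\<And>x. \<bar>\<sigma> x\<bar> \<le> real k" "\<sigma> 0 = real k"
    "\<And>x. \<sigma> x \<noteq> 0 \<Longrightarrow> d x 0 \<le> S" "\<And>g x. d g 0 \<le> R \<Longrightarrow> \<bar>translate g \<sigma> x - \<sigma> x\<bar> \<le> 1" by blast
  \<comment> \<open>If one of \<open>x\<close> and \<open>- g + x\<close> lies in the support of
    \<open>\<sigma>\<close>, both lie within \<open>S + R\<close> of the unit;
    \<open>\<alpha>\<close> is at least that large, and positive whatever the sign of
    \<open>S\<close>.\<close>
  define \<alpha> where "\<alpha> = \<bar>S\<bar> + 2 * R + 1"
  have "\<alpha> > 0" using R by (simp add: \<alpha>_def)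
  from cutoff[OF this] obtain \<phi> where \<phi>: "continuous_on UNIV \<phi>" "weakly_almost_periodic \<phi>"
    "Metric_space.mbounded UNIV d {g. \<phi> g \<noteq> 0}" "\<And>g. d g 0 \<le> \<alpha> \<Longrightarrow> \<phi> g = 1" by blast
  obtain c b where cb: "{g. \<phi> g \<noteq> 0} \<subseteq> Metric_space.mcball UNIV d c b"
    using \<phi>(3) unfolding Metric_space.mbounded_def[OF metric] by blast
  have supp: "d x 0 \<le> b + d c 0" if "\<phi> x \<noteq> 0" for x
  proof -
    have "d c x \<le> b" using cb that Metric_space.in_mcball[OF metric, of x c b] by auto
    then show ?thesis using triangle[of x 0 c] commute[of x c] by linarith
  qed
  define \<theta> where "\<theta> = (\<lambda>x. clip (\<phi> x))"
  have \<theta>: "tame \<theta>" unfolding \<theta>_def by (rule tame_clip[OF \<phi>(1,2)])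
  have \<theta>1: "\<theta> x = 1" if "d x 0 \<le> \<alpha>" for x using \<phi>(4)[OF that] by (simp add: \<theta>_def clip_def)
  have \<theta>b: "0 \<le> \<theta> x" "\<theta> x \<le> 1" for x by (auto simp: \<theta>_def clip_def)
  have \<theta>s: "d x 0 \<le> b + d c 0" if "\<theta> x \<noteq> 0" for x
    using supp[of x] that by (cases "\<phi> x = 0") (auto simp: \<theta>_def clip_def)
  have "tame (\<sigma> + \<theta>)" by (rule tame_add[OF \<sigma>(1) \<theta>])
  moreover have "\<bar>(\<sigma> + \<theta>) x\<bar> \<le> real (Suc k)" for x
    using \<sigma>(2)[of x] \<theta>b[of x] unfolding plus_fun_def by auto
  moreover have "(\<sigma> + \<theta>) 0 = real (Suc k)"
    using \<sigma>(3) \<theta>1[of 0] \<open>\<alpha> > 0\<close> by (simp add: plus_fun_def)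
  moreover have "d x 0 \<le> max S (b + d c 0)" if "(\<sigma> + \<theta>) x \<noteq> 0" for x
  proof (cases "\<sigma> x = 0")
    case True
    then have "\<theta> x \<noteq> 0" using that by (simp add: plus_fun_def)
    then show ?thesis using \<theta>s[of x] by simp
  next
    case False
    then show ?thesis using \<sigma>(4)[of x] by simp
  qed
  moreover have "\<bar>translate g (\<sigma> + \<theta>) x - (\<sigma> + \<theta>) x\<bar> \<le> 1" if g: "d g 0 \<le> R" for g x
  proof (cases "\<sigma> (- g + x) = 0 \<and> \<sigma> x = 0")
    case True
    then have "translate g (\<sigma> + \<theta>) x - (\<sigma> + \<theta>) x = \<theta> (- g + x) - \<theta> x"
      by (simp add: translate_def plus_fun_def)
    then show ?thesis using \<theta>b[of x] \<theta>b[of "- g + x"] by linarith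
  next
    \<comment> \<open>One of the two points lies in the support of \<open>\<sigma>\<close>, so
      \<open>\<theta>\<close> equals \<open>1\<close> at both and cancels.\<close>
    case False
    then have "d (- g + x) 0 \<le> S \<or> d x 0 \<le> S" using \<sigma>(4) by blast
    then have "d (- g + x) 0 \<le> \<alpha>" "d x 0 \<le> \<alpha>"
      using d_shift[of g x] g R unfolding \<alpha>_def by linarith+
    then have "translate g (\<sigma> + \<theta>) x - (\<sigma> + \<theta>) x = translate g \<sigma> x - \<sigma> x"
      using \<theta>1 by (simp add: translate_def plus_fun_def)
    then show ?thesis using \<sigma>(5)[OF g, of x] by simp
  qed
  ultimately show ?case by blast
qed

lemma slowly_varying_cutoff:
  assumes cutoff: "\<And>\<alpha>. \<alpha> > 0 \<Longrightarrow>
      \<exists>\<phi> :: 'a \<Rightarrow> real. continuous_on UNIV \<phi> \<and> weakly_almost_periodic \<phi> \<and>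
        Metric_space.mbounded UNIV d {g. \<phi> g \<noteq> 0} \<and> (\<forall>g. d g 0 \<le> \<alpha> \<longrightarrow> \<phi> g = 1)"
    and R: "R \<ge> 0" and k: "k > 0"
  shows "\<exists>\<psi> S. tame \<psi> \<and> (\<forall>x. \<bar>\<psi> x\<bar> \<le> 1) \<and> \<psi> 0 = 1 \<and> (\<forall>x. \<psi> x \<noteq> 0 \<longrightarrow> d x 0 \<le> S) \<and>
    (\<forall>g x. d g 0 \<le> R \<longrightarrow> \<bar>translate g \<psi> x - \<psi> x\<bar> \<le> 1 / real k)"
proof -
  obtain \<sigma> S where \<sigma>: "tame \<sigma>" "\<And>x. \<bar>\<sigma> x\<bar> \<le> real k" "\<sigma> 0 = real k"
    "\<And>x. \<sigma> x \<noteq> 0 \<Longrightarrow> d x 0 \<le> S" "\<And>g x. d g 0 \<le> R \<Longrightarrow> \<bar>translate g \<sigma> x - \<sigma> x\<bar> \<le> 1"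
    using slowly_varying_sum[OF cutoff R, of k] by blast
  let ?\<psi> = "(1 / real k) *\<^sub>R \<sigma>"
  have "\<bar>translate g ?\<psi> x - ?\<psi> x\<bar> \<le> 1 / real k" if "d g 0 \<le> R" for g x
  proof -
    have "translate g ?\<psi> x - ?\<psi> x = (translate g \<sigma> x - \<sigma> x) / real k"
      unfolding translate_scaleR scaleR_fun_apply by (simp add: diff_divide_distrib)
    then show ?thesis using \<sigma>(5)[OF that, of x] k by (simp add: divide_right_mono)
  qed
  moreover have "\<bar>?\<psi> x\<bar> \<le> 1" for x
    using \<sigma>(2)[of x] k by (simp add: scaleR_fun_def)
  moreover have "tame ?\<psi>" using \<sigma>(1) k by (intro tame_scaleR) auto
  moreover have "?\<psi> 0 = 1" using \<sigma>(3) k by (simp add: scaleR_fun_def)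
  moreover have "d x 0 \<le> S" if "?\<psi> x \<noteq> 0" for x
    using \<sigma>(4)[of x] that by (auto simp: scaleR_fun_def)
  ultimately show ?thesis by blast
qed

end

section \<open>A reflexivity criterion\<close>

text \<open>The intrinsic counterpart of \<open>convexly_compact\<close>. A convex set
  \<open>B\<close> of small diameter replaces the centre, since such sets can be intersected when
  several seminorms or several scales are treated in turn.\<close>

definition convexly_refinable :: "'b::real_vector set \<Rightarrow> ('b \<Rightarrow> real) \<Rightarrow> bool"
  where "convexly_refinable V N \<longleftrightarrow>
    (\<forall>\<C> R \<delta>. convex_base \<C> \<and> (\<forall>C\<in>\<C>. C \<subseteq> {x\<in>V. N x \<le> R}) \<and> \<delta> > 0 \<longrightarrow>
      (\<exists>B. convex B \<and> (\<forall>C\<in>\<C>. C \<inter> B \<noteq> {}) \<and> (\<forall>y\<in>B \<inter> V. \<forall>z\<in>B \<inter> V. N (y - z) \<le> \<delta>)))"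

section \<open>Dual spaces and Goldstine's theorem\<close>

lemma dual_spaceD:
  assumes "f \<in> dual_space V N"
  shows "x \<in> V \<Longrightarrow> y \<in> V \<Longrightarrow> f (x + y) = f x + f y" "x \<in> V \<Longrightarrow> f (c *\<^sub>R x) = c * f x"
    "\<exists>K. \<forall>x\<in>V. \<bar>f x\<bar> \<le> K * N x" "x \<notin> V \<Longrightarrow> f x = 0"
  using assms unfolding dual_space_def linear_map_on_def by auto

lemma dual_space_add:
  assumes "f \<in> dual_space V N" "g \<in> dual_space V N"
  shows "f + g \<in> dual_space V N"
proof -
  obtain K L where K: "\<And>x. x \<in> V \<Longrightarrow> \<bar>f x\<bar> \<le> K * N x" and L: "\<And>x. x \<in> V \<Longrightarrow> \<bar>g x\<bar> \<le> L * N x"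
    using dual_spaceD(3)[OF assms(1)] dual_spaceD(3)[OF assms(2)] by blast
  have "\<bar>(f + g) x\<bar> \<le> (K + L) * N x" if "x \<in> V" for x
    using K[OF that] L[OF that] unfolding plus_fun_apply distrib_right by linarith
  then have "\<exists>K. \<forall>x\<in>V. \<bar>(f + g) x\<bar> \<le> K * N x" by blast
  then show ?thesis
    using dual_spaceD(1,2,4)[OF assms(1)] dual_spaceD(1,2,4)[OF assms(2)]
    unfolding dual_space_def linear_map_on_def by (simp add: algebra_simps)
qed

lemma dual_space_scaleR:
  assumes "f \<in> dual_space V N"
  shows "c *\<^sub>R f \<in> dual_space V N"
proof -
  obtain K where K: "\<And>x. x \<in> V \<Longrightarrow> \<bar>f x\<bar> \<le> K * N x" using dual_spaceD(3)[OF assms] by blast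
  have "\<bar>(c *\<^sub>R f) x\<bar> \<le> (\<bar>c\<bar> * K) * N x" if "x \<in> V" for x
    using K[OF that] by (simp add: scaleR_fun_apply abs_mult mult_left_mono mult.assoc)
  then have "\<exists>K. \<forall>x\<in>V. \<bar>(c *\<^sub>R f) x\<bar> \<le> K * N x" by blast
  then show ?thesis
    using dual_spaceD(1,2,4)[OF assms]
    unfolding dual_space_def linear_map_on_def by (simp add: scaleR_fun_apply algebra_simps)
qed

lemma dual_space_combination:
  assumes "finite F" "F \<subseteq> dual_space V N"
  shows "(\<lambda>y. \<Sum>f\<in>F. c f * f y) \<in> dual_space V N \<and>
    (\<forall>\<Phi>\<in>dual_space (dual_space V N) M. \<Phi> (\<lambda>y. \<Sum>f\<in>F. c f * f y) = (\<Sum>f\<in>F. c f * \<Phi> f))"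
  using assms
proof (induction F rule: finite_induct)
  case empty
  have "\<Phi> (0 *\<^sub>R (\<lambda>_. 0)) = 0 * \<Phi> (\<lambda>_. 0)" if "\<Phi> \<in> dual_space (dual_space V N) M" for \<Phi>
    by (rule dual_spaceD(2)[OF that zero_dual_space])
  then show ?case by (simp add: zero_dual_space scaleR_fun_def)
next
  case (insert f F)
  have eq: "(\<lambda>y. \<Sum>f\<in>insert f F. c f * f y) = c f *\<^sub>R f + (\<lambda>y. \<Sum>f\<in>F. c f * f y)"
    using insert.hyps by (simp add: fun_eq_iff scaleR_fun_apply)
  have f: "f \<in> dual_space V N" and F: "(\<lambda>y. \<Sum>f\<in>F. c f * f y) \<in> dual_space V N"
    using insert by auto
  have "\<Phi> (c f *\<^sub>R f + (\<lambda>y. \<Sum>f\<in>F. c f * f y)) = (\<Sum>f\<in>insert f F. c f * \<Phi> f)"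
    if "\<Phi> \<in> dual_space (dual_space V N) M" for \<Phi>
    using dual_spaceD(1)[OF that dual_space_scaleR[OF f] F] dual_spaceD(2)[OF that f]
      insert.IH insert.prems insert.hyps that by simp
  then show ?case unfolding eq using dual_space_add[OF dual_space_scaleR[OF f] F] by blast
qed

locale normed_subspace =
  fixes V :: "'b::real_vector set" and N :: "'b \<Rightarrow> real"
  assumes normed: "normed_space_on V N"
begin

lemma subspace: "subspace V"
  using normed by (simp add: normed_space_on_def)

lemma norm_nonneg: "x \<in> V \<Longrightarrow> 0 \<le> N x"
  and norm_zero_iff: "x \<in> V \<Longrightarrow> N x = 0 \<longleftrightarrow> x = 0"
  and norm_scaleR: "x \<in> V \<Longrightarrow> N (c *\<^sub>R x) = \<bar>c\<bar> * N x"
  and norm_triangle: "x \<in> V \<Longrightarrow> y \<in> V \<Longrightarrow> N (x + y) \<le> N x + N y"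
  using normed unfolding normed_space_on_def by blast+

lemma norm_uminus: "x \<in> V \<Longrightarrow> N (- x) = N x"
  using norm_scaleR[of x "- 1"] by simp

lemma norm_minus_commute: "x \<in> V \<Longrightarrow> y \<in> V \<Longrightarrow> N (x - y) = N (y - x)"
  using norm_uminus[of "x - y"] subspace by (simp add: subspace_diff)

lemma norm_triangle4: "x \<in> V \<Longrightarrow> y \<in> V \<Longrightarrow> z \<in> V \<Longrightarrow> N (x - z) \<le> N (x - y) + N (y - z)"
  using norm_triangle[of "x - y" "y - z"] subspace by (simp add: subspace_diff)

lemma norm_triangle_diff: "x \<in> V \<Longrightarrow> y \<in> V \<Longrightarrow> N (x - y) \<le> N x + N y"
  using norm_triangle[of x "- y"] norm_uminus[of y] subspace by (simp add: subspace_neg)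

lemma convex_norm_ball: "convex {x\<in>V. N x \<le> R}"
proof (rule convexI, rule CollectI, rule conjI)
  fix x y and a b :: real
  assume x: "x \<in> {x\<in>V. N x \<le> R}" and y: "y \<in> {x\<in>V. N x \<le> R}" and ab: "0 \<le> a" "0 \<le> b" "a + b = 1"
  show "a *\<^sub>R x + b *\<^sub>R y \<in> V" using x y subspace by (simp add: subspace_add subspace_scale)
  have "N (a *\<^sub>R x + b *\<^sub>R y) \<le> N (a *\<^sub>R x) + N (b *\<^sub>R y)"
    using x y subspace by (intro norm_triangle) (auto simp: subspace_scale)
  also have "\<dots> = a * N x + b * N y" using x y ab by (simp add: norm_scaleR)
  also have "\<dots> \<le> R" using x y ab by (intro convex_bound_le) auto
  finally show "N (a *\<^sub>R x + b *\<^sub>R y) \<le> R" .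
qed

lemma dual_diff:
  assumes "f \<in> dual_space V N" "x \<in> V" "y \<in> V"
  shows "f (x - y) = f x - f y"
  using dual_spaceD(1)[OF assms(1), of "x - y" y] assms subspace by (simp add: subspace_diff)

lemma dual_bound:
  assumes "f \<in> dual_space V N"
  obtains K where "K \<ge> 0" "\<And>x. x \<in> V \<Longrightarrow> \<bar>f x\<bar> \<le> K * N x"
proof -
  obtain K where K: "\<And>x. x \<in> V \<Longrightarrow> \<bar>f x\<bar> \<le> K * N x" using dual_spaceD(3)[OF assms] by blast
  have "\<bar>f x\<bar> \<le> \<bar>K\<bar> * N x" if "x \<in> V" for x
    using K[OF that] norm_nonneg[OF that] mult_right_mono[of K "\<bar>K\<bar>" "N x"] by linarith
  then show ?thesis using that[of "\<bar>K\<bar>"] by simp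
qed

lemma dual_norm_le:
  assumes "f \<in> dual_space V N" "\<And>x. x \<in> V \<Longrightarrow> N x \<le> 1 \<Longrightarrow> \<bar>f x\<bar> \<le> K"
  shows "0 \<le> dual_norm V N f" "dual_norm V N f \<le> K"
proof -
  have z: "0 \<in> {x\<in>V. N x \<le> 1}" using subspace_0[OF subspace] norm_zero_iff[of 0] by simp
  then show "dual_norm V N f \<le> K"
    unfolding dual_norm_def using assms(2) by (intro cSUP_least) auto
  have "bdd_above ((\<lambda>x. \<bar>f x\<bar>) ` {x\<in>V. N x \<le> 1})"
    using assms(2) by (intro bdd_aboveI[of _ K]) auto
  from cSUP_upper[OF z this] show "0 \<le> dual_norm V N f" unfolding dual_norm_def by simp
qed

text \<open>
  Goldstine's theorem without Hahn-Banach: at an almost minimiser \<open>x\<close> of the quadratic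
  deviation over a ball, the functional \<open>g\<close> given by the gradient almost attains its norm on the
  ball at \<open>x\<close>, while \<open>\<Phi> g\<close> exceeds \<open>g x\<close> by the deviation itself.
\<close>

lemma Goldstine:
  assumes \<Phi>: "\<Phi> \<in> dual_space (dual_space V N) (dual_norm V N)"
    and bd: "\<And>f. f \<in> dual_space V N \<Longrightarrow> \<bar>\<Phi> f\<bar> \<le> R * dual_norm V N f" and R: "R > 0"
    and F: "finite F" "F \<subseteq> dual_space V N" and \<epsilon>: "\<epsilon> > 0"
  shows "\<exists>x\<in>V. N x \<le> R \<and> (\<forall>f\<in>F. \<bar>f x - \<Phi> f\<bar> \<le> \<epsilon>)"
proof -
  let ?S = "{x\<in>V. N x \<le> R}"
  define e where "e x = (\<Sum>f\<in>F. (f x - \<Phi> f)\<^sup>2)" for x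
  have "\<forall>f\<in>F. \<exists>K\<ge>0. \<forall>x\<in>V. \<bar>f x\<bar> \<le> K * N x"
    using F(2) dual_bound by (metis subsetD)
  then obtain k where k: "\<And>f. f \<in> F \<Longrightarrow> k f \<ge> 0" "\<And>f x. f \<in> F \<Longrightarrow> x \<in> V \<Longrightarrow> \<bar>f x\<bar> \<le> k f * N x"
    by metis
  define L where "L = (\<Sum>f\<in>F. (k f * (2 * R))\<^sup>2)"
  have L0: "L \<ge> 0" unfolding L_def by (intro sum_nonneg) auto
  have L: "(\<Sum>f\<in>F. (f (y - x))\<^sup>2) \<le> L" if "x \<in> ?S" "y \<in> ?S" for x y
    unfolding L_def
  proof (rule sum_mono)
    fix f assume f: "f \<in> F"
    have V: "y - x \<in> V" using that subspace by (simp add: subspace_diff)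
    have "N (y - x) \<le> 2 * R" using norm_triangle_diff[of y x] that by simp
    then have "\<bar>f (y - x)\<bar> \<le> k f * (2 * R)"
      using k(2)[OF f V] mult_left_mono[OF _ k(1)[OF f], of "N (y - x)" "2 * R"] by linarith
    then show "(f (y - x))\<^sup>2 \<le> (k f * (2 * R))\<^sup>2" by (rule power2_le_iff_abs_le[THEN iffD2, rotated]) (use k(1)[OF f] R in auto)
  qed
  \<comment> \<open>The length of a step along a segment: at most \<open>1\<close> to stay in the
    ball, and small enough that the final error \<open>t * (1 + L) / 2\<close> is at most
    \<open>\<epsilon>\<^sup>2\<close>.\<close>
  define t where "t = min 1 (\<epsilon>\<^sup>2 / (1 + L))"
  have t: "t > 0" "t \<le> 1" "t \<le> \<epsilon>\<^sup>2 / (1 + L)"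
    using \<epsilon> L0 unfolding t_def by auto
  then have t3: "t * (1 + L) \<le> \<epsilon>\<^sup>2" using L0 by (simp add: pos_le_divide_eq)
  have S0: "0 \<in> ?S" using subspace_0[OF subspace] norm_zero_iff[of 0] R by simp
  have e0: "e x \<ge> 0" for x unfolding e_def by (intro sum_nonneg) auto
  define \<mu> where "\<mu> = Inf (e ` ?S)"
  have \<mu>: "\<mu> \<le> e y" if "y \<in> ?S" for y
    unfolding \<mu>_def using that e0 by (intro cINF_lower bdd_belowI[of _ 0]) auto
  \<comment> \<open>The slack \<open>t\<^sup>2\<close> is of the same order as the second order term
    of \<open>e\<close> along a step of length \<open>t\<close>.\<close>
  have "\<exists>x\<in>?S. e x < \<mu> + t\<^sup>2"
  proof (rule ccontr)
    assume "\<not> ?thesis"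
    then have "\<mu> + t\<^sup>2 \<le> Inf (e ` ?S)" using S0 by (intro cINF_greatest) (auto simp: not_less)
    then show False using t(1) unfolding \<mu>_def[symmetric] by simp
  qed
  then obtain x where x: "x \<in> ?S" "e x < \<mu> + t\<^sup>2" by blast
  \<comment> \<open>This is \<open>- 1/2\<close> times the gradient of the quadratic deviation
    \<open>e\<close> at \<open>x\<close>.\<close>
  define g where "g = (\<lambda>y. \<Sum>f\<in>F. (\<Phi> f - f x) * f y)"
  have g: "g \<in> dual_space V N" and \<Phi>g: "\<Phi> g = (\<Sum>f\<in>F. (\<Phi> f - f x) * \<Phi> f)"
    using dual_space_combination[OF F, of "\<lambda>f. \<Phi> f - f x" "dual_norm V N"] \<Phi> unfolding g_def by auto
  have "(\<Sum>f\<in>F. (\<Phi> f - f x) * \<Phi> f) = g x + e x"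
    unfolding g_def e_def sum.distrib[symmetric]
    by (rule sum.cong) (simp_all add: power2_eq_square algebra_simps)
  then have gap: "\<Phi> g = g x + e x" unfolding \<Phi>g .
  \<comment> \<open>Comparing \<open>e\<close> at \<open>x + t *\<^sub>R (y - x)\<close> with its
    infimum gives \<open>2 * t * g (y - x) \<le> t\<^sup>2 * (1 + L)\<close>, that is,
    \<open>g (y - x) \<le> \<tau>\<close>.\<close>
  define \<tau> where "\<tau> = t * (1 + L) / 2"
  have gy: "g y \<le> g x + \<tau>" if y: "y \<in> ?S" for y
  proof -
    have V: "y - x \<in> V" using x(1) y subspace by (simp add: subspace_diff)
    have "x + t *\<^sub>R (y - x) = (1 - t) *\<^sub>R x + t *\<^sub>R y" by (simp add: algebra_simps)
    also have "\<dots> \<in> ?S" by (rule convexD[OF convex_norm_ball x(1) y]) (use t in auto)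
    finally have z: "x + t *\<^sub>R (y - x) \<in> ?S" .
    have fz: "f (x + t *\<^sub>R (y - x)) = f x + t * f (y - x)" if "f \<in> F" for f
      using dual_spaceD(1,2)[of f V N] that F(2) x(1) V subspace by (auto simp: subspace_scale)
    have "e (x + t *\<^sub>R (y - x)) = (\<Sum>f\<in>F. (f x - \<Phi> f)\<^sup>2 - 2 * t * ((\<Phi> f - f x) * f (y - x)) + t\<^sup>2 * (f (y - x))\<^sup>2)"
      unfolding e_def
    proof (rule sum.cong[OF refl])
      fix f assume "f \<in> F"
      show "(f (x + t *\<^sub>R (y - x)) - \<Phi> f)\<^sup>2 =
          (f x - \<Phi> f)\<^sup>2 - 2 * t * ((\<Phi> f - f x) * f (y - x)) + t\<^sup>2 * (f (y - x))\<^sup>2"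
        unfolding fz[OF \<open>f \<in> F\<close>] by algebra
    qed
    also have "\<dots> = e x - 2 * t * g (y - x) + t\<^sup>2 * (\<Sum>f\<in>F. (f (y - x))\<^sup>2)"
      unfolding e_def g_def by (simp add: sum.distrib sum_subtractf sum_distrib_left)
    also have "\<dots> \<le> e x - 2 * t * g (y - x) + t\<^sup>2 * L"
      using L[OF x(1) y] by (simp add: mult_left_mono)
    finally have "2 * t * g (y - x) \<le> e x - \<mu> + t\<^sup>2 * L" using \<mu>[OF z] by linarith
    also have "\<dots> \<le> t\<^sup>2 * (1 + L)" using x(2) by (simp add: distrib_left)
    finally have "t * (2 * g (y - x)) \<le> t * (t * (1 + L))" by (simp add: power2_eq_square algebra_simps)
    then have "g (y - x) \<le> \<tau>" using t(1) unfolding \<tau>_def by (simp add: mult_le_cancel_left_pos)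
    then show ?thesis using dual_diff[OF g, of y x] x(1) y by simp
  qed
  have "\<bar>g y\<bar> \<le> (g x + \<tau>) / R" if y: "y \<in> V" "N y \<le> 1" for y
  proof -
    \<comment> \<open>Taking \<open>c = R\<close> and \<open>c = - R\<close> turns the one-sided
      bound on the ball of radius \<open>R\<close> into a bound for the dual norm, whence
      \<open>e x = \<Phi> g - g x \<le> \<tau>\<close>.\<close>
    have "c *\<^sub>R y \<in> ?S" if "\<bar>c\<bar> = R" for c
      using y that R subspace mult_left_mono[OF y(2), of R] by (simp add: norm_scaleR subspace_scale)
    from gy[OF this[of R]] gy[OF this[of "- R"]] R
    have "R * g y \<le> g x + \<tau>" "- (R * g y) \<le> g x + \<tau>"
      using dual_spaceD(2)[OF g y(1), of R] dual_spaceD(2)[OF g y(1), of "- R"] by auto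
    then have "R * \<bar>g y\<bar> \<le> g x + \<tau>" using R by (simp add: abs_if)
    then show ?thesis using R by (simp add: pos_le_divide_eq mult.commute)
  qed
  from dual_norm_le(2)[OF g this] have "R * dual_norm V N g \<le> g x + \<tau>"
    using R by (simp add: pos_le_divide_eq mult.commute)
  then have "e x \<le> \<tau>" using bd[OF g] gap by linarith
  also have "\<tau> \<le> \<epsilon>\<^sup>2" using t3 zero_le_power2[of \<epsilon>] unfolding \<tau>_def by linarith
  finally have ex: "e x \<le> \<epsilon>\<^sup>2" .
  have "\<bar>f x - \<Phi> f\<bar> \<le> \<epsilon>" if f: "f \<in> F" for f
  proof -
    have "(f x - \<Phi> f)\<^sup>2 \<le> e x" unfolding e_def by (rule member_le_sum[OF f]) (use F in auto)
    then have "(f x - \<Phi> f)\<^sup>2 \<le> \<epsilon>\<^sup>2" using ex by linarith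
    then show ?thesis using \<epsilon> by (simp add: abs_le_square_iff[symmetric])
  qed
  then show ?thesis using x(1) by blast
qed

end

text \<open>By Goldstine the approximate solutions \<open>x\<close> of finitely many equations
  \<open>f x = \<Phi> f\<close> form a convex base in a ball. Refinement yields nested sets
  \<open>B n\<close> of vanishing diameter meeting every member; points chosen in them converge to
  some \<open>l\<close>. As each \<open>B n\<close> meets the solutions for any given
  \<open>f\<close>, the same \<open>l\<close> represents \<open>\<Phi>\<close> at all
  functionals.\<close>

lemma convexly_refinable_reflexive:
  assumes banach: "banach_space_on V N" and dent: "convexly_refinable V N"
  shows "reflexive_on V N"
  unfolding reflexive_on_def
proof
  fix \<Phi> assume \<Phi>: "\<Phi> \<in> dual_space (dual_space V N) (dual_norm V N)"
  interpret normed_subspace V N using banach by unfold_locales (simp add: banach_space_on_def)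
  interpret M: Metric_space V "norm_dist V N" by (rule Metric_space_norm_dist[OF normed])
  obtain K where K: "\<And>f. f \<in> dual_space V N \<Longrightarrow> \<bar>\<Phi> f\<bar> \<le> K * dual_norm V N f"
    using dual_spaceD(3)[OF \<Phi>] by blast
  define R where "R = \<bar>K\<bar> + 1"
  have "R > 0" by (simp add: R_def)
  have bd: "\<bar>\<Phi> f\<bar> \<le> R * dual_norm V N f" if f: "f \<in> dual_space V N" for f
  proof -
    obtain k where k: "k \<ge> 0" "\<And>x. x \<in> V \<Longrightarrow> \<bar>f x\<bar> \<le> k * N x" using dual_bound[OF f] by blast
    have "\<bar>f x\<bar> \<le> k" if "x \<in> V" "N x \<le> 1" for x
      using k(2)[OF that(1)] mult_left_mono[OF that(2) k(1)] by simp
    from dual_norm_le(1)[OF f this] have "K * dual_norm V N f \<le> R * dual_norm V N f"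
      unfolding R_def by (intro mult_right_mono) auto
    then show ?thesis using K[OF f] by linarith
  qed
  define G where "G F \<epsilon> = {x\<in>V. N x \<le> R} \<inter> {x\<in>V. \<forall>f\<in>F. \<bar>f x - \<Phi> f\<bar> \<le> \<epsilon>}" for F \<epsilon>
  define \<C> where "\<C> = {G F \<epsilon> |F \<epsilon>. finite F \<and> F \<subseteq> dual_space V N \<and> \<epsilon> > 0}"
  have G_mono: "G F \<epsilon> \<subseteq> G F' \<epsilon>'" if "F' \<subseteq> F" "\<epsilon> \<le> \<epsilon>'" for F F' \<epsilon> \<epsilon>'
    using that unfolding G_def by force
  have ball: "G {} 1 \<in> \<C>"
    unfolding \<C>_def by (rule CollectI, rule exI[of _ "{}"], rule exI[of _ 1]) simp
  have base: "convex_base \<C>"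
    unfolding convex_base_def
  proof (intro conjI ballI)
    show "\<C> \<noteq> {}" using ball by blast
    fix C assume "C \<in> \<C>"
    then obtain F \<epsilon> where C: "C = G F \<epsilon>" "finite F" "F \<subseteq> dual_space V N" "\<epsilon> > 0" unfolding \<C>_def by blast
    have "convex {x\<in>V. \<forall>f\<in>F. \<bar>f x - \<Phi> f\<bar> \<le> \<epsilon>}"
    proof (rule convexI, rule CollectI, intro conjI ballI)
      fix x y and a b :: real
      assume x: "x \<in> {x\<in>V. \<forall>f\<in>F. \<bar>f x - \<Phi> f\<bar> \<le> \<epsilon>}" and y: "y \<in> {x\<in>V. \<forall>f\<in>F. \<bar>f x - \<Phi> f\<bar> \<le> \<epsilon>}"
        and ab: "0 \<le> a" "0 \<le> b" "a + b = 1"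
      show "a *\<^sub>R x + b *\<^sub>R y \<in> V" using x y subspace by (simp add: subspace_add subspace_scale)
      fix f assume f: "f \<in> F"
      have b: "b = 1 - a" using ab by simp
      have "f (a *\<^sub>R x + b *\<^sub>R y) = a * f x + b * f y"
        using dual_spaceD(1,2)[of f V N] f C(3) x y subspace by (auto simp: subspace_scale)
      then have "f (a *\<^sub>R x + b *\<^sub>R y) - \<Phi> f = a * (f x - \<Phi> f) + b * (f y - \<Phi> f)"
        unfolding b by (simp add: algebra_simps)
      also have "\<bar>\<dots>\<bar> \<le> \<epsilon>"
        using x y f ab by (intro abs_convex_bound_le) auto
      finally show "\<bar>f (a *\<^sub>R x + b *\<^sub>R y) - \<Phi> f\<bar> \<le> \<epsilon>" .
    qed
    then show "convex C" unfolding C(1) G_def by (intro convex_Int convex_norm_ball)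
    obtain x where "x \<in> V" "N x \<le> R" "\<forall>f\<in>F. \<bar>f x - \<Phi> f\<bar> \<le> \<epsilon>"
      using Goldstine[OF \<Phi> bd \<open>R > 0\<close> C(2,3,4)] by blast
    then have "x \<in> C" unfolding C(1) G_def by blast
    then show "C \<noteq> {}" by blast
    fix D assume "D \<in> \<C>"
    then obtain F' \<epsilon>' where D: "D = G F' \<epsilon>'" "finite F'" "F' \<subseteq> dual_space V N" "\<epsilon>' > 0" unfolding \<C>_def by blast
    have "G (F \<union> F') (min \<epsilon> \<epsilon>') \<in> \<C>"
      unfolding \<C>_def using C D by (intro CollectI exI[of _ "F \<union> F'"] exI[of _ "min \<epsilon> \<epsilon>'"]) auto
    moreover have "G (F \<union> F') (min \<epsilon> \<epsilon>') \<subseteq> C \<inter> D"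
      unfolding C(1) D(1) by (intro Int_greatest G_mono) auto
    ultimately show "\<exists>E\<in>\<C>. E \<subseteq> C \<inter> D" by blast
  qed
  define good where "good n B \<longleftrightarrow> convex B \<and> (\<forall>C\<in>\<C>. C \<inter> B \<noteq> {}) \<and>
    (\<forall>y\<in>B \<inter> V. \<forall>z\<in>B \<inter> V. N (y - z) \<le> 1 / real (Suc n))" for n B
  have refine: "\<exists>B'. good n B' \<and> B' \<subseteq> B" if B: "convex B" "\<And>C. C \<in> \<C> \<Longrightarrow> C \<inter> B \<noteq> {}" for B n
  proof -
    have "convex_base ((\<lambda>C. C \<inter> B) ` \<C>)" by (rule convex_base_Int[OF base B])
    moreover have "\<forall>C\<in>(\<lambda>C. C \<inter> B) ` \<C>. C \<subseteq> {x\<in>V. N x \<le> R}" unfolding \<C>_def G_def by auto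
    ultimately obtain B' where "convex B'" "\<forall>C\<in>(\<lambda>C. C \<inter> B) ` \<C>. C \<inter> B' \<noteq> {}"
      "\<forall>y\<in>B' \<inter> V. \<forall>z\<in>B' \<inter> V. N (y - z) \<le> 1 / real (Suc n)"
      using dent[unfolded convexly_refinable_def, rule_format, of "(\<lambda>C. C \<inter> B) ` \<C>" R "1 / real (Suc n)"] by auto
    then have "good n (B \<inter> B')" unfolding good_def using B(1)
      by (auto intro: convex_Int simp: Int_assoc)
    then show ?thesis by blast
  qed
  have "\<exists>B. \<forall>n. good n (B n) \<and> B (Suc n) \<subseteq> B n"
  proof (rule dependent_nat_choice)
    show "\<exists>B. good 0 B" using refine[of UNIV 0] convex_baseD(3)[OF base] by auto
    show "\<exists>B'. good (Suc n) B' \<and> B' \<subseteq> B" if "good n B" for B n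
      using that refine[of B "Suc n"] by (auto simp: good_def)
  qed
  then obtain B where B: "\<And>n. good n (B n)" "\<And>n. B (Suc n) \<subseteq> B n" by blast
  have Bmono: "B n \<subseteq> B m" if "m \<le> n" for m n
    using lift_Suc_antimono_le[of B, OF B(2) that] .
  have diam: "N (y - z) \<le> 1 / real (Suc n)" if "y \<in> B n" "z \<in> B n" "y \<in> V" "z \<in> V" for y z n
    using B(1)[of n] that unfolding good_def by blast
  have meet: "C \<inter> B n \<noteq> {}" if "C \<in> \<C>" for C n using B(1)[of n] that unfolding good_def by blast
  have "\<forall>n. \<exists>x. x \<in> G {} 1 \<inter> B n" using meet[OF ball] by blast
  then obtain x where x: "\<And>n. x n \<in> G {} 1 \<inter> B n" by metis
  have xV: "x n \<in> V" for n using x[of n] by (simp add: G_def)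
  have inv: "\<exists>n. 1 / real (Suc n) < \<epsilon>" if "\<epsilon> > 0" for \<epsilon> :: real
    using nat_approx_posE[OF that] by metis
  have "M.MCauchy x"
    unfolding M.MCauchy_def
  proof (intro conjI allI impI)
    show "range x \<subseteq> V" using xV by auto
    fix \<epsilon> :: real assume "\<epsilon> > 0"
    then obtain n where n: "1 / real (Suc n) < \<epsilon>" using inv by blast
    have "norm_dist V N (x i) (x j) < \<epsilon>" if "n \<le> i" "n \<le> j" for i j
    proof -
      have "x i \<in> B n" "x j \<in> B n" using x Bmono that by blast+
      then have "N (x i - x j) \<le> 1 / real (Suc n)" by (intro diam xV)
      then show ?thesis using n xV by (simp add: norm_dist_def)
    qed
    then show "\<exists>n. \<forall>i j. n \<le> i \<longrightarrow> n \<le> j \<longrightarrow> norm_dist V N (x i) (x j) < \<epsilon>" by blast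
  qed
  then obtain l where "limitin M.mtopology x l sequentially"
    using banach unfolding banach_space_on_def M.mcomplete_def by blast
  then have l: "l \<in> V" "\<And>\<epsilon>. \<epsilon> > 0 \<Longrightarrow> \<exists>n. \<forall>i\<ge>n. norm_dist V N (x i) l < \<epsilon>"
    unfolding M.limit_metric_sequentially by blast+
  have "\<Phi> f = f l" if f: "f \<in> dual_space V N" for f
  proof (rule ccontr)
    assume "\<Phi> f \<noteq> f l"
    define \<epsilon> where "\<epsilon> = \<bar>\<Phi> f - f l\<bar>"
    have "\<epsilon> > 0" using \<open>\<Phi> f \<noteq> f l\<close> by (simp add: \<epsilon>_def)
    obtain k where k: "k \<ge> 0" "\<And>x. x \<in> V \<Longrightarrow> \<bar>f x\<bar> \<le> k * N x" using dual_bound[OF f] by blast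
    \<comment> \<open>The point \<open>z\<close> below is within \<open>2 * \<eta>\<close> of
      \<open>l\<close>, so \<open>f z\<close> and \<open>f l\<close> differ by at most
      \<open>\<epsilon> / 2\<close>. With the error \<open>\<epsilon> / 4\<close> of
      \<open>z\<close> the total is less than \<open>\<epsilon>\<close>.\<close>
    define \<eta> where "\<eta> = \<epsilon> / (4 * (k + 1))"
    have \<eta>: "\<eta> > 0" "k * \<eta> \<le> \<epsilon> / 4" using \<open>\<epsilon> > 0\<close> k(1) by (auto simp: \<eta>_def field_simps)
    obtain n1 where n1: "1 / real (Suc n1) < \<eta>" using inv[OF \<eta>(1)] by blast
    obtain n2 where n2: "\<And>i. i \<ge> n2 \<Longrightarrow> norm_dist V N (x i) l < \<eta>" using l(2)[OF \<eta>(1)] by blast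
    let ?n = "max n1 n2"
    have "G {f} (\<epsilon> / 4) \<in> \<C>" unfolding \<C>_def using f \<open>\<epsilon> > 0\<close> by (intro CollectI exI[of _ "{f}"] exI[of _ "\<epsilon> / 4"]) auto
    then obtain z where z: "z \<in> G {f} (\<epsilon> / 4)" "z \<in> B ?n" using meet by blast
    then have zV: "z \<in> V" and fz: "\<bar>f z - \<Phi> f\<bar> \<le> \<epsilon> / 4" by (auto simp: G_def)
    have "x ?n \<in> B n1" "z \<in> B n1" using x[of ?n] z(2) Bmono[of n1 ?n] by auto
    then have "N (z - x ?n) \<le> \<eta>" using diam[of z n1 "x ?n"] zV xV n1 by fastforce
    moreover have "N (x ?n - l) \<le> \<eta>" using n2[of ?n] xV l(1) by (simp add: norm_dist_def)
    ultimately have "N (z - l) \<le> 2 * \<eta>" using norm_triangle4[OF zV xV l(1), of ?n] by linarith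
    then have "k * N (z - l) \<le> k * (2 * \<eta>)" by (rule mult_left_mono[OF _ k(1)])
    moreover have "\<bar>f z - f l\<bar> \<le> k * N (z - l)"
      using k(2)[of "z - l"] dual_diff[OF f zV l(1)] zV l(1) subspace by (simp add: subspace_diff)
    ultimately have "\<bar>f z - f l\<bar> \<le> \<epsilon> / 2" using \<eta>(2) by linarith
    then have "\<bar>\<Phi> f - f l\<bar> \<le> \<epsilon> * (3/4)" using fz by linarith
    then show False using \<open>\<epsilon> > 0\<close> by (simp add: \<epsilon>_def)
  qed
  then show "\<exists>x\<in>V. \<forall>f\<in>dual_space V N. \<Phi> f = f x" using l(1) by blast
qed

section \<open>Square summable sequences of seminorms\<close>

text \<open>A single index is used because it will enumerate pairs of a coordinate and a scale:
  \<open>total\<close> is then at once the interpolation norm, a square sum over scales, and the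
  norm of the l2-sum over coordinates.\<close>

locale seminorm_family =
  fixes Y :: "'b::real_vector set" and q :: "nat \<Rightarrow> 'b \<Rightarrow> real"
  assumes subspace_Y: "subspace Y"
    and q_nonneg: "x \<in> Y \<Longrightarrow> 0 \<le> q k x"
    and q_triangle: "x \<in> Y \<Longrightarrow> y \<in> Y \<Longrightarrow> q k (x + y) \<le> q k x + q k y"
    and q_scaleR: "x \<in> Y \<Longrightarrow> q k (c *\<^sub>R x) = \<bar>c\<bar> * q k x"
    and q_separating: "x \<in> Y \<Longrightarrow> (\<And>k. q k x = 0) \<Longrightarrow> x = 0"
    and q_complete: "(\<And>i. X i \<in> Y) \<Longrightarrow>
      (\<And>k \<epsilon>. \<epsilon> > 0 \<Longrightarrow> \<exists>n. \<forall>i\<ge>n. \<forall>j\<ge>n. q k (X i - X j) < \<epsilon>) \<Longrightarrow>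
      \<exists>x\<in>Y. \<forall>k. (\<lambda>i. q k (X i - x)) \<longlonglongrightarrow> 0"
begin

definition partial :: "'b \<Rightarrow> nat \<Rightarrow> real"
  where "partial x n = L2_set (\<lambda>k. q k x) {..<n}"

definition carrier :: "'b set"
  where "carrier = {x\<in>Y. summable (\<lambda>k. (q k x)\<^sup>2)}"

definition total :: "'b \<Rightarrow> real"
  where "total x = sqrt (\<Sum>k. (q k x)\<^sup>2)"

lemma carrier_Y: "x \<in> carrier \<Longrightarrow> x \<in> Y"
  by (simp add: carrier_def)

lemma Y_diff: "x \<in> Y \<Longrightarrow> y \<in> Y \<Longrightarrow> x - y \<in> Y"
  using subspace_Y by (rule subspace_diff)

lemma q_diff_le: "x \<in> Y \<Longrightarrow> y \<in> Y \<Longrightarrow> q k (x - y) \<le> q k x + q k y"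
  using q_triangle[of x "- y" k] q_scaleR[of y k "- 1"] subspace_neg[OF subspace_Y, of y] by simp

lemma q_uminus: "x \<in> Y \<Longrightarrow> q k (- x) = q k x"
  using q_scaleR[of x k "- 1"] by simp

lemma q_diff_ge: "x \<in> Y \<Longrightarrow> y \<in> Y \<Longrightarrow> \<bar>q k x - q k y\<bar> \<le> q k (x - y)"
  using q_triangle[of "x - y" y k] q_triangle[of "y - x" x k] q_uminus[of "x - y" k]
    Y_diff[of x y] Y_diff[of y x] by simp

lemma partial_le_total: "x \<in> carrier \<Longrightarrow> partial x n \<le> total x"
  unfolding partial_def total_def L2_set_def carrier_def
  by (intro real_sqrt_le_mono sum_le_suminf) auto

lemma total_nonneg: "x \<in> carrier \<Longrightarrow> 0 \<le> total x"
  unfolding total_def carrier_def by (auto intro!: suminf_nonneg)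

lemma total_power2: "x \<in> carrier \<Longrightarrow> (total x)\<^sup>2 = (\<Sum>k. (q k x)\<^sup>2)"
  unfolding total_def carrier_def by (auto intro!: suminf_nonneg)

lemma q_le_total:
  assumes "x \<in> carrier" shows "q k x \<le> total x"
proof -
  have "q k x \<le> partial x (Suc k)"
    unfolding partial_def by (rule member_le_L2_set) auto
  then show ?thesis using partial_le_total[OF assms, of "Suc k"] by linarith
qed

lemma carrierI:
  assumes x: "x \<in> Y" and le: "\<And>n. partial x n \<le> C"
  shows "x \<in> carrier" "total x \<le> C"
proof -
  have C: "0 \<le> C" using le[of 0] by (simp add: partial_def)
  have *: "(\<Sum>k<n. (q k x)\<^sup>2) \<le> C\<^sup>2" for n
  proof -
    have "0 \<le> partial x n" by (simp add: partial_def L2_set_nonneg)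
    then have "(partial x n)\<^sup>2 \<le> C\<^sup>2" using le[of n] by (rule power_mono[rotated])
    then show ?thesis unfolding partial_def L2_set_def by (simp add: sum_nonneg)
  qed
  have s: "summable (\<lambda>k. (q k x)\<^sup>2)"
    by (rule summableI_nonneg_bounded[OF _ *]) simp
  then show "x \<in> carrier" using x by (simp add: carrier_def)
  have "(\<Sum>k. (q k x)\<^sup>2) \<le> C\<^sup>2" by (rule suminf_le_const[OF s *])
  then show "total x \<le> C" unfolding total_def using C by (rule real_le_lsqrt[rotated])
qed

lemma partial_triangle:
  assumes "x \<in> Y" "y \<in> Y"
  shows "partial (x + y) n \<le> partial x n + partial y n"
proof -
  have "partial (x + y) n \<le> L2_set (\<lambda>k. q k x + q k y) {..<n}"
    unfolding partial_def using assms subspace_Y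
    by (intro L2_set_mono q_triangle q_nonneg) (auto simp: subspace_add)
  also have "\<dots> \<le> partial x n + partial y n"
    unfolding partial_def by (rule L2_set_triangle_ineq)
  finally show ?thesis .
qed

lemma carrier_add:
  assumes "x \<in> carrier" "y \<in> carrier"
  shows "x + y \<in> carrier" "total (x + y) \<le> total x + total y"
proof -
  have "partial (x + y) n \<le> total x + total y" for n
    using partial_triangle[of x y n] partial_le_total[OF assms(1), of n] partial_le_total[OF assms(2), of n]
      assms carrier_Y by fastforce
  moreover have "x + y \<in> Y" using assms carrier_Y subspace_Y by (blast intro: subspace_add)
  ultimately show "x + y \<in> carrier" "total (x + y) \<le> total x + total y" by (rule carrierI[rotated])+
qed

lemma carrier_scaleR:
  assumes "x \<in> carrier"
  shows "c *\<^sub>R x \<in> carrier" "total (c *\<^sub>R x) = \<bar>c\<bar> * total x"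
proof -
  have eq: "(q k (c *\<^sub>R x))\<^sup>2 = c\<^sup>2 * (q k x)\<^sup>2" for k
    using assms carrier_Y by (simp add: q_scaleR power_mult_distrib)
  have s: "summable (\<lambda>k. (q k x)\<^sup>2)" using assms by (simp add: carrier_def)
  show "c *\<^sub>R x \<in> carrier"
    using assms subspace_Y s by (simp add: carrier_def subspace_scale eq[unfolded carrier_def] summable_mult)
  show "total (c *\<^sub>R x) = \<bar>c\<bar> * total x"
    unfolding total_def eq using suminf_mult[OF s, of "c\<^sup>2"] by (simp add: real_sqrt_mult)
qed

lemma normed_space_carrier: "normed_space_on carrier total"
  unfolding normed_space_on_def
proof (intro conjI ballI allI)
  have q0: "q k 0 = 0" for k using q_scaleR[OF subspace_0[OF subspace_Y], of k 0] by simp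
  have zero: "0 \<in> carrier" "total 0 = 0"
    using subspace_0[OF subspace_Y] by (simp_all add: carrier_def total_def q0)
  show "subspace carrier"
    unfolding subspace_def using zero carrier_add(1) carrier_scaleR(1) by blast
  fix x assume x: "x \<in> carrier"
  show "0 \<le> total x" by (rule total_nonneg[OF x])
  show "total x = 0 \<longleftrightarrow> x = 0"
  proof
    assume "total x = 0"
    then have "q k x = 0" for k
      using q_le_total[OF x, of k] q_nonneg[OF carrier_Y[OF x], of k] by simp
    then show "x = 0" by (rule q_separating[OF carrier_Y[OF x]])
  qed (simp add: zero)
  show "total (c *\<^sub>R x) = \<bar>c\<bar> * total x" for c by (rule carrier_scaleR(2)[OF x])
  show "total (x + y) \<le> total x + total y" if "y \<in> carrier" for y by (rule carrier_add(2)[OF x that])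
qed

sublocale normed_subspace carrier total
  by unfold_locales (rule normed_space_carrier)

lemma banach_space_carrier: "banach_space_on carrier total"
proof -
  interpret M: Metric_space carrier "norm_dist carrier total" by (rule Metric_space_norm_dist[OF normed])
  have "M.mcomplete"
    unfolding M.mcomplete_def
  proof (intro allI impI)
    fix X assume "M.MCauchy X"
    then have X: "\<And>i. X i \<in> carrier" and cauchy: "\<And>\<epsilon>. \<epsilon> > 0 \<Longrightarrow> \<exists>n. \<forall>i j. n \<le> i \<longrightarrow> n \<le> j \<longrightarrow> norm_dist carrier total (X i) (X j) < \<epsilon>"
      unfolding M.MCauchy_def by blast+
    have diff: "X i - X j \<in> carrier" for i j using X subspace by (simp add: subspace_diff)
    have cauchy': "\<exists>n. \<forall>i\<ge>n. \<forall>j\<ge>n. total (X i - X j) < \<epsilon>" if "\<epsilon> > 0" for \<epsilon>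
      using cauchy[OF that] X unfolding norm_dist_def by auto
    have XY: "X i \<in> Y" for i using X carrier_Y by blast
    have "\<exists>x\<in>Y. \<forall>k. (\<lambda>i. q k (X i - x)) \<longlonglongrightarrow> 0"
    proof (rule q_complete[OF XY])
      fix k and \<epsilon> :: real assume "\<epsilon> > 0"
      then obtain n where "\<forall>i\<ge>n. \<forall>j\<ge>n. total (X i - X j) < \<epsilon>" using cauchy' by blast
      then show "\<exists>n. \<forall>i\<ge>n. \<forall>j\<ge>n. q k (X i - X j) < \<epsilon>"
        using q_le_total[OF diff] by (meson le_less_trans)
    qed
    then obtain x where x: "x \<in> Y" "\<And>k. (\<lambda>i. q k (X i - x)) \<longlonglongrightarrow> 0" by blast
    \<comment> \<open>Only finitely many seminorms enter \<open>partial\<close>, so the Cauchy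
      estimate passes to the limit there; \<open>carrierI\<close> then recovers both membership and
      the bound for \<open>total\<close>.\<close>
    have close: "X i - x \<in> carrier \<and> total (X i - x) \<le> \<epsilon>"
      if n: "\<And>i j. n \<le> i \<Longrightarrow> n \<le> j \<Longrightarrow> total (X i - X j) < \<epsilon>" and i: "n \<le> i" for n i \<epsilon>
    proof -
      have "partial (X i - x) m \<le> \<epsilon>" for m
      proof (rule LIMSEQ_le_const2)
        have "(\<lambda>j. q k (X i - X j)) \<longlonglongrightarrow> q k (X i - x)" for k
        proof (rule Lim_transform2)
          show "(\<lambda>j. q k (X i - x)) \<longlonglongrightarrow> q k (X i - x)" by simp
          have "norm (q k (X i - x) - q k (X i - X j)) \<le> q k (X j - x)" for j
            using q_diff_ge[of "X i - x" "X i - X j" k] Y_diff[OF XY x(1), of i] carrier_Y[OF diff] by simp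
          then show "(\<lambda>j. q k (X i - x) - q k (X i - X j)) \<longlonglongrightarrow> 0"
            by (intro Lim_null_comparison[OF _ x(2)] always_eventually allI)
        qed
        then show "(\<lambda>j. partial (X i - X j) m) \<longlonglongrightarrow> partial (X i - x) m"
          unfolding partial_def L2_set_def by (intro tendsto_intros)
        have "partial (X i - X j) m \<le> \<epsilon>" if "j \<ge> n" for j
          using partial_le_total[OF diff, of i j m] n[OF i that] by linarith
        then show "\<exists>N. \<forall>j\<ge>N. partial (X i - X j) m \<le> \<epsilon>" by blast
      qed
      then show ?thesis using carrierI[OF Y_diff[OF XY x(1)]] by blast
    qed
    obtain n where n: "\<And>i j. n \<le> i \<Longrightarrow> n \<le> j \<Longrightarrow> total (X i - X j) < 1" using cauchy'[of 1] by auto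
    have "X n - (X n - x) \<in> carrier"
      by (rule subspace_diff[OF subspace X]) (use close[OF n, of n] in blast)
    then have xc: "x \<in> carrier" by simp
    have "\<exists>n. \<forall>i\<ge>n. X i \<in> carrier \<and> norm_dist carrier total (X i) x < \<epsilon>" if "\<epsilon> > 0" for \<epsilon>
    proof -
      obtain n where n: "\<And>i j. n \<le> i \<Longrightarrow> n \<le> j \<Longrightarrow> total (X i - X j) < \<epsilon> / 2" using cauchy'[of "\<epsilon> / 2"] \<open>\<epsilon> > 0\<close> by auto
      have "total (X i - x) < \<epsilon>" if "i \<ge> n" for i using close[OF n, of i] that \<open>\<epsilon> > 0\<close> by fastforce
      then show ?thesis using X xc by (auto simp: norm_dist_def)
    qed
    then have "limitin M.mtopology X x sequentially"
      unfolding M.limit_metric_sequentially using xc by blast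
    then show "\<exists>x. limitin M.mtopology X x sequentially" ..
  qed
  then show ?thesis using normed by (simp add: banach_space_on_def)
qed

end

lemma L2_set_tail:
  fixes f :: "nat \<Rightarrow> real"
  assumes "summable (\<lambda>k. (f k)\<^sup>2)" "\<tau> > 0"
  obtains K where "\<And>n. L2_set f {K..<n} \<le> \<tau>"
proof -
  have "0 < \<tau>\<^sup>2" using assms(2) by simp
  from assms(1)[unfolded summable_Cauchy, rule_format, OF this]
  obtain K where K: "\<And>n. norm (\<Sum>k=K..<n. (f k)\<^sup>2) < \<tau>\<^sup>2" by blast
  have "L2_set f {K..<n} \<le> \<tau>" for n
    unfolding L2_set_def using K[of n] assms(2) by (intro real_le_lsqrt) (auto simp: sum_nonneg)
  then show ?thesis using that by blast
qed

lemma L2_set_diff_le: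
  fixes f g :: "nat \<Rightarrow> real"
  shows "L2_set f A \<le> L2_set g A + L2_set (\<lambda>k. f k - g k) A"
  using L2_set_triangle_ineq[of g "\<lambda>k. f k - g k" A] by simp

text \<open>The hypothesis treats one seminorm at a time. Since \<open>total\<close> involves
  infinitely many, the gap lies in the tails, and square summability closes it.\<close>

locale refinable_seminorm_family = seminorm_family +
  assumes refinable: "convex_base \<C> \<Longrightarrow> (\<And>C. C \<in> \<C> \<Longrightarrow> C \<subseteq> {x\<in>carrier. total x \<le> R}) \<Longrightarrow> \<delta> > 0 \<Longrightarrow>
    \<exists>B. convex B \<and> (\<forall>C\<in>\<C>. C \<inter> B \<noteq> {}) \<and> (\<forall>y\<in>B \<inter> Y. \<forall>z\<in>B \<inter> Y. q k (y - z) \<le> \<delta>)"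
begin

lemma refinable_finite:
  assumes base: "convex_base \<C>" and sub: "\<And>C. C \<in> \<C> \<Longrightarrow> C \<subseteq> {x\<in>carrier. total x \<le> R}" and \<delta>: "\<delta> > 0"
  shows "\<exists>B. convex B \<and> (\<forall>C\<in>\<C>. C \<inter> B \<noteq> {}) \<and> (\<forall>k<K. \<forall>y\<in>B \<inter> Y. \<forall>z\<in>B \<inter> Y. q k (y - z) \<le> \<delta>)"
proof (induction K)
  case 0
  show ?case using convex_baseD(3)[OF base] by (intro exI[of _ UNIV]) auto
next
  case (Suc K)
  then obtain B where IH: "convex B \<and> (\<forall>C\<in>\<C>. C \<inter> B \<noteq> {}) \<and>
    (\<forall>k<K. \<forall>y\<in>B \<inter> Y. \<forall>z\<in>B \<inter> Y. q k (y - z) \<le> \<delta>)" by (rule exE)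
  then have B: "convex B" "\<And>C. C \<in> \<C> \<Longrightarrow> C \<inter> B \<noteq> {}"
    "\<And>k y z. k < K \<Longrightarrow> y \<in> B \<inter> Y \<Longrightarrow> z \<in> B \<inter> Y \<Longrightarrow> q k (y - z) \<le> \<delta>" by simp_all
  have "\<exists>B'. convex B' \<and> (\<forall>C\<in>(\<lambda>C. C \<inter> B) ` \<C>. C \<inter> B' \<noteq> {}) \<and> (\<forall>y\<in>B' \<inter> Y. \<forall>z\<in>B' \<inter> Y. q K (y - z) \<le> \<delta>)"
    by (rule refinable[OF convex_base_Int[OF base B(1,2)] _ \<delta>, of R]) (use sub in auto)
  then obtain B' where B': "convex B'" "\<forall>C\<in>(\<lambda>C. C \<inter> B) ` \<C>. C \<inter> B' \<noteq> {}"
    "\<forall>y\<in>B' \<inter> Y. \<forall>z\<in>B' \<inter> Y. q K (y - z) \<le> \<delta>" by (elim exE conjE)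
  have "q k (y - z) \<le> \<delta>" if "k < Suc K" "y \<in> (B \<inter> B') \<inter> Y" "z \<in> (B \<inter> B') \<inter> Y" for k y z
    using that B(3)[of k y z] B'(3) by (cases "k = K") auto
  then show ?case
    using B' B(1) by (intro exI[of _ "B \<inter> B'"]) (auto simp: Int_assoc intro: convex_Int)
qed

text \<open>
  Elements of nearly minimal norm have, by the parallelogram identity in \<open>l\<^sup>2\<close>, almost the same
  sequence of seminorms; hence their tails are uniformly small, and only finitely many seminorms
  remain to be controlled.
\<close>

lemma convexly_refinable_carrier: "convexly_refinable carrier total"
  unfolding convexly_refinable_def
proof (intro allI impI, elim conjE)
  fix \<C> R and \<delta> :: real
  assume base: "convex_base \<C>" and sub: "\<forall>C\<in>\<C>. C \<subseteq> {x\<in>carrier. total x \<le> R}" and \<delta>: "\<delta> > 0"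
  \<comment> \<open>Five shares: one for the first \<open>K\<close> seminorms and four for the tail
    of a difference, two for each of its terms.\<close>
  define \<tau> where "\<tau> = \<delta> / 5"
  have \<tau>: "\<tau> > 0" using \<delta> by (simp add: \<tau>_def)
  have lb: "0 \<le> Inf (total ` C)" "Inf (total ` C) \<le> R" "\<And>x. x \<in> C \<Longrightarrow> Inf (total ` C) \<le> total x"
    if C: "C \<in> \<C>" for C
  proof -
    obtain x where x: "x \<in> C" using convex_baseD(3)[OF base C] by blast
    have nn: "0 \<le> total y" if "y \<in> C" for y using sub C that total_nonneg by blast
    then have bb: "bdd_below (total ` C)" by (intro bdd_belowI[of _ 0]) auto
    show "0 \<le> Inf (total ` C)" using x nn by (intro cINF_greatest) auto
    show le: "Inf (total ` C) \<le> total y" if "y \<in> C" for y using that bb by (rule cINF_lower[rotated])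
    have "total x \<le> R" using sub C x by blast
    then show "Inf (total ` C) \<le> R" using le[OF x] by linarith
  qed
  \<comment> \<open>The asymptotic minimal norm of the base: members have elements of norm
    arbitrarily close to at most \<open>\<mu>\<close>, and small members have no elements of much
    smaller norm.\<close>
  define \<mu> where "\<mu> = (SUP C\<in>\<C>. Inf (total ` C))"
  have bdd: "bdd_above ((\<lambda>C. Inf (total ` C)) ` \<C>)" using lb(2) by (intro bdd_aboveI[of _ R]) auto
  have \<mu>_ge: "Inf (total ` C) \<le> \<mu>" if "C \<in> \<C>" for C unfolding \<mu>_def by (rule cSUP_upper[OF that bdd])
  have \<mu>_le: "\<mu> \<le> R" unfolding \<mu>_def by (rule cSUP_least) (use convex_baseD(1)[OF base] lb in auto)
  obtain C1 where C1: "C1 \<in> \<C>" using convex_baseD(1)[OF base] by blast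
  have \<mu>_nn: "0 \<le> \<mu>" using lb(1)[OF C1] \<mu>_ge[OF C1] by linarith
  \<comment> \<open>The square sum of the differences of seminorms will be bounded by
    \<open>16 * \<eta> * (\<mu> + \<eta>)\<close>, which this choice makes at most
    \<open>\<tau>\<^sup>2\<close>.\<close>
  define \<eta> where "\<eta> = min 1 (\<tau>\<^sup>2 / (16 * (R + 1)))"
  have R0: "R \<ge> 0" using \<mu>_nn \<mu>_le by linarith
  have \<eta>: "\<eta> > 0" "\<eta> \<le> 1" "\<eta> \<le> \<tau>\<^sup>2 / (16 * (R + 1))" using \<tau> R0 unfolding \<eta>_def by auto
  have \<eta>3: "16 * \<eta> * (\<mu> + \<eta>) \<le> \<tau>\<^sup>2"
  proof -
    have "16 * \<eta> * (\<mu> + \<eta>) \<le> 16 * \<eta> * (R + 1)" using \<eta>(1,2) \<mu>_le by (intro mult_left_mono) auto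
    also have "\<dots> = \<eta> * (16 * (R + 1))" by simp
    also have "\<dots> \<le> \<tau>\<^sup>2" using \<eta>(3) R0 by (subst pos_le_divide_eq[symmetric]) auto
    finally show ?thesis .
  qed
  obtain C0 where C0: "C0 \<in> \<C>" "\<mu> - \<eta> < Inf (total ` C0)"
  proof -
    have "\<mu> - \<eta> < \<mu>" using \<eta>(1) by simp
    then have "\<exists>C\<in>\<C>. \<mu> - \<eta> < Inf (total ` C)"
      unfolding \<mu>_def using convex_baseD(1)[OF base] bdd by (subst (asm) less_cSUP_iff) auto
    then show ?thesis using that by blast
  qed
  define B1 where "B1 = C0 \<inter> {x\<in>carrier. total x \<le> \<mu> + \<eta>}"
  have B1_convex: "convex B1"
    unfolding B1_def by (intro convex_Int convex_norm_ball convex_baseD(2)[OF base C0(1)])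
  have meet1: "C \<inter> B1 \<noteq> {}" if C: "C \<in> \<C>" for C
  proof -
    obtain E where E: "E \<in> \<C>" "E \<subseteq> C" "E \<subseteq> C0" using convex_baseD(4)[OF base C C0(1)] by blast
    have "Inf (total ` E) < \<mu> + \<eta>" using \<mu>_ge[OF E(1)] \<eta>(1) by linarith
    moreover have "bdd_below (total ` E)" using lb(3)[OF E(1)] by (intro bdd_belowI[of _ "Inf (total ` E)"]) auto
    ultimately obtain x where "x \<in> E" "total x < \<mu> + \<eta>"
      using convex_baseD(3)[OF base E(1)] cINF_less_iff[of E total "\<mu> + \<eta>"] by auto
    then have "x \<in> C \<inter> B1" using E sub E(1) by (auto simp: B1_def)
    then show ?thesis by blast
  qed
  have B1c: "x \<in> carrier" "x \<in> Y" "total x \<le> \<mu> + \<eta>" if "x \<in> B1" for x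
    using that carrier_Y by (auto simp: B1_def)
  have profile: "L2_set (\<lambda>k. q k y - q k z) {K..<n} \<le> \<tau>" if y: "y \<in> B1" and z: "z \<in> B1" for y z K n
  proof -
    have sy: "summable (\<lambda>k. (q k y)\<^sup>2)" and sz: "summable (\<lambda>k. (q k z)\<^sup>2)"
      using B1c(1)[OF y] B1c(1)[OF z] by (auto simp: carrier_def)
    have yz: "y + z \<in> carrier" by (rule carrier_add(1)[OF B1c(1)[OF y] B1c(1)[OF z]])
    have syz: "summable (\<lambda>k. (q k (y + z))\<^sup>2)" using yz by (simp add: carrier_def)
    \<comment> \<open>The midpoint lies in the convex set \<open>C0\<close>, so its norm cannot drop
      below \<open>\<mu> - \<eta>\<close>; near equality in the triangle inequality then forces the
      two sequences of seminorms together.\<close>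
    have "(1/2) *\<^sub>R y + (1/2) *\<^sub>R z \<in> C0"
      using y z by (intro convexD[OF convex_baseD(2)[OF base C0(1)]]) (auto simp: B1_def)
    then have "\<mu> - \<eta> < total ((1/2) *\<^sub>R y + (1/2) *\<^sub>R z)" using C0(2) lb(3)[OF C0(1)] by force
    also have "(1/2) *\<^sub>R y + (1/2) *\<^sub>R z = (1/2) *\<^sub>R (y + z)" by (simp add: scaleR_add_right)
    also have "total \<dots> = total (y + z) / 2" by (simp add: carrier_scaleR(2)[OF yz])
    finally have mid: "2 * (\<mu> - \<eta>) \<le> total (y + z)" by simp
    have par: "(q k y - q k z)\<^sup>2 \<le> 2 * (q k y)\<^sup>2 + 2 * (q k z)\<^sup>2 - (q k (y + z))\<^sup>2" for k
    proof -
      have "(q k (y + z))\<^sup>2 \<le> (q k y + q k z)\<^sup>2"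
        using B1c(2)[OF y] B1c(2)[OF z] carrier_Y[OF yz] by (intro power_mono q_triangle q_nonneg)
      then show ?thesis by (simp add: power2_eq_square algebra_simps)
    qed
    have "(\<Sum>k=K..<n. (q k y - q k z)\<^sup>2) \<le> (\<Sum>k<n. (q k y - q k z)\<^sup>2)"
      by (rule sum_mono2) auto
    also have "\<dots> \<le> (\<Sum>k<n. 2 * (q k y)\<^sup>2 + 2 * (q k z)\<^sup>2 - (q k (y + z))\<^sup>2)"
      by (rule sum_mono) (rule par)
    also have "\<dots> \<le> (\<Sum>k. 2 * (q k y)\<^sup>2 + 2 * (q k z)\<^sup>2 - (q k (y + z))\<^sup>2)"
    proof (rule sum_le_suminf)
      show "summable (\<lambda>k. 2 * (q k y)\<^sup>2 + 2 * (q k z)\<^sup>2 - (q k (y + z))\<^sup>2)"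
        by (intro summable_diff summable_add summable_mult sy sz syz)
      show "0 \<le> 2 * (q k y)\<^sup>2 + 2 * (q k z)\<^sup>2 - (q k (y + z))\<^sup>2" for k
        using par[of k] zero_le_power2[of "q k y - q k z"] by linarith
    qed simp
    also have "\<dots> = 2 * (total y)\<^sup>2 + 2 * (total z)\<^sup>2 - (total (y + z))\<^sup>2"
      unfolding total_power2[OF B1c(1)[OF y]] total_power2[OF B1c(1)[OF z]] total_power2[OF yz]
      by (simp add: suminf_diff[symmetric] suminf_add[symmetric] suminf_mult summable_add summable_mult sy sz syz)
    also have "\<dots> \<le> 4 * (\<mu> + \<eta>)\<^sup>2 - (total (y + z))\<^sup>2"
    proof -
      have "(total y)\<^sup>2 \<le> (\<mu> + \<eta>)\<^sup>2" "(total z)\<^sup>2 \<le> (\<mu> + \<eta>)\<^sup>2"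
        using B1c[OF y] B1c[OF z] total_nonneg by (auto intro!: power_mono)
      then show ?thesis by linarith
    qed
    also have "\<dots> \<le> 16 * \<eta> * (\<mu> + \<eta>)"
    \<comment> \<open>The lower bound for the midpoint can be squared only if
      \<open>\<mu> - \<eta>\<close> is nonnegative; otherwise the norms themselves are already
      small.\<close>
    proof (cases "\<eta> \<le> \<mu>")
      case True
      then have "(2 * (\<mu> - \<eta>))\<^sup>2 \<le> (total (y + z))\<^sup>2" using mid by (intro power_mono) auto
      moreover have "4 * (\<mu> + \<eta>)\<^sup>2 - (2 * (\<mu> - \<eta>))\<^sup>2 = 16 * \<eta> * \<mu>"
        by (simp add: power2_eq_square algebra_simps)
      moreover have "16 * \<eta> * \<mu> \<le> 16 * \<eta> * (\<mu> + \<eta>)" using \<eta>(1) by (intro mult_left_mono) auto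
      ultimately show ?thesis by linarith
    next
      case False
      have "4 * (\<mu> + \<eta>)\<^sup>2 = (4 * (\<mu> + \<eta>)) * (\<mu> + \<eta>)" by (simp add: power2_eq_square)
      also have "\<dots> \<le> (16 * \<eta>) * (\<mu> + \<eta>)" using False \<eta>(1) \<mu>_nn by (intro mult_right_mono) auto
      finally show ?thesis using zero_le_power2[of "total (y + z)"] by linarith
    qed
    also have "\<dots> \<le> \<tau>\<^sup>2" by (rule \<eta>3)
    finally show ?thesis unfolding L2_set_def using \<tau> by (intro real_le_lsqrt) (auto simp: sum_nonneg)
  qed
  obtain y0 where y0: "y0 \<in> B1" using meet1[OF C1] by blast
  obtain K where K: "\<And>n. L2_set (\<lambda>k. q k y0) {K..<n} \<le> \<tau>"
    using L2_set_tail[OF _ \<tau>, of "\<lambda>k. q k y0"] B1c(1)[OF y0] unfolding carrier_def by blast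
  have tail: "L2_set (\<lambda>k. q k z) {K..<n} \<le> 2 * \<tau>" if "z \<in> B1" for z n
    using L2_set_diff_le[of "\<lambda>k. q k z" "{K..<n}" "\<lambda>k. q k y0"] K[of n] profile[OF that y0, of K n] by linarith
  \<comment> \<open>\<open>K\<close> seminorms of size \<open>\<kappa>\<close> have square norm at
    most \<open>\<tau>\<close> altogether.\<close>
  define \<kappa> where "\<kappa> = \<tau> / (real K + 1)"
  have \<kappa>: "\<kappa> > 0" "real K * \<kappa> \<le> \<tau>" using \<tau> by (auto simp: \<kappa>_def field_simps)
  have "\<exists>B. convex B \<and> (\<forall>C\<in>(\<lambda>C. C \<inter> B1) ` \<C>. C \<inter> B \<noteq> {}) \<and>
      (\<forall>k<K. \<forall>y\<in>B \<inter> Y. \<forall>z\<in>B \<inter> Y. q k (y - z) \<le> \<kappa>)"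
    by (rule refinable_finite[OF convex_base_Int[OF base B1_convex meet1] _ \<kappa>(1), of R]) (use sub in auto)
  then obtain B2 where B2: "convex B2" "\<forall>C\<in>(\<lambda>C. C \<inter> B1) ` \<C>. C \<inter> B2 \<noteq> {}"
    and B2': "\<forall>k<K. \<forall>y\<in>B2 \<inter> Y. \<forall>z\<in>B2 \<inter> Y. q k (y - z) \<le> \<kappa>" by (elim exE conjE)
  have "total (y - z) \<le> \<delta>" if y: "y \<in> B1 \<inter> B2" and z: "z \<in> B1 \<inter> B2" for y z
  proof (rule carrierI(2))
    have yY: "y \<in> Y" and zY: "z \<in> Y" using y z B1c by auto
    show "y - z \<in> Y" by (rule Y_diff[OF yY zY])
    fix n
    have nn: "0 \<le> q k (y - z)" for k by (rule q_nonneg[OF Y_diff[OF yY zY]])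
    have "L2_set (\<lambda>k. q k (y - z)) {..<K} \<le> (\<Sum>k<K. q k (y - z))" by (rule L2_set_le_sum) (rule nn)
    also have "\<dots> \<le> (\<Sum>k<K. \<kappa>)" using B2' y z yY zY by (intro sum_mono) auto
    also have "\<dots> \<le> \<tau>" using \<kappa>(2) by simp
    finally have head: "L2_set (\<lambda>k. q k (y - z)) {..<K} \<le> \<tau>" .
    have "L2_set (\<lambda>k. q k (y - z)) {K..<n} \<le> L2_set (\<lambda>k. q k y + q k z) {K..<n}"
      by (intro L2_set_mono q_diff_le yY zY nn)
    also have "\<dots> \<le> L2_set (\<lambda>k. q k y) {K..<n} + L2_set (\<lambda>k. q k z) {K..<n}" by (rule L2_set_triangle_ineq)
    also have "\<dots> \<le> 4 * \<tau>" using tail[of y n] tail[of z n] y z by auto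
    finally have rest: "L2_set (\<lambda>k. q k (y - z)) {K..<n} \<le> 4 * \<tau>" .
    have "(\<Sum>k<n. (q k (y - z))\<^sup>2) \<le> (\<Sum>k\<in>{..<K} \<union> {K..<n}. (q k (y - z))\<^sup>2)"
      by (rule sum_mono2) auto
    also have "\<dots> = (\<Sum>k<K. (q k (y - z))\<^sup>2) + (\<Sum>k=K..<n. (q k (y - z))\<^sup>2)"
      by (rule sum.union_disjoint) auto
    finally have "partial (y - z) n \<le> sqrt ((\<Sum>k<K. (q k (y - z))\<^sup>2) + (\<Sum>k=K..<n. (q k (y - z))\<^sup>2))"
      unfolding partial_def L2_set_def by (rule real_sqrt_le_mono)
    also have "\<dots> \<le> L2_set (\<lambda>k. q k (y - z)) {..<K} + L2_set (\<lambda>k. q k (y - z)) {K..<n}"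
      unfolding L2_set_def by (rule sqrt_add_le_add_sqrt) (auto intro: sum_nonneg)
    finally show "partial (y - z) n \<le> \<delta>" using head rest by (simp add: \<tau>_def)
  qed
  then show "\<exists>B. convex B \<and> (\<forall>C\<in>\<C>. C \<inter> B \<noteq> {}) \<and> (\<forall>y\<in>B \<inter> carrier. \<forall>z\<in>B \<inter> carrier. total (y - z) \<le> \<delta>)"
    using B2(1,2) B1_convex by (intro exI[of _ "B1 \<inter> B2"]) (auto simp: Int_assoc intro: convex_Int)
qed

lemma reflexive_carrier: "reflexive_on carrier total"
  by (rule convexly_refinable_reflexive[OF banach_space_carrier convexly_refinable_carrier])

end

section \<open>The interpolation norms\<close>

text \<open>A symmetric, convex and translation invariant set which contains the cocycle values
  \<open>translate g \<psi> - \<psi>\<close> without any scaling factor.\<close>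

definition difference_hull :: "('a::group_add \<Rightarrow> real) \<Rightarrow> ('a \<Rightarrow> real) set"
  where "difference_hull \<psi> = {a - b |a b. a \<in> orbit_hull \<psi> \<and> b \<in> orbit_hull \<psi>}"

text \<open>A decomposition of \<open>\<xi>\<close> into \<open>t\<close> times an element of the
  hull and a remainder of uniform norm at most \<open>M\<close>.\<close>

definition admissible :: "('a::group_add \<Rightarrow> real) \<Rightarrow> ('a \<Rightarrow> real) \<Rightarrow> real \<Rightarrow> real \<Rightarrow> bool"
  where "admissible \<psi> \<xi> t M \<longleftrightarrow> t \<ge> 0 \<and> (\<exists>w\<in>difference_hull \<psi>. \<forall>s. \<bar>\<xi> s - t * w s\<bar> \<le> M)"

text \<open>
  The seminorms of the Davis-Figiel-Johnson-Pelczynski interpolation space between the symmetric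
  convex set \<open>difference_hull \<psi>\<close> and the uniform norm, as an infimal convolution.
\<close>

definition gauge_norm :: "('a::group_add \<Rightarrow> real) \<Rightarrow> nat \<Rightarrow> ('a \<Rightarrow> real) \<Rightarrow> real"
  where "gauge_norm \<psi> m \<xi> = Inf {t / 2 ^ m + 2 ^ m * M |t M. admissible \<psi> \<xi> t M}"

lemma zero_orbit_hull: "0 \<in> orbit_hull \<psi>" and translate_orbit_hull: "translate g \<psi> \<in> orbit_hull \<psi>"
  unfolding orbit_hull_def by (rule hull_inc; simp)+

lemma convex_orbit_hull: "convex (orbit_hull \<psi>)"
  by (simp add: orbit_hull_def)

lemma orbit_hull_translate:
  assumes "w \<in> orbit_hull \<psi>" shows "translate g w \<in> orbit_hull \<psi>"
proof -
  have "convex hull (insert 0 (range (\<lambda>g. translate g \<psi>))) \<subseteq> {w. translate g w \<in> orbit_hull \<psi>}"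
  proof (rule hull_minimal)
    have "translate g (translate h \<psi>) \<in> orbit_hull \<psi>" for h
      using translate_orbit_hull[of "g + h" \<psi>] by (simp add: translate_add)
    then show "insert 0 (range (\<lambda>g. translate g \<psi>)) \<subseteq> {w. translate g w \<in> orbit_hull \<psi>}"
      by (auto simp: zero_orbit_hull)
    show "convex {w. translate g w \<in> orbit_hull \<psi>}"
      using convex_orbit_hull[of \<psi>] unfolding convex_def by (simp add: translate_plus translate_scaleR)
  qed
  then show ?thesis using assms unfolding orbit_hull_def by blast
qed

lemma orbit_hull_bound:
  assumes "\<And>x. \<bar>\<psi> x\<bar> \<le> 1" "w \<in> orbit_hull \<psi>"
  shows "\<bar>w s\<bar> \<le> 1"
proof -
  have "convex hull (insert 0 (range (\<lambda>g. translate g \<psi>))) \<subseteq> {y. \<forall>s. \<bar>y s - 0\<bar> \<le> 1}"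
    by (rule hull_minimal[where S = convex, OF _ convex_uniform_ball]) (use assms in \<open>auto simp: translate_def\<close>)
  then show ?thesis using assms(2) unfolding orbit_hull_def by auto
qed

lemma zero_difference_hull: "0 \<in> difference_hull \<psi>"
  unfolding difference_hull_def using zero_orbit_hull[of \<psi>] by force

lemma convex_difference_hull: "convex (difference_hull \<psi>)"
proof -
  have "difference_hull \<psi> = (\<Union>x\<in>orbit_hull \<psi>. \<Union>y\<in>orbit_hull \<psi>. {x - y})"
    unfolding difference_hull_def by blast
  then show ?thesis by (simp add: convex_differences convex_orbit_hull)
qed

lemma uminus_difference_hull: "w \<in> difference_hull \<psi> \<Longrightarrow> - w \<in> difference_hull \<psi>"
  unfolding difference_hull_def by force

lemma difference_hull_translate: "w \<in> difference_hull \<psi> \<Longrightarrow> translate g w \<in> difference_hull \<psi>"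
  unfolding difference_hull_def using orbit_hull_translate by (force simp: translate_minus)

lemma difference_hull_bound:
  assumes "\<And>x. \<bar>\<psi> x\<bar> \<le> 1" "w \<in> difference_hull \<psi>"
  shows "\<bar>w s\<bar> \<le> 2"
proof -
  obtain a b where "w = a - b" "a \<in> orbit_hull \<psi>" "b \<in> orbit_hull \<psi>"
    using assms(2) unfolding difference_hull_def by blast
  then show ?thesis using orbit_hull_bound[of \<psi> a s] orbit_hull_bound[of \<psi> b s] assms(1) by (simp add: fun_diff_def)
qed

lemma convexly_compact_difference_hull:
  assumes "convexly_compact (orbit_hull \<psi>)"
  shows "convexly_compact (difference_hull \<psi>)"
proof (rule convexly_compact_subset)
  show "convexly_compact {a + b |a b. a \<in> orbit_hull \<psi> \<and> b \<in> (*\<^sub>R) (- 1) ` orbit_hull \<psi>}"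
    by (intro convexly_compact_sum convexly_compact_scale assms convex_orbit_hull convex_scaling) simp
  show "difference_hull \<psi> \<subseteq> {a + b |a b. a \<in> orbit_hull \<psi> \<and> b \<in> (*\<^sub>R) (- 1) ` orbit_hull \<psi>}"
    unfolding difference_hull_def by force
qed

section \<open>Norm properties of the interpolation seminorms\<close>

lemma admissible_nonneg: "admissible \<psi> \<xi> t M \<Longrightarrow> 0 \<le> M"
  unfolding admissible_def by (meson abs_ge_zero order_trans)

lemma admissible_bound:
  assumes "\<And>s. \<bar>\<xi> s\<bar> \<le> M" shows "admissible \<psi> \<xi> 0 M"
  unfolding admissible_def using assms zero_difference_hull by auto

lemma admissible_value_nonneg: "admissible \<psi> \<xi> t M \<Longrightarrow> 0 \<le> t / 2 ^ m + 2 ^ m * M"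
  using admissible_nonneg[of \<psi> \<xi> t M] by (simp add: admissible_def)

lemma gauge_norm_le:
  assumes "admissible \<psi> \<xi> t M" shows "gauge_norm \<psi> m \<xi> \<le> t / 2 ^ m + 2 ^ m * M"
  unfolding gauge_norm_def
proof (rule cInf_lower)
  show "bdd_below {t / 2 ^ m + 2 ^ m * M |t M. admissible \<psi> \<xi> t M}"
    by (rule bdd_belowI[of _ 0]) (auto intro: admissible_value_nonneg)
qed (use assms in blast)

lemma gauge_norm_greatest:
  assumes "\<xi> \<in> linf" "\<And>t M. admissible \<psi> \<xi> t M \<Longrightarrow> c \<le> t / 2 ^ m + 2 ^ m * M"
  shows "c \<le> gauge_norm \<psi> m \<xi>"
  unfolding gauge_norm_def
proof (rule cInf_greatest)
  have "admissible \<psi> \<xi> 0 (linf_norm \<xi>)" using linf_bound[OF assms(1)] by (intro admissible_bound)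
  then show "{t / 2 ^ m + 2 ^ m * M |t M. admissible \<psi> \<xi> t M} \<noteq> {}" by blast
qed (use assms(2) in blast)

lemma gauge_norm_less:
  assumes "\<xi> \<in> linf" "gauge_norm \<psi> m \<xi> < c"
  obtains t M where "admissible \<psi> \<xi> t M" "t / 2 ^ m + 2 ^ m * M < c"
  using gauge_norm_greatest[OF assms(1), of \<psi> c m] assms(2) by force

lemma gauge_norm_nonneg: "\<xi> \<in> linf \<Longrightarrow> 0 \<le> gauge_norm \<psi> m \<xi>"
  by (rule gauge_norm_greatest) (auto intro: admissible_value_nonneg)

lemma admissible_add:
  assumes "admissible \<psi> \<xi> t M" "admissible \<psi> \<xi>' t' M'"
  shows "admissible \<psi> (\<xi> + \<xi>') (t + t') (M + M')"
proof -
  obtain w w' where w: "w \<in> difference_hull \<psi>" "\<And>s. \<bar>\<xi> s - t * w s\<bar> \<le> M"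
    and w': "w' \<in> difference_hull \<psi>" "\<And>s. \<bar>\<xi>' s - t' * w' s\<bar> \<le> M'" and t: "t \<ge> 0" "t' \<ge> 0"
    using assms unfolding admissible_def by blast
  obtain v where v: "v \<in> difference_hull \<psi>" "\<And>s. (t + t') * v s = t * w s + t' * w' s"
  proof (cases "t + t' = 0")
    case True
    then have "t = 0" "t' = 0" using t by auto
    then show ?thesis using that[OF w(1)] by simp
  next
    case False
    let ?v = "(t / (t + t')) *\<^sub>R w + (t' / (t + t')) *\<^sub>R w'"
    have "?v \<in> difference_hull \<psi>"
      using t False by (intro convexD[OF convex_difference_hull w(1) w'(1)]) (auto simp flip: add_divide_distrib)
    moreover have "(t + t') * ?v s = t * w s + t' * w' s" for s
      using False by (simp add: scaleR_fun_apply distrib_left)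
    ultimately show ?thesis using that by blast
  qed
  have "\<bar>(\<xi> + \<xi>') s - (t + t') * v s\<bar> \<le> M + M'" for s
    using w(2)[of s] w'(2)[of s] unfolding v(2) plus_fun_apply by linarith
  then show ?thesis unfolding admissible_def using v(1) t by auto
qed

lemma gauge_norm_triangle:
  assumes "\<xi> \<in> linf" "\<xi>' \<in> linf"
  shows "gauge_norm \<psi> m (\<xi> + \<xi>') \<le> gauge_norm \<psi> m \<xi> + gauge_norm \<psi> m \<xi>'"
proof (rule field_le_epsilon)
  fix \<epsilon> :: real assume "\<epsilon> > 0"
  obtain t M where t: "admissible \<psi> \<xi> t M" "t / 2 ^ m + 2 ^ m * M < gauge_norm \<psi> m \<xi> + \<epsilon> / 2"
    using gauge_norm_less[OF assms(1), of \<psi> m "gauge_norm \<psi> m \<xi> + \<epsilon> / 2"] \<open>\<epsilon> > 0\<close> by auto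
  obtain t' M' where t': "admissible \<psi> \<xi>' t' M'" "t' / 2 ^ m + 2 ^ m * M' < gauge_norm \<psi> m \<xi>' + \<epsilon> / 2"
    using gauge_norm_less[OF assms(2), of \<psi> m "gauge_norm \<psi> m \<xi>' + \<epsilon> / 2"] \<open>\<epsilon> > 0\<close> by auto
  have "gauge_norm \<psi> m (\<xi> + \<xi>') \<le> (t + t') / 2 ^ m + 2 ^ m * (M + M')"
    by (rule gauge_norm_le[OF admissible_add[OF t(1) t'(1)]])
  also have "\<dots> = (t / 2 ^ m + 2 ^ m * M) + (t' / 2 ^ m + 2 ^ m * M')"
    by (simp add: add_divide_distrib distrib_left)
  finally show "gauge_norm \<psi> m (\<xi> + \<xi>') \<le> gauge_norm \<psi> m \<xi> + gauge_norm \<psi> m \<xi>' + \<epsilon>"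
    using t(2) t'(2) by linarith
qed

lemma admissible_scaleR:
  assumes "admissible \<psi> \<xi> t M"
  shows "admissible \<psi> (c *\<^sub>R \<xi>) (\<bar>c\<bar> * t) (\<bar>c\<bar> * M)"
proof -
  obtain w where w: "w \<in> difference_hull \<psi>" "\<And>s. \<bar>\<xi> s - t * w s\<bar> \<le> M" and t: "t \<ge> 0"
    using assms unfolding admissible_def by blast
  obtain v where v: "v \<in> difference_hull \<psi>" "\<And>s. \<bar>c\<bar> * v s = c * w s"
  proof (cases "c \<ge> 0")
    case False
    then show ?thesis using that[OF uminus_difference_hull[OF w(1)]] by simp
  qed (use that[OF w(1)] in simp)
  have "\<bar>(c *\<^sub>R \<xi>) s - (\<bar>c\<bar> * t) * v s\<bar> \<le> \<bar>c\<bar> * M" for s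
  proof -
    have "(c *\<^sub>R \<xi>) s - (\<bar>c\<bar> * t) * v s = c * \<xi> s - t * (\<bar>c\<bar> * v s)"
      by (simp add: scaleR_fun_apply mult_ac)
    also have "\<dots> = c * (\<xi> s - t * w s)" unfolding v(2) by (simp add: algebra_simps)
    finally show ?thesis using w(2)[of s] by (simp add: abs_mult mult_left_mono)
  qed
  then show ?thesis unfolding admissible_def using v(1) t by auto
qed

lemma gauge_norm_scaleR_le:
  assumes "\<xi> \<in> linf"
  shows "gauge_norm \<psi> m (c *\<^sub>R \<xi>) \<le> \<bar>c\<bar> * gauge_norm \<psi> m \<xi>"
proof (cases "c = 0")
  case True
  have "gauge_norm \<psi> m (c *\<^sub>R \<xi>) \<le> 0 / 2 ^ m + 2 ^ m * 0"
    by (intro gauge_norm_le admissible_bound) (simp add: True scaleR_fun_apply)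
  then show ?thesis using True by simp
next
  case False
  have "gauge_norm \<psi> m (c *\<^sub>R \<xi>) / \<bar>c\<bar> \<le> gauge_norm \<psi> m \<xi>"
  proof (rule gauge_norm_greatest[OF assms])
    fix t M assume "admissible \<psi> \<xi> t M"
    from gauge_norm_le[OF admissible_scaleR[OF this], of m c]
    have "gauge_norm \<psi> m (c *\<^sub>R \<xi>) \<le> \<bar>c\<bar> * (t / 2 ^ m + 2 ^ m * M)"
      by (simp add: distrib_left mult_ac)
    then show "gauge_norm \<psi> m (c *\<^sub>R \<xi>) / \<bar>c\<bar> \<le> t / 2 ^ m + 2 ^ m * M"
      using False by (simp add: pos_divide_le_eq mult.commute)
  qed
  then show ?thesis using False by (simp add: pos_divide_le_eq mult.commute)
qed

lemma gauge_norm_scaleR: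
  assumes "\<xi> \<in> linf"
  shows "gauge_norm \<psi> m (c *\<^sub>R \<xi>) = \<bar>c\<bar> * gauge_norm \<psi> m \<xi>"
proof (cases "c = 0")
  case True
  then show ?thesis
    using gauge_norm_scaleR_le[OF assms, of \<psi> m c] gauge_norm_nonneg[OF linf_scaleR[OF assms], of \<psi> m c] by simp
next
  case False
  have "gauge_norm \<psi> m ((1 / c) *\<^sub>R (c *\<^sub>R \<xi>)) \<le> \<bar>1 / c\<bar> * gauge_norm \<psi> m (c *\<^sub>R \<xi>)"
    by (rule gauge_norm_scaleR_le[OF linf_scaleR[OF assms]])
  then have "gauge_norm \<psi> m \<xi> \<le> gauge_norm \<psi> m (c *\<^sub>R \<xi>) / \<bar>c\<bar>" using False by simp
  then have "\<bar>c\<bar> * gauge_norm \<psi> m \<xi> \<le> gauge_norm \<psi> m (c *\<^sub>R \<xi>)"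
    using False by (simp add: pos_le_divide_eq mult.commute)
  then show ?thesis using gauge_norm_scaleR_le[OF assms, of \<psi> m c] by linarith
qed

lemma gauge_norm_bound_le:
  assumes "\<And>s. \<bar>\<xi> s\<bar> \<le> M" shows "gauge_norm \<psi> m \<xi> \<le> 2 ^ m * M"
  using gauge_norm_le[OF admissible_bound[OF assms], of \<psi> m] by simp

text \<open>At scale \<open>0\<close> both terms have weight one, and elements of the hull are
  bounded by \<open>2\<close>. This comparison with the uniform norm gives separation and
  completeness, and later the lower bound for the cocycle.\<close>

lemma bound_le_gauge_norm:
  assumes \<psi>: "\<And>x. \<bar>\<psi> x\<bar> \<le> 1" and \<xi>: "\<xi> \<in> linf"
  shows "\<bar>\<xi> s\<bar> \<le> 2 * gauge_norm \<psi> 0 \<xi>"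
proof -
  have "\<bar>\<xi> s\<bar> / 2 \<le> gauge_norm \<psi> 0 \<xi>"
  proof (rule gauge_norm_greatest[OF \<xi>])
    fix t M assume adm: "admissible \<psi> \<xi> t M"
    then obtain w where w: "w \<in> difference_hull \<psi>" "\<bar>\<xi> s - t * w s\<bar> \<le> M" "t \<ge> 0"
      unfolding admissible_def by blast
    have "\<bar>t * w s\<bar> \<le> t * 2"
      using difference_hull_bound[OF \<psi> w(1), of s] w(3) by (simp add: abs_mult mult_left_mono)
    then show "\<bar>\<xi> s\<bar> / 2 \<le> t / 2 ^ 0 + 2 ^ 0 * M" using w(2) admissible_nonneg[OF adm] by simp
  qed
  then show ?thesis by simp
qed

lemma linf_translate: "\<xi> \<in> linf \<Longrightarrow> translate g \<xi> \<in> linf"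
  unfolding linf_iff translate_def by blast

lemma gauge_norm_translate:
  assumes "\<xi> \<in> linf"
  shows "gauge_norm \<psi> m (translate g \<xi>) = gauge_norm \<psi> m \<xi>"
proof -
  have le: "gauge_norm \<psi> m (translate g \<xi>) \<le> gauge_norm \<psi> m \<xi>" if "\<xi> \<in> linf" for g \<xi>
  proof (rule gauge_norm_greatest[OF that])
    fix t M assume "admissible \<psi> \<xi> t M"
    then obtain w where w: "w \<in> difference_hull \<psi>" "\<And>s. \<bar>\<xi> s - t * w s\<bar> \<le> M" "t \<ge> 0"
      unfolding admissible_def by blast
    have "\<bar>translate g \<xi> s - t * translate g w s\<bar> \<le> M" for s
      using w(2)[of "- g + s"] by (simp add: translate_def)
    then have "admissible \<psi> (translate g \<xi>) t M"
      unfolding admissible_def using difference_hull_translate[OF w(1)] w(3) by blast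
    then show "gauge_norm \<psi> m (translate g \<xi>) \<le> t / 2 ^ m + 2 ^ m * M" by (rule gauge_norm_le)
  qed
  have "translate (- g) (translate g \<xi>) = \<xi>" by (simp flip: translate_add)
  then show ?thesis using le[OF assms, of g] le[OF linf_translate[OF assms, of g], of "- g"] by simp
qed

lemma gauge_norm_orbit_difference: "gauge_norm \<psi> m (translate g \<psi> - \<psi>) \<le> 1 / 2 ^ m"
proof -
  have "translate g \<psi> - \<psi> \<in> difference_hull \<psi>"
    unfolding difference_hull_def using translate_orbit_hull[of g \<psi>] translate_orbit_hull[of 0 \<psi>] by auto
  then have "admissible \<psi> (translate g \<psi> - \<psi>) 1 0"
    unfolding admissible_def by (intro conjI bexI) auto
  from gauge_norm_le[OF this, of m] show ?thesis by simp
qed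

text \<open>
  This is the step that makes the interpolation space reflexive: its balls are uniformly
  approximated by multiples of the convexly compact set \<open>difference_hull \<psi>\<close>.
\<close>

lemma convexly_compact_gauge_ball:
  assumes "convexly_compact (orbit_hull \<psi>)"
  shows "convexly_compact {\<xi>\<in>linf. \<forall>m. gauge_norm \<psi> m \<xi> \<le> R}"
proof (rule convexly_compact_approx)
  fix \<delta> :: real assume "\<delta> > 0"
  define Q where "Q = \<bar>R\<bar> + 1"
  have "Q > 0" by (simp add: Q_def)
  \<comment> \<open>At this scale a decomposition of value less than \<open>Q\<close> has remainder
    less than \<open>Q / 2 ^ m \<le> \<delta>\<close>, while its coefficient stays below the fixed
    number \<open>2 ^ m * Q\<close>.\<close>
  obtain m where m: "Q / \<delta> < 2 ^ m" using real_arch_pow[of 2 "Q / \<delta>"] by auto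
  then have m: "Q \<le> 2 ^ m * \<delta>" using \<open>\<delta> > 0\<close> by (simp add: pos_divide_less_eq)
  let ?T = "2 ^ m * Q"
  let ?A = "(*\<^sub>R) ?T ` difference_hull \<psi>"
  have T: "?T > 0" using \<open>Q > 0\<close> by simp
  have "\<exists>a\<in>?A. \<forall>s. \<bar>\<xi> s - a s\<bar> \<le> \<delta>" if \<xi>: "\<xi> \<in> linf" "\<forall>m. gauge_norm \<psi> m \<xi> \<le> R" for \<xi>
  proof -
    have "gauge_norm \<psi> m \<xi> < Q" using spec[OF \<xi>(2), of m] unfolding Q_def by linarith
    then obtain t M where tM: "admissible \<psi> \<xi> t M" "t / 2 ^ m + 2 ^ m * M < Q"
      using gauge_norm_less[OF \<xi>(1)] by blast
    then obtain w where w: "w \<in> difference_hull \<psi>" "\<And>s. \<bar>\<xi> s - t * w s\<bar> \<le> M" "t \<ge> 0"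
      unfolding admissible_def by blast
    have M0: "M \<ge> 0" by (rule admissible_nonneg[OF tM(1)])
    have "t / 2 ^ m < Q" "2 ^ m * M < Q"
      using tM(2) M0 w(3) by (smt (verit) divide_nonneg_pos mult_nonneg_nonneg zero_less_power)+
    then have tT: "t \<le> ?T" and "2 ^ m * M \<le> 2 ^ m * \<delta>"
      using m by (simp add: pos_divide_less_eq mult.commute, linarith)
    then have M: "M \<le> \<delta>" by simp
    \<comment> \<open>Since the hull contains \<open>0\<close>, the varying coefficient
      \<open>t\<close> can be absorbed into it, so that one multiple of the hull serves for all
      \<open>\<xi>\<close>.\<close>
    have "(t / ?T) *\<^sub>R w + (1 - t / ?T) *\<^sub>R 0 \<in> difference_hull \<psi>"
      using tT T w(3) by (intro convexD[OF convex_difference_hull w(1) zero_difference_hull]) auto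
    then have "(t / ?T) *\<^sub>R w \<in> difference_hull \<psi>" by simp
    then have "?T *\<^sub>R ((t / ?T) *\<^sub>R w) \<in> ?A" by (rule imageI)
    moreover have "?T *\<^sub>R ((t / ?T) *\<^sub>R w) = t *\<^sub>R w" using \<open>Q > 0\<close> by simp
    moreover have "\<bar>\<xi> s - (t *\<^sub>R w) s\<bar> \<le> \<delta>" for s using w(2)[of s] M by (simp add: scaleR_fun_apply)
    ultimately show ?thesis by metis
  qed
  moreover have "convex ?A" by (intro convex_scaling convex_difference_hull)
  moreover have "convexly_compact ?A"
    using T by (intro convexly_compact_scale convexly_compact_difference_hull assms) auto
  ultimately show "\<exists>A'. convex A' \<and> convexly_compact A' \<and> (\<forall>a\<in>{\<xi>\<in>linf. \<forall>m. gauge_norm \<psi> m \<xi> \<le> R}. \<exists>a'\<in>A'. \<forall>s. \<bar>a s - a' s\<bar> \<le> \<delta>)"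
    by blast
qed

section \<open>The affine action\<close>

lemma linf_zero: "0 \<in> linf"
  unfolding linf_iff by (auto intro!: exI[of _ 0])

lemma linf_diff: "u \<in> linf \<Longrightarrow> v \<in> linf \<Longrightarrow> u - v \<in> linf"
  using linf_add[OF _ linf_scaleR[of v "- 1"]] by simp

text \<open>On all of \<open>linf\<close> the translations need not be strongly continuous; on this
  closed invariant subspace they are.\<close>

definition smooth :: "('a::topological_group_add \<Rightarrow> real) set"
  where "smooth = {\<xi>\<in>linf. norm_continuous \<xi>}"

lemma subspace_smooth: "subspace smooth"
  unfolding subspace_def smooth_def
  using linf_zero linf_add linf_scaleR norm_continuous_add norm_continuous_scaleR tame_zero
  by (auto simp: tame_def)

text \<open>Translating by \<open>h\<close> and then by \<open>g\<close> is translating by the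
  conjugate \<open>- h + g + h\<close> and then by \<open>h\<close>; the conjugate tends to
  \<open>0\<close> with \<open>g\<close>.\<close>

lemma smooth_translate:
  assumes "\<xi> \<in> smooth"
  shows "translate h \<xi> \<in> smooth"
proof -
  have "norm_continuous (translate h \<xi>)"
    unfolding norm_continuous_def
  proof (intro allI impI)
    fix \<epsilon> :: real assume "\<epsilon> > 0"
    then have ev: "eventually (\<lambda>g. \<forall>x. \<bar>translate g \<xi> x - \<xi> x\<bar> \<le> \<epsilon>) (nhds 0)"
      using assms unfolding smooth_def norm_continuous_def by blast
    have "((\<lambda>g. - h + g + h) \<longlongrightarrow> - h + 0 + h) (nhds 0)"
      by (intro tendsto_add tendsto_const filterlim_ident)
    then have "filterlim (\<lambda>g. - h + g + h) (nhds 0) (nhds 0)" by simp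
    from eventually_compose_filterlim[OF ev this]
    show "eventually (\<lambda>g. \<forall>x. \<bar>translate g (translate h \<xi>) x - translate h \<xi> x\<bar> \<le> \<epsilon>) (nhds 0)"
    proof (rule eventually_mono, intro allI)
      fix g x assume *: "\<forall>x. \<bar>translate (- h + g + h) \<xi> x - \<xi> x\<bar> \<le> \<epsilon>"
      have "g + h = h + (- h + g + h)" by (simp add: add.assoc[symmetric])
      then have "translate g (translate h \<xi>) x = translate h (translate (- h + g + h) \<xi>) x"
        by (metis translate_add)
      then show "\<bar>translate g (translate h \<xi>) x - translate h \<xi> x\<bar> \<le> \<epsilon>"
        using spec[OF *, of "- h + x"] by (simp add: translate_def)
    qed
  qed
  then show ?thesis using assms by (simp add: smooth_def linf_translate)
qed

lemma smooth_complete: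
  assumes X: "\<And>i::nat. X i \<in> smooth"
    and cauchy: "\<And>\<epsilon>. \<epsilon> > 0 \<Longrightarrow> \<exists>n. \<forall>i\<ge>n. \<forall>j\<ge>n. \<forall>s. \<bar>X i s - X j s\<bar> < \<epsilon>"
  shows "\<exists>\<xi>\<in>smooth. \<forall>\<epsilon>>0. \<exists>n. \<forall>i\<ge>n. \<forall>s. \<bar>X i s - \<xi> s\<bar> \<le> \<epsilon>"
proof -
  have "Cauchy (\<lambda>i. X i s)" for s
    unfolding Cauchy_def dist_real_def using cauchy by meson
  then have "\<exists>l. (\<lambda>i. X i s) \<longlonglongrightarrow> l" for s
    using Cauchy_convergent_iff convergent_def by blast
  then obtain \<xi> where lim: "\<And>s. (\<lambda>i. X i s) \<longlonglongrightarrow> \<xi> s" by metis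
  have unif: "\<exists>n. \<forall>i\<ge>n. \<forall>s. \<bar>X i s - \<xi> s\<bar> \<le> \<epsilon>" if "\<epsilon> > 0" for \<epsilon>
  proof -
    obtain n where n: "\<And>i j s. i \<ge> n \<Longrightarrow> j \<ge> n \<Longrightarrow> \<bar>X i s - X j s\<bar> < \<epsilon>" using cauchy[OF \<open>\<epsilon> > 0\<close>] by blast
    have "\<bar>X i s - \<xi> s\<bar> \<le> \<epsilon>" if "i \<ge> n" for i s
    proof (rule LIMSEQ_le_const2)
      show "(\<lambda>j. \<bar>X i s - X j s\<bar>) \<longlonglongrightarrow> \<bar>X i s - \<xi> s\<bar>" by (intro tendsto_intros lim)
      show "\<exists>N. \<forall>j\<ge>N. \<bar>X i s - X j s\<bar> \<le> \<epsilon>" using n[OF that] by (meson less_imp_le)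
    qed
    then show ?thesis by blast
  qed
  obtain n where n: "\<And>s. \<bar>X n s - \<xi> s\<bar> \<le> 1" using unif[of 1] by auto
  have "\<bar>\<xi> s\<bar> \<le> linf_norm (X n) + 1" for s
    using n[of s] linf_bound[of "X n" s] X[of n] by (auto simp: smooth_def)
  then have "\<xi> \<in> linf" unfolding linf_iff by blast
  moreover have "norm_continuous \<xi>"
    unfolding norm_continuous_def
  proof (intro allI impI)
    fix \<epsilon> :: real assume "\<epsilon> > 0"
    then obtain n where n: "\<And>s. \<bar>X n s - \<xi> s\<bar> \<le> \<epsilon> / 3" using unif[of "\<epsilon> / 3"] by auto
    have "\<epsilon> / 3 > 0" using \<open>\<epsilon> > 0\<close> by simp
    then have "eventually (\<lambda>g. \<forall>x. \<bar>translate g (X n) x - X n x\<bar> \<le> \<epsilon> / 3) (nhds 0)"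
      using X[of n] unfolding smooth_def norm_continuous_def by blast
    then show "eventually (\<lambda>g. \<forall>x. \<bar>translate g \<xi> x - \<xi> x\<bar> \<le> \<epsilon>) (nhds 0)"
    proof (rule eventually_mono, intro allI)
      fix g x assume "\<forall>x. \<bar>translate g (X n) x - X n x\<bar> \<le> \<epsilon> / 3"
      then have "\<bar>X n (- g + x) - X n x\<bar> \<le> \<epsilon> / 3" by (simp add: translate_def)
      then show "\<bar>translate g \<xi> x - \<xi> x\<bar> \<le> \<epsilon>"
        using n[of "- g + x"] n[of x] unfolding translate_def by linarith
    qed
  qed
  ultimately show ?thesis using unif by (auto simp: smooth_def)
qed

lemma summable_geometric_pairs:
  "summable (\<lambda>k. (1/2) ^ snd (prod_decode k) * (1/4) ^ fst (prod_decode k) :: real)"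
proof (rule summableI_nonneg_bounded)
  fix N
  let ?h = "\<lambda>(n, m). (1/4) ^ n * (1/2) ^ m :: real"
  have "(\<Sum>k<N. (1/2) ^ snd (prod_decode k) * (1/4) ^ fst (prod_decode k)) = (\<Sum>k<N. ?h (prod_decode k))"
    by (rule sum.cong) (auto simp: case_prod_beta)
  also have "\<dots> = sum ?h (prod_decode ` {..<N})"
    by (subst sum.reindex) (auto simp: inj_prod_decode)
  also have "\<dots> \<le> sum ?h ({..<N} \<times> {..<N})"
  \<comment> \<open>\<open>prod_encode\<close> dominates both of its arguments, so the first
    \<open>N\<close> pairs lie in a square on which the sum factorises.\<close>
  proof (rule sum_mono2)
    show "prod_decode ` {..<N} \<subseteq> {..<N} \<times> {..<N}"
    proof
      fix p assume "p \<in> prod_decode ` {..<N}"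
      then obtain k where k: "k < N" "p = prod_decode k" by auto
      obtain n m where nm: "p = (n, m)" by fastforce
      then have "prod_encode (n, m) = k" using k(2) by (metis prod_decode_inverse)
      then have "n \<le> k" "m \<le> k" using le_prod_encode_1[of n m] le_prod_encode_2[of m n] by auto
      then show "p \<in> {..<N} \<times> {..<N}" using k(1) unfolding nm by auto
    qed
  qed auto
  also have "\<dots> = (\<Sum>n<N. (1/4) ^ n) * (\<Sum>m<N. (1/2) ^ m)"
    by (simp add: sum_product sum.cartesian_product)
  also have "\<dots> \<le> (\<Sum>n. (1/4) ^ n) * (\<Sum>m. (1/2) ^ m)"
    by (intro mult_mono sum_le_suminf suminf_nonneg sum_nonneg) (auto intro: summable_geometric)
  finally show "(\<Sum>k<N. (1/2) ^ snd (prod_decode k) * (1/4) ^ fst (prod_decode k)) \<le>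
      (\<Sum>n. (1/4) ^ n) * (\<Sum>m. (1/2 :: real) ^ m)" .
qed auto

section \<open>The l2-sum of the interpolation spaces\<close>

locale cutoff_sequence = compatible_group_metric d
  for d :: "'a::topological_group_add \<Rightarrow> 'a \<Rightarrow> real" +
  fixes \<psi> :: "nat \<Rightarrow> 'a \<Rightarrow> real" and S :: "nat \<Rightarrow> real"
  assumes \<psi>_tame: "tame (\<psi> n)" and \<psi>_bound: "\<bar>\<psi> n x\<bar> \<le> 1" and \<psi>_0: "\<psi> n 0 = 1"
    and \<psi>_supp: "\<psi> n x \<noteq> 0 \<Longrightarrow> d x 0 \<le> S n"
    and \<psi>_slow: "d g 0 \<le> real n \<Longrightarrow> \<bar>translate g (\<psi> n) x - \<psi> n x\<bar> \<le> 1 / 16 ^ n"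
begin

definition Y :: "(nat \<Rightarrow> 'a \<Rightarrow> real) set"
  where "Y = {f. \<forall>n. f n \<in> smooth}"

definition q :: "nat \<Rightarrow> (nat \<Rightarrow> 'a \<Rightarrow> real) \<Rightarrow> real"
  where "q k f = gauge_norm (\<psi> (fst (prod_decode k))) (snd (prod_decode k)) (f (fst (prod_decode k)))"

lemma q_encode: "q (prod_encode (n, m)) f = gauge_norm (\<psi> n) m (f n)"
  by (simp add: q_def)

lemma Y_linf: "f \<in> Y \<Longrightarrow> f n \<in> linf"
  by (simp add: Y_def smooth_def)

lemma \<psi>_smooth: "\<psi> n \<in> smooth"
  using \<psi>_tame[of n] by (simp add: smooth_def tame_def)

sublocale seminorm_family Y q
proof
  show "subspace Y"
    unfolding subspace_def Y_def
    using subspace_smooth unfolding subspace_def by (auto simp: plus_fun_apply zero_fun_apply scaleR_fun_apply)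
  fix x k assume x: "x \<in> Y"
  show "0 \<le> q k x" unfolding q_def by (rule gauge_norm_nonneg[OF Y_linf[OF x]])
  show "q k (c *\<^sub>R x) = \<bar>c\<bar> * q k x" for c
    unfolding q_def scaleR_fun_apply[of c x] by (rule gauge_norm_scaleR[OF Y_linf[OF x]])
  show "q k (x + y) \<le> q k x + q k y" if "y \<in> Y" for y
    unfolding q_def plus_fun_apply[of x y] by (rule gauge_norm_triangle[OF Y_linf[OF x] Y_linf[OF that]])
next
  fix x assume x: "x \<in> Y" and z: "\<And>k. q k x = 0"
  have "x n s = 0" for n s
    using bound_le_gauge_norm[of "\<psi> n" "x n" s] \<psi>_bound Y_linf[OF x] z[of "prod_encode (n, 0)"]
    by (simp add: q_encode)
  then show "x = 0" by (simp add: fun_eq_iff zero_fun_apply)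
next
  fix X :: "nat \<Rightarrow> nat \<Rightarrow> 'a \<Rightarrow> real"
  assume X: "\<And>i. X i \<in> Y" and cauchy: "\<And>k \<epsilon>. \<epsilon> > 0 \<Longrightarrow> \<exists>n. \<forall>i\<ge>n. \<forall>j\<ge>n. q k (X i - X j) < \<epsilon>"
  \<comment> \<open>The seminorms of scale \<open>0\<close> force uniform convergence in each
    coordinate, and uniform convergence in turn controls scale \<open>m\<close> up to the factor
    \<open>2 ^ m\<close>.\<close>
  have "\<exists>\<xi>\<in>smooth. \<forall>\<epsilon>>0. \<exists>N. \<forall>i\<ge>N. \<forall>s. \<bar>X i n s - \<xi> s\<bar> \<le> \<epsilon>" for n
  proof (rule smooth_complete)
    show "X i n \<in> smooth" for i using X[of i] by (simp add: Y_def)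
    fix \<epsilon> :: real assume "\<epsilon> > 0"
    then obtain N where N: "\<And>i j. i \<ge> N \<Longrightarrow> j \<ge> N \<Longrightarrow> q (prod_encode (n, 0)) (X i - X j) < \<epsilon> / 2"
      using cauchy[of "\<epsilon> / 2" "prod_encode (n, 0)"] by auto
    have "\<bar>X i n s - X j n s\<bar> < \<epsilon>" if "i \<ge> N" "j \<ge> N" for i j s
      using bound_le_gauge_norm[of "\<psi> n" "X i n - X j n" s] \<psi>_bound linf_diff[OF Y_linf[OF X] Y_linf[OF X]] N[OF that]
      by (simp add: q_encode fun_diff_def)
    then show "\<exists>N. \<forall>i\<ge>N. \<forall>j\<ge>N. \<forall>s. \<bar>X i n s - X j n s\<bar> < \<epsilon>" by blast
  qed
  then obtain \<xi> where \<xi>: "\<And>n. \<xi> n \<in> smooth" "\<And>n \<epsilon>. \<epsilon> > 0 \<Longrightarrow> \<exists>N. \<forall>i\<ge>N. \<forall>s. \<bar>X i n s - \<xi> n s\<bar> \<le> \<epsilon>"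
    by metis
  have \<xi>Y: "\<xi> \<in> Y" using \<xi>(1) by (simp add: Y_def)
  have "(\<lambda>i. q k (X i - \<xi>)) \<longlonglongrightarrow> 0" for k
  proof (rule LIMSEQ_I)
    fix \<epsilon> :: real assume "\<epsilon> > 0"
    obtain n m where k: "k = prod_encode (n, m)" by (metis prod_decode_inverse surj_pair)
    have "\<epsilon> / 2 / 2 ^ m > 0" using \<open>\<epsilon> > 0\<close> by simp
    then obtain N where N: "\<And>i s. i \<ge> N \<Longrightarrow> \<bar>X i n s - \<xi> n s\<bar> \<le> \<epsilon> / 2 / 2 ^ m" using \<xi>(2) by blast
    have "norm (q k (X i - \<xi>) - 0) < \<epsilon>" if "i \<ge> N" for i
    proof -
      have "q k (X i - \<xi>) \<le> 2 ^ m * (\<epsilon> / 2 / 2 ^ m)"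
        unfolding k q_encode by (rule gauge_norm_bound_le) (use N[OF that] in \<open>simp add: fun_diff_def\<close>)
      moreover have "0 \<le> q k (X i - \<xi>)"
        unfolding k q_encode fun_diff_def[of "X i"] by (rule gauge_norm_nonneg[OF linf_diff[OF Y_linf[OF X] Y_linf[OF \<xi>Y]]])
      ultimately show ?thesis using \<open>\<epsilon> > 0\<close> by simp
    qed
    then show "\<exists>N. \<forall>i\<ge>N. norm (q k (X i - \<xi>) - 0) < \<epsilon>" by blast
  qed
  then show "\<exists>x\<in>Y. \<forall>k. (\<lambda>i. q k (X i - x)) \<longlonglongrightarrow> 0" using \<xi>Y by blast
qed

text \<open>The coordinates of a bounded set lie in an interpolation ball, which is convexly
  compact. Uniform closeness is turned back into closeness for \<open>q k\<close> at the cost of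
  \<open>2 ^ m\<close>, which \<open>\<delta>'\<close> compensates.\<close>

sublocale refinable_seminorm_family Y q
proof
  fix \<C> :: "(nat \<Rightarrow> 'a \<Rightarrow> real) set set" and R \<delta> :: real and k
  assume base: "convex_base \<C>" and sub: "\<And>C. C \<in> \<C> \<Longrightarrow> C \<subseteq> {x \<in> carrier. total x \<le> R}" and \<delta>: "\<delta> > 0"
  obtain n m where k: "k = prod_encode (n, m)" by (metis prod_decode_inverse surj_pair)
  let ?\<Psi> = "\<lambda>C :: (nat \<Rightarrow> 'a \<Rightarrow> real) set. (\<lambda>f. f n) ` C"
  define \<delta>' where "\<delta>' = \<delta> / 2 / 2 ^ m"
  have "\<delta>' > 0" using \<delta> by (simp add: \<delta>'_def)
  have lin: "linear (\<lambda>f :: nat \<Rightarrow> 'a \<Rightarrow> real. f n)"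
    by (rule linearI) (simp_all add: plus_fun_apply scaleR_fun_apply)
  have "\<exists>f. \<forall>C\<in>?\<Psi> ` \<C>. \<exists>y\<in>C. \<forall>s. \<bar>y s - f s\<bar> \<le> \<delta>'"
  proof (rule convexly_compactD[OF convexly_compact_gauge_ball[of "\<psi> n" R]])
    show "convexly_compact (orbit_hull (\<psi> n))" using \<psi>_tame[of n] by (simp add: tame_def)
    show "convex_base (?\<Psi> ` \<C>)"
      by (rule convex_base_image[OF base])
        (use convex_linear_image[OF lin] convex_baseD(2,3)[OF base] in auto)
    fix C assume "C \<in> ?\<Psi> ` \<C>"
    then obtain D where D: "D \<in> \<C>" "C = ?\<Psi> D" by blast
    show "C \<subseteq> {\<xi> \<in> linf. \<forall>m. gauge_norm (\<psi> n) m \<xi> \<le> R}"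
    proof
      fix \<xi> assume "\<xi> \<in> C"
      then obtain f where f: "f \<in> D" "\<xi> = f n" using D by blast
      then have fc: "f \<in> carrier" "total f \<le> R" using sub[OF D(1)] by auto
      have "gauge_norm (\<psi> n) m \<xi> \<le> R" for m
        using q_le_total[OF fc(1), of "prod_encode (n, m)"] fc(2) unfolding q_encode f(2) by linarith
      then show "\<xi> \<in> {\<xi> \<in> linf. \<forall>m. gauge_norm (\<psi> n) m \<xi> \<le> R}"
        using Y_linf[OF carrier_Y[OF fc(1)]] f(2) by simp
    qed
  qed (rule \<open>\<delta>' > 0\<close>)
  then obtain f where f: "\<forall>C\<in>?\<Psi> ` \<C>. \<exists>y\<in>C. \<forall>s. \<bar>y s - f s\<bar> \<le> \<delta>'" by (rule exE)
  define B where "B = (\<lambda>g :: nat \<Rightarrow> 'a \<Rightarrow> real. g n) -` {y. \<forall>s. \<bar>y s - f s\<bar> \<le> \<delta>'}"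
  have "convex B" unfolding B_def by (rule convex_linear_vimage[OF lin convex_uniform_ball])
  moreover have "C \<inter> B \<noteq> {}" if C: "C \<in> \<C>" for C
  proof -
    obtain y where "y \<in> ?\<Psi> C" "\<forall>s. \<bar>y s - f s\<bar> \<le> \<delta>'" using bspec[OF f imageI[OF C]] by blast
    then obtain g where "g \<in> C" "\<forall>s. \<bar>g n s - f s\<bar> \<le> \<delta>'" by blast
    then have "g \<in> C \<inter> B" by (simp add: B_def)
    then show ?thesis by blast
  qed
  moreover have "q k (y - z) \<le> \<delta>" if "y \<in> B" "z \<in> B" for y z
  proof -
    have near: "\<bar>y n s - f s\<bar> \<le> \<delta>'" "\<bar>z n s - f s\<bar> \<le> \<delta>'" for s using that by (auto simp: B_def)
    have "\<bar>y n s - z n s\<bar> \<le> 2 * \<delta>'" for s using near(1)[of s] near(2)[of s] by linarith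
    then have "q k (y - z) \<le> 2 ^ m * (2 * \<delta>')"
      unfolding k q_encode by (intro gauge_norm_bound_le) (simp add: fun_diff_def)
    then show ?thesis by (simp add: \<delta>'_def)
  qed
  ultimately show "\<exists>B. convex B \<and> (\<forall>C\<in>\<C>. C \<inter> B \<noteq> {}) \<and> (\<forall>y\<in>B \<inter> Y. \<forall>z\<in>B \<inter> Y. q k (y - z) \<le> \<delta>)"
    by (intro exI[of _ B]) blast
qed

section \<open>The affine action: isometry, continuity and properness\<close>

definition rep :: "'a \<Rightarrow> (nat \<Rightarrow> 'a \<Rightarrow> real) \<Rightarrow> nat \<Rightarrow> 'a \<Rightarrow> real"
  where "rep g f = (\<lambda>n. translate g (f n))"

text \<open>Formally the coboundary of the sequence \<open>\<psi>\<close>. Since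
  \<open>\<psi> n 0 = 1\<close> for all \<open>n\<close>, this sequence is not square summable and
  lies outside \<open>carrier\<close>, which leaves room for an unbounded cocycle.\<close>

definition cocycle :: "'a \<Rightarrow> nat \<Rightarrow> 'a \<Rightarrow> real"
  where "cocycle g = (\<lambda>n. translate g (\<psi> n) - \<psi> n)"

definition act :: "'a \<Rightarrow> (nat \<Rightarrow> 'a \<Rightarrow> real) \<Rightarrow> nat \<Rightarrow> 'a \<Rightarrow> real"
  where "act g f = rep g f + cocycle g"

lemma rep_plus: "rep g (f + f') = rep g f + rep g f'"
  by (simp add: rep_def fun_eq_iff plus_fun_apply translate_plus)

lemma rep_scaleR: "rep g (c *\<^sub>R f) = c *\<^sub>R rep g f"
  by (simp add: rep_def fun_eq_iff scaleR_fun_apply translate_scaleR)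

lemma rep_minus: "rep g (f - f') = rep g f - rep g f'"
  using rep_plus[of g f "- f'"] rep_scaleR[of g "- 1" f'] by simp

lemma rep_add: "rep (g + h) f = rep g (rep h f)"
  by (simp add: rep_def translate_add)

lemma rep_0 [simp]: "rep 0 f = f"
  by (simp add: rep_def)

lemma cocycle_add: "cocycle (g + h) = rep g (cocycle h) + cocycle g"
proof
  fix n
  show "cocycle (g + h) n = (rep g (cocycle h) + cocycle g) n"
    unfolding cocycle_def rep_def plus_fun_apply translate_minus translate_add by (simp add: fun_diff_def)
qed

lemma act_add: "act (g + h) f = act g (act h f)"
  by (simp add: act_def rep_add cocycle_add rep_plus add.assoc)

lemma act_diff: "act g f - act g f' = rep g (f - f')"
  by (simp add: act_def rep_minus)

lemma rep_Y: "f \<in> Y \<Longrightarrow> rep g f \<in> Y"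
  by (simp add: Y_def rep_def smooth_translate)

lemma q_rep: "f \<in> Y \<Longrightarrow> q k (rep g f) = q k f"
  unfolding q_def rep_def by (rule gauge_norm_translate[OF Y_linf])

lemma rep_carrier: "f \<in> carrier \<Longrightarrow> rep g f \<in> carrier"
  by (simp add: carrier_def rep_Y q_rep)

lemma total_rep: "f \<in> carrier \<Longrightarrow> total (rep g f) = total f"
  by (simp add: total_def q_rep carrier_Y)

lemma cocycle_Y: "cocycle g \<in> Y"
  unfolding Y_def cocycle_def using subspace_smooth \<psi>_smooth smooth_translate by (auto intro: subspace_diff)

text \<open>
  The two bounds on \<open>cocycle g n\<close>, by \<open>1 / 2 ^ m\<close> in the gauge of the orbit and by
  \<open>1 / 16 ^ n\<close> in the uniform norm, interpolate to a bound which is summable in \<open>(n, m)\<close>.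
\<close>

lemma q_cocycle_bound:
  assumes g: "d g 0 \<le> real R"
  shows "(q k (cocycle g))\<^sup>2 \<le> 4 ^ R * ((1/2) ^ snd (prod_decode k) * (1/4) ^ fst (prod_decode k))"
proof -
  obtain n m where k: "k = prod_encode (n, m)" by (metis prod_decode_inverse surj_pair)
  have nn: "0 \<le> q k (cocycle g)" by (rule q_nonneg[OF cocycle_Y])
  have b1: "q k (cocycle g) \<le> 1 / 2 ^ m"
    unfolding k q_encode cocycle_def by (rule gauge_norm_orbit_difference)
  have sq1: "(q k (cocycle g))\<^sup>2 \<le> (1/2) ^ m * (1/2) ^ m"
    using power_mono[OF b1 nn, of 2] by (simp add: power2_eq_square power_one_over)
  have R1: "(1::real) \<le> 4 ^ R" by simp
  have "(q k (cocycle g))\<^sup>2 \<le> 4 ^ R * ((1/2) ^ m * (1/4) ^ n)"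
  proof (cases "n < R")
    case True
    have "(1/2::real) ^ m \<le> 1" by (simp add: power_le_one)
    also have "1 = (4::real) ^ n * (1/4) ^ n" by (simp add: power_one_over)
    also have "\<dots> \<le> 4 ^ R * (1/4) ^ n" using True by (intro mult_right_mono power_increasing) auto
    finally have "(1/2) ^ m * (1/2) ^ m \<le> (1/2::real) ^ m * (4 ^ R * (1/4) ^ n)" by (intro mult_left_mono) auto
    also have "\<dots> = 4 ^ R * ((1/2) ^ m * (1/4) ^ n)" by (rule mult.left_commute)
    finally show ?thesis using sq1 by linarith
  next
    case False
    have "(q k (cocycle g))\<^sup>2 \<le> (1/2) ^ m * (1/4) ^ n"
    proof (cases "2 * n \<le> m")
      case True
      have "(1/2::real) ^ m \<le> (1/2) ^ (2 * n)" using True by (intro power_decreasing) auto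
      also have "\<dots> = (1/4) ^ n" by (simp add: power_mult power2_eq_square)
      finally have "(1/2) ^ m * (1/2) ^ m \<le> (1/2::real) ^ m * (1/4) ^ n" by (intro mult_left_mono) auto
      then show ?thesis using sq1 by linarith
    next
      case m: False
      have "d g 0 \<le> real n" using g False by linarith
      then have "q k (cocycle g) \<le> 2 ^ m * (1 / 16 ^ n)"
        unfolding k q_encode cocycle_def
        by (intro gauge_norm_bound_le) (use \<psi>_slow in \<open>simp add: fun_diff_def\<close>)
      from power_mono[OF this nn, of 2]
      have "(q k (cocycle g))\<^sup>2 \<le> 4 ^ m * (1/256) ^ n"
        by (simp add: power_mult_distrib power2_eq_square power_one_over flip: power_mult_distrib)
      \<comment> \<open>Here the rate \<open>16\<close> is used: for \<open>m < 2 * n\<close> the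
        factor \<open>8 ^ m\<close> is at most \<open>64 ^ n\<close>, and
        \<open>64 / 256 = 1 / 4\<close>.\<close>
      also have "4 ^ m = (1/2::real) ^ m * 8 ^ m" by (simp flip: power_mult_distrib)
      also have "(1/2::real) ^ m * 8 ^ m * (1/256) ^ n \<le> (1/2) ^ m * 8 ^ (2 * n) * (1/256) ^ n"
        using m by (intro mult_right_mono mult_left_mono power_increasing) auto
      also have "\<dots> = (1/2) ^ m * (1/4) ^ n"
        by (simp add: power_mult mult.assoc flip: power_mult_distrib)
      finally show ?thesis .
    qed
    also have "\<dots> \<le> 4 ^ R * ((1/2) ^ m * (1/4) ^ n)"
      using mult_right_mono[OF R1, of "(1/2) ^ m * (1/4) ^ n"] by simp
    finally show ?thesis .
  qed
  then show ?thesis by (simp add: k)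
qed

lemma cocycle_carrier: "cocycle g \<in> carrier"
proof -
  obtain R :: nat where "d g 0 \<le> real R" using real_arch_simple by blast
  from q_cocycle_bound[OF this]
  have "summable (\<lambda>k. (q k (cocycle g))\<^sup>2)"
    by (intro summable_comparison_test'[OF summable_mult[OF summable_geometric_pairs, of "4 ^ R"]]) auto
  then show ?thesis by (simp add: carrier_def cocycle_Y)
qed

lemma act_carrier: "f \<in> carrier \<Longrightarrow> act g f \<in> carrier"
  unfolding act_def by (intro carrier_add(1) rep_carrier cocycle_carrier)

text \<open>Dominated convergence for series. Tannery's theorem asks for domination jointly in the
  index and the parameter, hence the product filter in its premise.\<close>

lemma total_dominated_tendsto:
  fixes F :: "'c filter"
  assumes lim: "\<And>k. ((\<lambda>g. q k (x g)) \<longlongrightarrow> 0) F"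
    and dom: "eventually (\<lambda>g. \<forall>k. (q k (x g))\<^sup>2 \<le> D k) F" and D: "summable D"
  shows "((\<lambda>g. total (x g)) \<longlongrightarrow> 0) F"
proof (cases "F = bot")
  case False
  have "((\<lambda>g. \<Sum>k. (q k (x g))\<^sup>2) \<longlongrightarrow> (\<Sum>k. 0)) F"
  proof (rule tannerys_theorem[THEN conjunct2, THEN conjunct2])
    show "((\<lambda>g. (q k (x g))\<^sup>2) \<longlongrightarrow> 0) F" for k
      using tendsto_power[OF lim[of k], of 2] by simp
    have "eventually (\<lambda>p. \<forall>k. (q k (x (snd p)))\<^sup>2 \<le> D k) (at_top \<times>\<^sub>F F :: (nat \<times> 'c) filter)"
      using dom by (rule eventually_compose_filterlim) (rule filterlim_snd)
    then show "eventually (\<lambda>(k, g). norm ((q k (x g))\<^sup>2) \<le> D k) (at_top \<times>\<^sub>F F)"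
      by (rule eventually_mono) auto
  qed (use D False in auto)
  from tendsto_real_sqrt[OF this] show ?thesis by (simp add: total_def)
qed simp

text \<open>Stated on \<open>Y\<close> rather than on \<open>carrier\<close> so that it also applies
  to the sequence \<open>\<psi>\<close>, and thereby to the cocycle.\<close>

lemma q_translate_tendsto:
  assumes "f \<in> Y"
  shows "((\<lambda>g. gauge_norm (\<psi> n) m (translate g (f n) - f n)) \<longlongrightarrow> 0) (nhds 0)"
proof (rule tendstoI)
  fix \<epsilon> :: real assume "\<epsilon> > 0"
  then have "\<epsilon> / 2 / 2 ^ m > 0" by simp
  then have "eventually (\<lambda>g. \<forall>x. \<bar>translate g (f n) x - f n x\<bar> \<le> \<epsilon> / 2 / 2 ^ m) (nhds 0)"
    using assms unfolding Y_def smooth_def norm_continuous_def by blast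
  then show "eventually (\<lambda>g. dist (gauge_norm (\<psi> n) m (translate g (f n) - f n)) 0 < \<epsilon>) (nhds 0)"
  proof (rule eventually_mono)
    fix g assume *: "\<forall>x. \<bar>translate g (f n) x - f n x\<bar> \<le> \<epsilon> / 2 / 2 ^ m"
    have "gauge_norm (\<psi> n) m (translate g (f n) - f n) \<le> 2 ^ m * (\<epsilon> / 2 / 2 ^ m)"
      by (rule gauge_norm_bound_le) (use * in \<open>simp add: fun_diff_def\<close>)
    moreover have "0 \<le> gauge_norm (\<psi> n) m (translate g (f n) - f n)"
      by (intro gauge_norm_nonneg linf_diff linf_translate Y_linf assms)
    ultimately show "dist (gauge_norm (\<psi> n) m (translate g (f n) - f n)) 0 < \<epsilon>"
      using \<open>\<epsilon> > 0\<close> by (simp add: dist_real_def)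
  qed
qed

lemma total_rep_tendsto:
  assumes f: "f \<in> carrier"
  shows "((\<lambda>g. total (rep g f - f)) \<longlongrightarrow> 0) (nhds 0)"
proof (rule total_dominated_tendsto)
  have fY: "f \<in> Y" by (rule carrier_Y[OF f])
  show "((\<lambda>g. q k (rep g f - f)) \<longlongrightarrow> 0) (nhds 0)" for k
    using q_translate_tendsto[OF fY] by (simp add: q_def rep_def fun_diff_def)
  have "(q k (rep g f - f))\<^sup>2 \<le> 4 * (q k f)\<^sup>2" for g k
  proof -
    have "q k (rep g f - f) \<le> 2 * q k f"
      using q_diff_le[OF rep_Y[OF fY] fY, of k g] q_rep[OF fY] by simp
    from power_mono[OF this q_nonneg[OF Y_diff[OF rep_Y[OF fY] fY]], of 2]
    show ?thesis by (simp add: power_mult_distrib)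
  qed
  then show "eventually (\<lambda>g. \<forall>k. (q k (rep g f - f))\<^sup>2 \<le> 4 * (q k f)\<^sup>2) (nhds 0)" by simp
  show "summable (\<lambda>k. 4 * (q k f)\<^sup>2)" using f by (intro summable_mult) (simp add: carrier_def)
qed

lemma total_cocycle_tendsto: "((\<lambda>g. total (cocycle g)) \<longlongrightarrow> 0) (nhds 0)"
proof (rule total_dominated_tendsto)
  have "\<psi> \<in> Y" using \<psi>_smooth by (simp add: Y_def)
  then show "((\<lambda>g. q k (cocycle g)) \<longlongrightarrow> 0) (nhds 0)" for k
    using q_translate_tendsto by (simp add: q_def cocycle_def)
  have "eventually (\<lambda>g. d 0 g < 1) (nhds 0)" unfolding eventually_nhds_d by (auto intro!: exI[of _ 1])
  then show "eventually (\<lambda>g. \<forall>k. (q k (cocycle g))\<^sup>2 \<le>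
      4 ^ 1 * ((1/2) ^ snd (prod_decode k) * (1/4) ^ fst (prod_decode k))) (nhds 0)"
  proof (rule eventually_mono, intro allI)
    fix g k assume "d 0 g < 1"
    then have "d g 0 \<le> real 1" using commute[of 0 g] by simp
    then show "(q k (cocycle g))\<^sup>2 \<le> 4 ^ 1 * ((1/2) ^ snd (prod_decode k) * (1/4) ^ fst (prod_decode k))"
      by (rule q_cocycle_bound)
  qed
  show "summable (\<lambda>k. 4 ^ 1 * ((1/2) ^ snd (prod_decode k) * (1/4) ^ fst (prod_decode k)) :: real)"
    by (rule summable_mult[OF summable_geometric_pairs])
qed

lemma affine_isometric_act: "affine_isometric_action carrier total act"
  unfolding affine_isometric_action_def
proof (intro conjI exI allI ballI)
  show "act g \<xi> \<in> carrier" if "\<xi> \<in> carrier" for g \<xi> by (rule act_carrier[OF that])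
  show "act 0 \<xi> = \<xi>" if "\<xi> \<in> carrier" for \<xi> by (simp add: act_def cocycle_def zero_fun_def fun_eq_iff)
  show "act (g + f) \<xi> = act g (act f \<xi>)" for g f \<xi> by (rule act_add)
  show "cocycle g \<in> carrier" for g by (rule cocycle_carrier)
  show "cocycle (g + f) = rep g (cocycle f) + cocycle g" for g f by (rule cocycle_add)
  show "act g \<xi> = rep g \<xi> + cocycle g" for g \<xi> by (rule act_def)
  have bij: "bij_betw (rep g) carrier carrier" for g
    by (rule bij_betw_byWitness[where f' = "rep (- g)"]) (auto simp: rep_carrier simp flip: rep_add)
  show "isometric_representation carrier total rep"
    unfolding isometric_representation_def linear_map_on_def
    using bij by (auto simp: rep_carrier total_rep rep_plus rep_scaleR rep_add)
qed

text \<open>Each \<open>act g\<close> is an isometry, so joint continuity reduces to continuity at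
  the unit of \<open>h \<mapsto> act h \<xi>0\<close>, which splits into the linear part and the
  cocycle.\<close>

lemma continuous_act: "continuous_action carrier total act"
proof -
  interpret M: Metric_space carrier "norm_dist carrier total" by (rule Metric_space_norm_dist[OF normed])
  show ?thesis
    unfolding continuous_action_def M.continuous_map_to_metric
  proof (intro ballI allI impI)
    fix p :: "'a \<times> (nat \<Rightarrow> 'a \<Rightarrow> real)" and \<epsilon> :: real
    assume "p \<in> topspace (prod_topology euclidean M.mtopology)" and \<epsilon>: "\<epsilon> > 0"
    then obtain g0 \<xi>0 where p: "p = (g0, \<xi>0)" "\<xi>0 \<in> carrier" by auto
    have "((\<lambda>h. total (rep h \<xi>0 - \<xi>0) + total (cocycle h)) \<longlongrightarrow> 0 + 0) (nhds 0)"
      by (intro tendsto_add total_rep_tendsto total_cocycle_tendsto p)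
    then have "eventually (\<lambda>h. total (rep h \<xi>0 - \<xi>0) + total (cocycle h) < \<epsilon> / 2) (nhds 0)"
      using \<epsilon> by (intro order_tendstoD) auto
    moreover have "((\<lambda>g. - g0 + g) \<longlongrightarrow> - g0 + g0) (nhds g0)"
      by (intro tendsto_add tendsto_const filterlim_ident)
    then have "filterlim (\<lambda>g. - g0 + g) (nhds 0) (nhds g0)" by simp
    ultimately have "eventually (\<lambda>g. total (rep (- g0 + g) \<xi>0 - \<xi>0) + total (cocycle (- g0 + g)) < \<epsilon> / 2) (nhds g0)"
      by (rule eventually_compose_filterlim)
    then obtain U where U: "open U" "g0 \<in> U"
      "\<And>g. g \<in> U \<Longrightarrow> total (rep (- g0 + g) \<xi>0 - \<xi>0) + total (cocycle (- g0 + g)) < \<epsilon> / 2"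
      unfolding eventually_nhds by blast
    let ?W = "U \<times> M.mball \<xi>0 (\<epsilon> / 2)"
    have "openin (prod_topology euclidean M.mtopology) ?W"
      using U(1) by (simp add: openin_prod_Times_iff)
    moreover have "p \<in> ?W" using p U(2) \<epsilon> by simp
    moreover have "(case y of (g, \<xi>) \<Rightarrow> act g \<xi>) \<in> M.mball (case p of (g, \<xi>) \<Rightarrow> act g \<xi>) \<epsilon>" if yW: "y \<in> ?W" for y
    proof -
      obtain g \<xi> where y: "y = (g, \<xi>)" "g \<in> U" "\<xi> \<in> carrier" "norm_dist carrier total \<xi>0 \<xi> < \<epsilon> / 2"
        using yW by (cases y) auto
      \<comment> \<open>Writing \<open>g\<close> as \<open>g0 + ?h\<close> puts the small factor on
        the right, where the isometry \<open>act g0\<close> can be removed.\<close>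
      let ?h = "- g0 + g"
      have g: "g = g0 + ?h" by (simp add: add.assoc[symmetric])
      have "total (act g \<xi>0 - act g \<xi>) < \<epsilon> / 2"
        using y(3,4) p(2) subspace total_rep[of "\<xi>0 - \<xi>" g]
        by (simp add: act_diff norm_dist_def subspace_diff)
      moreover have "total (act g0 \<xi>0 - act g \<xi>0) < \<epsilon> / 2"
      proof -
        have "act g \<xi>0 = act g0 (act ?h \<xi>0)" using act_add[of g0 ?h \<xi>0] g by simp
        then have "total (act g0 \<xi>0 - act g \<xi>0) = total (\<xi>0 - act ?h \<xi>0)"
          using p(2) subspace act_carrier[OF p(2)] by (simp add: act_diff total_rep subspace_diff)
        also have "\<dots> = total (act ?h \<xi>0 - \<xi>0)" using p(2) act_carrier[OF p(2)] by (rule norm_minus_commute)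
        also have "act ?h \<xi>0 - \<xi>0 = (rep ?h \<xi>0 - \<xi>0) + cocycle ?h" by (simp add: act_def)
        also have "total \<dots> \<le> total (rep ?h \<xi>0 - \<xi>0) + total (cocycle ?h)"
          using p(2) rep_carrier cocycle_carrier subspace by (intro carrier_add(2)) (auto intro: subspace_diff)
        also have "\<dots> < \<epsilon> / 2" by (rule U(3)[OF y(2)])
        finally show ?thesis .
      qed
      ultimately have "total (act g0 \<xi>0 - act g \<xi>) < \<epsilon>"
        using norm_triangle4[OF act_carrier[OF p(2)] act_carrier[OF p(2)] act_carrier[OF y(3)], of g0 g g] by linarith
      then show ?thesis using p y act_carrier by (simp add: norm_dist_def)
    qed
    ultimately show "\<exists>U. openin (prod_topology euclidean M.mtopology) U \<and> p \<in> U \<and>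
        (\<forall>y\<in>U. (case y of (g, \<xi>) \<Rightarrow> act g \<xi>) \<in> M.mball (case p of (g, \<xi>) \<Rightarrow> act g \<xi>) \<epsilon>)" by blast
  qed
qed

text \<open>If \<open>g\<close> has left the support of \<open>\<psi> n\<close>, evaluation at the
  unit gives \<open>cocycle g n 0 = - 1\<close>. The seminorm of scale \<open>0\<close> sees this as
  \<open>1/2\<close>, and \<open>L\<close> such coordinates add up in square norm.\<close>

lemma total_cocycle_ge:
  assumes "\<And>n. n < L \<Longrightarrow> S n < d g 0"
  shows "sqrt (real L) / 2 \<le> total (cocycle g)"
proof -
  have half: "1/2 \<le> q (prod_encode (n, 0)) (cocycle g)" if "n < L" for n
  proof -
    have "d (- g) 0 > S n" using assms[OF that] by (simp add: d_minus)
    then have "\<psi> n (- g) = 0" using \<psi>_supp[of n "- g"] by fastforce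
    then have "\<bar>cocycle g n 0\<bar> = 1" by (simp add: cocycle_def translate_def fun_diff_def \<psi>_0)
    then show ?thesis
      using bound_le_gauge_norm[of "\<psi> n" "cocycle g n" 0] \<psi>_bound Y_linf[OF cocycle_Y] by (simp add: q_encode)
  qed
  have "real L / 4 = (\<Sum>n<L. (1/2)\<^sup>2)" by (simp add: power2_eq_square)
  also have "\<dots> \<le> (\<Sum>n<L. (q (prod_encode (n, 0)) (cocycle g))\<^sup>2)"
    using half by (intro sum_mono power_mono) auto
  also have "\<dots> = (\<Sum>k\<in>(\<lambda>n. prod_encode (n, 0)) ` {..<L}. (q k (cocycle g))\<^sup>2)"
    by (subst sum.reindex) (auto simp: inj_on_def)
  also have "\<dots> \<le> (\<Sum>k. (q k (cocycle g))\<^sup>2)"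
    using cocycle_carrier[of g] by (intro sum_le_suminf) (auto simp: carrier_def)
  finally have "sqrt (real L / 4) \<le> total (cocycle g)" unfolding total_def by (rule real_sqrt_le_mono)
  then show ?thesis by (simp add: real_sqrt_divide)
qed

lemma metrically_proper_act:
  assumes "metrically_proper_metric d"
  shows "metrically_proper_action carrier total act"
  unfolding metrically_proper_action_def
proof (intro ballI allI impI)
  fix \<xi> and g :: "nat \<Rightarrow> 'a" assume \<xi>: "\<xi> \<in> carrier" and "tends_to_infinity g"
  then have inf: "filterlim (\<lambda>n. d (g n) 0) at_top sequentially"
    using assms unfolding metrically_proper_metric_def by blast
  show "filterlim (\<lambda>n. total (act (g n) \<xi> - \<xi>)) at_top sequentially"
    unfolding filterlim_at_top
  proof
    fix Z :: real
    \<comment> \<open>Moving the base point from \<open>0\<close> to \<open>\<xi>\<close> changes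
      the displacement by at most \<open>2 * total \<xi>\<close>; \<open>L\<close> is the number of
      supports to be left so that the cocycle still exceeds \<open>Z\<close> by that amount.\<close>
    obtain L :: nat where L: "(2 * (\<bar>Z\<bar> + 2 * total \<xi>))\<^sup>2 \<le> real L" using real_arch_simple by blast
    have tx: "total \<xi> \<ge> 0" by (rule total_nonneg[OF \<xi>])
    have "2 * (\<bar>Z\<bar> + 2 * total \<xi>) \<le> sqrt (real L)" using L tx by (intro real_le_rsqrt)
    then have LZ: "Z + 2 * total \<xi> \<le> sqrt (real L) / 2"
      using abs_ge_self[of Z] by (simp add: field_simps)
    have "eventually (\<lambda>n. \<forall>i\<in>{..<L}. S i < d (g n) 0) sequentially"
      by (intro eventually_ball_finite ballI filterlim_at_top_dense[THEN iffD1, rule_format] inf) simp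
    then show "eventually (\<lambda>n. Z \<le> total (act (g n) \<xi> - \<xi>)) sequentially"
    proof (rule eventually_mono)
      fix n assume "\<forall>i\<in>{..<L}. S i < d (g n) 0"
      then have big: "sqrt (real L) / 2 \<le> total (cocycle (g n))" by (intro total_cocycle_ge) auto
      have "cocycle (g n) = (act (g n) \<xi> - \<xi>) + (\<xi> - rep (g n) \<xi>)" by (simp add: act_def)
      then have "total (cocycle (g n)) \<le> total (act (g n) \<xi> - \<xi>) + total (\<xi> - rep (g n) \<xi>)"
        using carrier_add(2)[of "act (g n) \<xi> - \<xi>" "\<xi> - rep (g n) \<xi>"] \<xi> act_carrier rep_carrier subspace
        by (simp add: subspace_diff)
      also have "total (\<xi> - rep (g n) \<xi>) \<le> 2 * total \<xi>"
        using norm_triangle_diff[OF \<xi> rep_carrier[OF \<xi>]] total_rep[OF \<xi>] by simp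
      finally show "Z \<le> total (act (g n) \<xi> - \<xi>)" using big LZ by linarith
    qed
  qed
qed

end

theorem theorem4:
  fixes d :: "'a::topological_group_add \<Rightarrow> 'a \<Rightarrow> real"
  assumes "metrically_proper_metric d"
    and "\<And>\<alpha>. \<alpha> > 0 \<Longrightarrow>
      \<exists>\<phi> :: 'a \<Rightarrow> real.
        continuous_on UNIV \<phi> \<and> weakly_almost_periodic \<phi> \<and>
        Metric_space.mbounded UNIV d {g. \<phi> g \<noteq> 0} \<and>
        (\<forall>g. d g 0 \<le> \<alpha> \<longrightarrow> \<phi> g = 1)"
  shows "\<exists>(V :: (nat \<Rightarrow> 'a \<Rightarrow> real) set) N
      (\<alpha> :: 'a \<Rightarrow> (nat \<Rightarrow> 'a \<Rightarrow> real) \<Rightarrow> (nat \<Rightarrow> 'a \<Rightarrow> real)).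
    banach_space_on V N \<and> reflexive_on V N \<and>
    affine_isometric_action V N \<alpha> \<and> continuous_action V N \<alpha> \<and>
    metrically_proper_action V N \<alpha>"
proof -
  interpret compatible_group_metric d
    using assms(1) by unfold_locales (simp_all add: metrically_proper_metric_def)
  have "\<forall>n. \<exists>\<psi> S. tame \<psi> \<and> (\<forall>x. \<bar>\<psi> x\<bar> \<le> 1) \<and> \<psi> 0 = 1 \<and> (\<forall>x. \<psi> x \<noteq> 0 \<longrightarrow> d x 0 \<le> S) \<and>
    (\<forall>g x. d g 0 \<le> real n \<longrightarrow> \<bar>translate g \<psi> x - \<psi> x\<bar> \<le> 1 / real (16 ^ n))"
    by (intro allI slowly_varying_cutoff[OF assms(2)]) auto
  then obtain \<psi> S where \<psi>: "\<And>n. tame (\<psi> n) \<and> (\<forall>x. \<bar>\<psi> n x\<bar> \<le> 1) \<and> \<psi> n 0 = 1 \<and> (\<forall>x. \<psi> n x \<noteq> 0 \<longrightarrow> d x 0 \<le> S n) \<and>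
    (\<forall>g x. d g 0 \<le> real n \<longrightarrow> \<bar>translate g (\<psi> n) x - \<psi> n x\<bar> \<le> 1 / real (16 ^ n))" by metis
  interpret cutoff_sequence d \<psi> S
    by unfold_locales (use \<psi> in auto)
  show ?thesis
    using banach_space_carrier reflexive_carrier affine_isometric_act continuous_act
      metrically_proper_act[OF assms(1)] by blast
qed

end
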